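(* Let $n\ge 1$. Let $q\in[1,\infty)$, $c\in(0,\infty]$, $\mathbf{B}=(\beta_0,\beta_\infty)\in\mathbb{R}^2$ be such that either $q=c=1$ and $\mathbf{B}=(0,0)$, or $1<q<\infty$ and $0<c\le\infty$ (with $\mathbf{B}\in\mathbb{R}^2$ arbitrary). Let $0<b\le\infty$ and $\mathbf{A}=(\alpha_0,\alpha_\infty)\in\mathbb{R}^2$ with $\alpha_0<-\frac1b<\alpha_\infty$. Then there is a constant $C>0$, independent of $R$ and $f$, such that for all $R>0$ and all $f\in L^R_{q,c;\mathbf{B}}$ $$\|f\|_{\infty,b;\mathbf{A}}\le C\,R^{\frac nq}\,l^{\left(\overleftarrow{\mathbf{A}}-\overleftarrow{\mathbf{B}}+\frac1b\right)}(R)\,\|f\|_{q,c;\mathbf{B}}.$$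
   Context: Convention: $1/\infty=0$. For a pair $\mathbf{A}=(\alpha_0,\alpha_\infty)\in\mathbb{R}^2$ put $\overleftarrow{\mathbf{A}}=(\alpha_\infty,\alpha_0)$ and, for $\sigma\in\mathbb{R}$, $\mathbf{A}+\sigma=(\alpha_0+\sigma,\alpha_\infty+\sigma)$; pairs are added and subtracted componentwise. The broken-logarithmic function is $l^{\mathbf{A}}(t)=(1+|\ln t|)^{\alpha_0}$ for $0<t\le 1$ and $l^{\mathbf{A}}(t)=(1+|\ln t|)^{\alpha_\infty}$ for $t>1$. Functions are complex-valued, measurable on $\mathbb{R}^n$ with Lebesgue measure; $f^*$ is the non-increasing rearrangement of $f$. For $0<p,b\le\infty$, the Lorentz–Zygmund space $L_{p,b;\mathbf{A}}=L_{p,b;\mathbf{A}}(\mathbb{R}^n)$ consists of all measurable $f$ with $$\|f\|_{p,b;\mathbf{A}}:=\left\|t^{\frac1p-\frac1b}\,l^{\mathbf{A}}(t)\,f^*(t)\right\|_{L_b(0,\infty)}<\infty,$$ where $\|\cdot\|_{L_b(0,\infty)}$ is the usual Lebesgue (quasi-)norm in $t$. $S'$ is the space of tempered distributions on $\mathbb{R}^n$ and $\hat f$ is the Fourier transform of $f\in S'$, extending $\hat f(\xi)=\int e^{-2\pi i x\xi}f(x)\,dx$. For $0<R<\infty$, $B_R=\{\xi\in\mathbb{R}^n:|\xi|\le R\}$ and $L^R_{q,c;\mathbf{B}}=\{f\in L_{q,c;\mathbf{B}}\cap S':\operatorname{supp}\hat f\subset B_R\}$. The constant $C$ may depend on $b,\mathbf{A},q,c,\mathbf{B}$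 and the fixed dimension $n$. *)

theory Defs
  imports "HOL-Analysis.Analysis" "HOL-Probability.Essential_Supremum"
begin

section \<open>Lorentz--Zygmund spaces\<close>

text \<open>Exponents in $(0,\infty]$ are modelled by positive elements of \<^typ>\<open>ennreal\<close>;
  since \<open>inverse \<infinity> = 0\<close> there, \<open>recip\<close> respects the convention $1/\infty = 0$.\<close>

definition recip :: "ennreal \<Rightarrow> real" where
  "recip p = enn2real (inverse p)"

definition broken_log :: "real \<times> real \<Rightarrow> real \<Rightarrow> real" where
  "broken_log A t = (1 + \<bar>ln t\<bar>) powr (if t \<le> 1 then fst A else snd A)"

definition rearrangement :: "(real ^ 'n \<Rightarrow> complex) \<Rightarrow> real \<Rightarrow> ennreal" where
  "rearrangement f t =
     Inf {ennreal s |s. 0 \<le> s \<and> emeasure lebesgue {x. s < norm (f x)} \<le> ennreal t}"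

text \<open>Only used for exponents \<open>a > 0\<close>.\<close>

definition ennreal_powr :: "ennreal \<Rightarrow> real \<Rightarrow> ennreal" where
  "ennreal_powr x a = (if x = \<infinity> then \<infinity> else ennreal (enn2real x powr a))"

definition Lp_qnorm :: "ennreal \<Rightarrow> 'a measure \<Rightarrow> ('a \<Rightarrow> ennreal) \<Rightarrow> ennreal" where
  "Lp_qnorm b M g =
     (if b = \<infinity> then esssup M g
      else ennreal_powr (\<integral>\<^sup>+ t. ennreal_powr (g t) (enn2real b) \<partial>M) (recip b))"

definition LZ_qnorm ::
    "ennreal \<Rightarrow> ennreal \<Rightarrow> real \<times> real \<Rightarrow> (real ^ 'n \<Rightarrow> complex) \<Rightarrow> ennreal" where
  "LZ_qnorm p b A f =
     Lp_qnorm b (lebesgue_on {0<..})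
       (\<lambda>t. ennreal (t powr (recip p - recip b) * broken_log A t) * rearrangement f t)"

definition LZ_space ::
    "ennreal \<Rightarrow> ennreal \<Rightarrow> real \<times> real \<Rightarrow> (real ^ 'n \<Rightarrow> complex) set" where
  "LZ_space p b A = {f \<in> borel_measurable lebesgue. LZ_qnorm p b A f < \<infinity>}"

section \<open>Tempered distributions\<close>

definition partial_deriv :: "'n \<Rightarrow> (real ^ 'n \<Rightarrow> complex) \<Rightarrow> real ^ 'n \<Rightarrow> complex" where
  "partial_deriv i f x = vector_derivative (\<lambda>t. f (x + t *\<^sub>R axis i 1)) (at 0)"

primrec iter_partial :: "'n list \<Rightarrow> (real ^ 'n \<Rightarrow> complex) \<Rightarrow> real ^ 'n \<Rightarrow> complex" where
  "iter_partial [] f = f"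
| "iter_partial (i # is) f = partial_deriv i (iter_partial is f)"

text \<open>Total differentiability of every iterated partial derivative makes all of them
  continuous, so this is the class $C^\infty$.\<close>

definition smooth :: "(real ^ 'n \<Rightarrow> complex) \<Rightarrow> bool" where
  "smooth f \<longleftrightarrow> (\<forall>is. iter_partial is f differentiable_on UNIV)"

definition schwartz :: "(real ^ 'n \<Rightarrow> complex) set" where
  "schwartz = {\<phi>. smooth \<phi> \<and>
     (\<forall>k is. bounded (range (\<lambda>x. norm x ^ k * norm (iter_partial is \<phi> x))))}"

definition schwartz_seminorm :: "nat \<Rightarrow> 'n list \<Rightarrow> (real ^ 'n \<Rightarrow> complex) \<Rightarrow> real" where
  "schwartz_seminorm k is \<phi> = (SUP x. norm x ^ k * norm (iter_partial is \<phi> x))"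

definition schwartz_tendsto ::
    "(nat \<Rightarrow> real ^ 'n \<Rightarrow> complex) \<Rightarrow> (real ^ 'n \<Rightarrow> complex) \<Rightarrow> bool" where
  "schwartz_tendsto \<Phi> \<phi> \<longleftrightarrow>
     (\<forall>k is. (\<lambda>j. schwartz_seminorm k is (\<lambda>x. \<Phi> j x - \<phi> x)) \<longlonglongrightarrow> 0)"

definition supp :: "(real ^ 'n \<Rightarrow> complex) \<Rightarrow> (real ^ 'n) set" where
  "supp \<phi> = closure {x. \<phi> x \<noteq> 0}"

definition test_functions :: "(real ^ 'n \<Rightarrow> complex) set" where
  "test_functions = {\<phi>. smooth \<phi> \<and> compact (supp \<phi>)}"

text \<open>Functionals are total in HOL; only their values on \<open>schwartz\<close> are meaningful.
  The Schwartz space is metrizable, so continuity is sequential continuity.\<close>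

definition tempered :: "((real ^ 'n \<Rightarrow> complex) \<Rightarrow> complex) \<Rightarrow> bool" where
  "tempered T \<longleftrightarrow>
     (\<forall>\<phi>\<in>schwartz. \<forall>\<psi>\<in>schwartz. T (\<lambda>x. \<phi> x + \<psi> x) = T \<phi> + T \<psi>) \<and>
     (\<forall>a. \<forall>\<phi>\<in>schwartz. T (\<lambda>x. a * \<phi> x) = a * T \<phi>) \<and>
     (\<forall>\<Phi> \<phi>. (\<forall>j. \<Phi> j \<in> schwartz) \<longrightarrow> \<phi> \<in> schwartz \<longrightarrow> schwartz_tendsto \<Phi> \<phi>
        \<longrightarrow> (\<lambda>j. T (\<Phi> j)) \<longlonglongrightarrow> T \<phi>)"

text \<open>The function \<open>f\<close> is locally integrable and, as a distribution, is the restriction of \<open>T\<close>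
  to test functions. A tempered \<open>T\<close> is determined on \<open>schwartz\<close> by this property, test
  functions being dense.\<close>

definition represents ::
    "(real ^ 'n \<Rightarrow> complex) \<Rightarrow> ((real ^ 'n \<Rightarrow> complex) \<Rightarrow> complex) \<Rightarrow> bool" where
  "represents f T \<longleftrightarrow>
     (\<forall>K. compact K \<longrightarrow> set_integrable lebesgue K f) \<and>
     (\<forall>\<phi>\<in>test_functions. T \<phi> = (\<integral>x. f x * \<phi> x \<partial>lebesgue))"

definition fourier :: "(real ^ 'n \<Rightarrow> complex) \<Rightarrow> real ^ 'n \<Rightarrow> complex" where
  "fourier \<phi> \<xi> = (\<integral>x. exp (- 2 * of_real pi * \<i> * of_real (x \<bullet> \<xi>)) * \<phi> x \<partial>lebesgue)"

definition fourier_dist ::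
    "((real ^ 'n \<Rightarrow> complex) \<Rightarrow> complex) \<Rightarrow> (real ^ 'n \<Rightarrow> complex) \<Rightarrow> complex" where
  "fourier_dist T \<phi> = T (fourier \<phi>)"

definition dist_supp :: "((real ^ 'n \<Rightarrow> complex) \<Rightarrow> complex) \<Rightarrow> (real ^ 'n) set" where
  "dist_supp T =
     - \<Union>{U. open U \<and> (\<forall>\<phi>\<in>test_functions. supp \<phi> \<subseteq> U \<longrightarrow> T \<phi> = 0)}"

definition LZ_bandlimited ::
    "real \<Rightarrow> ennreal \<Rightarrow> ennreal \<Rightarrow> real \<times> real \<Rightarrow> (real ^ 'n \<Rightarrow> complex) set" where
  "LZ_bandlimited R q c B =
     {f \<in> LZ_space q c B.
        \<exists>T. tempered T \<and> represents f T \<and> dist_supp (fourier_dist T) \<subseteq> cball 0 R}"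

end

theory Submission
  imports Defs "HOL-Probability.Probability" "HOL-Real_Asymp.Real_Asymp"
begin

text \<open>Put $T = R^{-n}$. The norm of \<open>f\<close> in $L_{q,c;B}$ controls
  $f^*(t) \lesssim V(t) = t^{-1/q}\, l^{-B}(t)$ for all \<open>t > 0\<close>, and also
  $\int_0^T f^* \lesssim T\, V(T)$. If \<open>k\<close> is the inverse Fourier transform of a smooth cutoff that
  equals 1 near the ball of radius \<open>R\<close>, then $f = f * k$; splitting \<open>f\<close> at the level $f^*(T)$ and
  using $\|k\|_1 \lesssim 1$, $\|k\|_\infty \lesssim R^n$ gives the Nikolskii inequality
  $\|f\|_\infty \lesssim V(T)$. The theorem follows by integrating the first bound over
  \<open>t \<ge> T\<close> and the second one over \<open>t \<le> T\<close>.

  The identity $f = f * k$ is obtained by testing the distribution with tensor products of functions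
  of one variable only: these are stable under partial derivatives, under cutoffs, under the
  Fourier transform and under a partition of unity subordinate to boxes, and they determine \<open>f\<close>
  almost everywhere because they approximate indicators of boxes.\<close>

section \<open>Smooth functions of one real variable\<close>

text \<open>For \<open>t < T\<close> the bound \<open>V(t)\<close> cannot be integrated against the
  weight, because of the power \<open>t^(-1/q)\<close>; this is the range where the band limit has
  to be used, and there the rearrangement is replaced by a multiple of the constant
  \<open>V(T)\<close>. What remains, for finite \<open>b\<close>, is the integral of
  \<open>l^(bA)(t) / t\<close> over \<open>(0, T)\<close>. The condition on \<open>fst A\<close>
  makes it converge at 0, and the condition on \<open>snd A\<close> lets its upper end dominate when
  \<open>T > 1\<close>. It costs one factor \<open>1 + |ln T|\<close>, whose b-th root is the shift
  by \<open>1/b\<close> in the theorem; for \<open>b = \<infinity>\<close> the monotonicity of the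
  weight takes the place of the integral. The reversed pairs come from \<open>T = R^(-n)\<close>,
  which exchanges the two sides of 1. The alternative on \<open>q\<close>, \<open>c\<close> and
  \<open>B\<close> acts at one point, the bound for the integral of the rearrangement over
  \<open>(0, T)\<close>. Smoothness in one variable is coinductive, so that it is proved by
  exhibiting a class of functions closed under differentiation.\<close>

coinductive smooth1 :: "(real \<Rightarrow> complex) \<Rightarrow> bool" where
  "(\<And>x. (f has_vector_derivative f' x) (at x)) \<Longrightarrow> smooth1 f' \<Longrightarrow> smooth1 f"

definition D1 :: "(real \<Rightarrow> complex) \<Rightarrow> real \<Rightarrow> complex" where
  "D1 f x = vector_derivative f (at x)"

lemma D1_eqI: "(\<And>x. (f has_vector_derivative f' x) (at x)) \<Longrightarrow> D1 f = f'"
  by (rule ext) (simp add: D1_def vector_derivative_at)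

lemma smooth1_D1:
  assumes "smooth1 f"
  shows has_D1: "(f has_vector_derivative D1 f x) (at x)" and smooth1_D1_self: "smooth1 (D1 f)"
proof -
  from assms obtain f' where f': "\<And>x. (f has_vector_derivative f' x) (at x)" "smooth1 f'"
    by (cases rule: smooth1.cases) auto
  then have "D1 f = f'" by (intro D1_eqI)
  with f' show "(f has_vector_derivative D1 f x) (at x)" "smooth1 (D1 f)" by auto
qed

lemma smooth1_funpow_D1: "smooth1 f \<Longrightarrow> smooth1 ((D1 ^^ m) f)"
  by (induction m) (auto intro: smooth1_D1_self)

lemma smooth1_cont: "smooth1 f \<Longrightarrow> continuous_on S f"
  by (meson continuous_at_imp_continuous_on has_D1 has_vector_derivative_continuous)

lemma smooth1_measurable [measurable_dest]: "smooth1 f \<Longrightarrow> f \<in> borel_measurable borel"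
  by (intro borel_measurable_continuous_onI smooth1_cont)

lemma smooth1_const: "smooth1 (\<lambda>x. c)"
  by (coinduction arbitrary: c rule: smooth1.coinduct) (auto intro!: exI[of _ "\<lambda>x. 0"] derivative_eq_intros)

lemma smooth1_add:
  assumes "smooth1 f" "smooth1 g" shows "smooth1 (\<lambda>x. f x + g x)"
  using assms
proof (coinduction arbitrary: f g rule: smooth1.coinduct)
  case (smooth1 f g)
  then show ?case
    by (intro exI[of _ "\<lambda>x. f x + g x"] exI[of _ "\<lambda>x. D1 f x + D1 g x"])
      (auto intro!: has_vector_derivative_add has_D1 smooth1_D1_self)
qed

text \<open>Coinduction for \<open>smooth1\<close> asks for a class that differentiation maps into
  itself. Single products are not such a class, since the Leibniz rule gives a sum of two; finite
  sums of products are.\<close>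

inductive product_sum :: "(real \<Rightarrow> complex) \<Rightarrow> bool" where
  "smooth1 f \<Longrightarrow> smooth1 g \<Longrightarrow> product_sum (\<lambda>x. f x * g x)"
| "product_sum f \<Longrightarrow> product_sum g \<Longrightarrow> product_sum (\<lambda>x. f x + g x)"

lemma product_sum_deriv:
  "product_sum h \<Longrightarrow> \<exists>h'. (\<forall>x. (h has_vector_derivative h' x) (at x)) \<and> product_sum h'"
proof (induction rule: product_sum.induct)
  case (1 f g)
  then have "((\<lambda>x. f x * g x) has_vector_derivative (f x * D1 g x + D1 f x * g x)) (at x)" for x
    by (intro has_vector_derivative_mult has_D1)
  moreover have "product_sum (\<lambda>x. f x * D1 g x + D1 f x * g x)"
    using 1 by (intro product_sum.intros smooth1_D1_self)
  ultimately show ?case by (intro exI[of _ "\<lambda>x. f x * D1 g x + D1 f x * g x"]) auto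
next
  case (2 f g)
  then obtain f' g' where "\<forall>x. (f has_vector_derivative f' x) (at x)" "product_sum f'"
    "\<forall>x. (g has_vector_derivative g' x) (at x)" "product_sum g'" by blast
  then show ?case
    by (intro exI[of _ "\<lambda>x. f' x + g' x"]) (auto intro!: has_vector_derivative_add product_sum.intros)
qed

lemma smooth1_mult:
  assumes "smooth1 f" "smooth1 g" shows "smooth1 (\<lambda>x. f x * g x)"
proof -
  have "smooth1 h" if "product_sum h" for h
    using that by (coinduction arbitrary: h rule: smooth1.coinduct) (use product_sum_deriv in blast)
  then show ?thesis using assms product_sum.intros by blast
qed

lemma smooth1_cmult: "smooth1 f \<Longrightarrow> smooth1 (\<lambda>x. c * f x)"
  by (intro smooth1_mult smooth1_const)

lemma smooth1_diff: "smooth1 f \<Longrightarrow> smooth1 g \<Longrightarrow> smooth1 (\<lambda>x. f x - g x)"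
  using smooth1_add[of f "\<lambda>x. (-1) * g x"] smooth1_cmult[of g "-1"] by simp

lemma smooth1_ident: "smooth1 (\<lambda>x. of_real x)"
  by (rule smooth1.intros[of _ "\<lambda>x. 1"]) (auto intro!: derivative_eq_intros smooth1_const)

lemma smooth1_affine:
  assumes "smooth1 f" shows "smooth1 (\<lambda>x. f (a * x + b))"
proof -
  \<comment> \<open>Each differentiation pulls out a factor \<open>a\<close>, so the coinduction
    needs a free constant in front.\<close>
  have "smooth1 (\<lambda>x. c * f (a * x + b))" for c
    using assms
  proof (coinduction arbitrary: f c rule: smooth1.coinduct)
    case (smooth1 f c)
    have "((\<lambda>x. a * x + b) has_vector_derivative a) (at x)" for x
      by (simp add: has_real_derivative_iff_has_vector_derivative[symmetric]) (auto intro!: derivative_eq_intros)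
    then have "((\<lambda>x. f (a * x + b)) has_vector_derivative (a *\<^sub>R D1 f (a * x + b))) (at x)" for x
      using vector_diff_chain_at[of "\<lambda>x. a * x + b" a x f "D1 f (a * x + b)"] has_D1[OF smooth1]
      by (auto simp: o_def)
    then have "((\<lambda>x. c * f (a * x + b)) has_vector_derivative ((c * of_real a) * D1 f (a * x + b))) (at x)" for x
      by (auto intro!: derivative_eq_intros simp: scaleR_conv_of_real)
    then show ?case
      using smooth1 by (intro exI[of _ "\<lambda>x. c * f (a * x + b)"] exI[of _ "\<lambda>x. (c * of_real a) * D1 f (a * x + b)"])
        (auto intro!: smooth1_D1_self)
  qed
  from this[of 1] show ?thesis by simp
qed

lemma D1_add: "smooth1 f \<Longrightarrow> smooth1 g \<Longrightarrow> D1 (\<lambda>x. f x + g x) = (\<lambda>x. D1 f x + D1 g x)"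
  by (intro D1_eqI has_vector_derivative_add has_D1)

lemma D1_diff: "smooth1 f \<Longrightarrow> smooth1 g \<Longrightarrow> D1 (\<lambda>x. f x - g x) = (\<lambda>x. D1 f x - D1 g x)"
  by (intro D1_eqI has_vector_derivative_diff has_D1)

lemma D1_mult: "smooth1 f \<Longrightarrow> smooth1 g \<Longrightarrow> D1 (\<lambda>x. f x * g x) = (\<lambda>x. f x * D1 g x + D1 f x * g x)"
  by (intro D1_eqI has_vector_derivative_mult has_D1)

lemma D1_cmult: "smooth1 f \<Longrightarrow> D1 (\<lambda>x. c * f x) = (\<lambda>x. c * D1 f x)"
  by (intro D1_eqI) (auto intro!: derivative_eq_intros has_D1)

lemma D1_scale: "smooth1 f \<Longrightarrow> D1 (\<lambda>x. f (a * x)) = (\<lambda>x. of_real a * D1 f (a * x))"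
proof (rule D1_eqI)
  fix x assume "smooth1 f"
  moreover have "((\<lambda>x. a * x) has_vector_derivative a) (at x)"
    by (simp add: has_real_derivative_iff_has_vector_derivative[symmetric])
  ultimately show "((\<lambda>x. f (a * x)) has_vector_derivative of_real a * D1 f (a * x)) (at x)"
    using vector_diff_chain_at[of "\<lambda>x. a * x" a x f "D1 f (a * x)"] has_D1[of f "a * x"]
    by (auto simp: o_def scaleR_conv_of_real)
qed

lemma funpow_D1_add: "smooth1 f \<Longrightarrow> smooth1 g \<Longrightarrow>
    (D1 ^^ m) (\<lambda>x. f x + g x) = (\<lambda>x. (D1 ^^ m) f x + (D1 ^^ m) g x)"
  by (induction m) (simp_all add: D1_add smooth1_funpow_D1)

lemma funpow_D1_diff: "smooth1 f \<Longrightarrow> smooth1 g \<Longrightarrow>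
    (D1 ^^ m) (\<lambda>x. f x - g x) = (\<lambda>x. (D1 ^^ m) f x - (D1 ^^ m) g x)"
  by (induction m) (simp_all add: D1_diff smooth1_funpow_D1)

lemma funpow_D1_scale: "smooth1 f \<Longrightarrow>
    (D1 ^^ m) (\<lambda>x. f (a * x)) = (\<lambda>x. of_real a ^ m * (D1 ^^ m) f (a * x))"
proof (induction m)
  case (Suc m)
  have s: "smooth1 (\<lambda>x. (D1 ^^ m) f (a * x))"
    using smooth1_affine[OF smooth1_funpow_D1[OF Suc.prems], of m a 0] by simp
  have "(D1 ^^ Suc m) (\<lambda>x. f (a * x)) = (\<lambda>x. of_real a ^ m * (of_real a * (D1 ^^ Suc m) f (a * x)))"
    using Suc by (simp add: D1_cmult[OF s] D1_scale smooth1_funpow_D1)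
  then show ?case by (simp add: mult_ac)
qed simp

lemma funpow_D1_const: "(D1 ^^ Suc m) (\<lambda>x. c) = (\<lambda>x. 0)"
proof -
  have *: "D1 (\<lambda>x. d) = (\<lambda>x. 0)" for d by (rule D1_eqI) simp
  show ?thesis by (induction m) (simp_all add: *)
qed

section \<open>A flat exponential, a bump and a smooth step\<close>

definition flat_exp :: "real poly \<Rightarrow> real \<Rightarrow> complex" where
  "flat_exp p x = (if x > 0 then of_real (poly p (1 / x) * exp (- 1 / x)) else 0)"

lemma flat_exp_tendsto: "((\<lambda>h. poly p (1 / h) * exp (- 1 / h)) \<longlongrightarrow> (0::real)) (at_right 0)"
proof -
  have "((\<lambda>h. \<Sum>i\<le>degree p. coeff p i * ((1 / h) ^ i * exp (- 1 / h))) \<longlongrightarrow> (\<Sum>i\<le>degree p. coeff p i * 0)) (at_right (0::real))"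
  proof (intro tendsto_intros)
    fix i :: nat
    show "((\<lambda>h::real. (1 / h) ^ i * exp (- 1 / h)) \<longlongrightarrow> 0) (at_right 0)"
      by real_asymp
  qed
  then show ?thesis by (simp add: poly_altdef sum_distrib_right mult.assoc)
qed

text \<open>For \<open>x > 0\<close> the derivative of p(1/x) exp(-1/x) is (p - p')(1/x) exp(-1/x) /
  x^2, so differentiation acts on the polynomial alone, sending p to X^2 (p - p'). The family of all
  \<open>flat_exp p\<close> is therefore closed under it, and coinduction over \<open>p\<close>
  gives smoothness.\<close>

lemma flat_exp_deriv:
  "(flat_exp p has_vector_derivative flat_exp ([:0, 0, 1:] * (p - pderiv p)) x) (at x)"
proof -
  consider "x > 0" | "x < 0" | "x = 0" by linarith
  then show ?thesis
  proof cases
    case 1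
    have "((\<lambda>x. poly p (1 / x) * exp (- 1 / x)) has_real_derivative
        (poly (pderiv p) (1 / x) * (- 1 / x\<^sup>2) * exp (- 1 / x) + poly p (1 / x) * (exp (- 1 / x) * (1 / x\<^sup>2)))) (at x)"
      using 1 by (auto intro!: derivative_eq_intros poly_DERIV DERIV_chain2[where f="poly p"] simp: field_simps power2_eq_square)
    then have "((\<lambda>x. complex_of_real (poly p (1 / x) * exp (- 1 / x))) has_vector_derivative
        flat_exp ([:0, 0, 1:] * (p - pderiv p)) x) (at x)"
      using 1 by (intro has_vector_derivative_of_real[THEN has_vector_derivative_eq_rhs])
         (auto simp: flat_exp_def has_real_derivative_iff_has_vector_derivative[symmetric] field_simps power2_eq_square)
    then show ?thesis
      by (rule has_vector_derivative_transform_within_open[of _ _ _ "{0<..}"]) (use 1 in \<open>auto simp: flat_exp_def\<close>)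
  next
    case 2
    have "((\<lambda>x. 0) has_vector_derivative flat_exp ([:0, 0, 1:] * (p - pderiv p)) x) (at x)"
      using 2 by (simp add: flat_exp_def)
    then show ?thesis
      by (rule has_vector_derivative_transform_within_open[of _ _ _ "{..<0}"]) (use 2 in \<open>auto simp: flat_exp_def\<close>)
  next
    case 3
    \<comment> \<open>The difference quotient at 0 is again of the flat form: dividing by
      \<open>h\<close> turns p into X p, that is \<open>pCons 0 p\<close>.\<close>
    have "((\<lambda>h. complex_of_real (poly (pCons 0 p) (1 / h) * exp (- 1 / h))) \<longlongrightarrow> of_real 0) (at_right 0)"
      by (intro tendsto_of_real flat_exp_tendsto)
    then have r: "((\<lambda>h. (1 / h) *\<^sub>R flat_exp p h) \<longlongrightarrow> 0) (at_right 0)"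
    proof (subst tendsto_cong[of _ "\<lambda>h. complex_of_real (poly (pCons 0 p) (1 / h) * exp (- 1 / h))"])
      show "\<forall>\<^sub>F h in at_right 0. (1 / h) *\<^sub>R flat_exp p h = of_real (poly (pCons 0 p) (1 / h) * exp (- 1 / h))"
        using eventually_at_right_less[of 0]
        by eventually_elim (simp add: flat_exp_def scaleR_conv_of_real)
    qed simp
    have l: "((\<lambda>h. (1 / h) *\<^sub>R flat_exp p h) \<longlongrightarrow> 0) (at_left 0)"
    proof (rule tendsto_eventually)
      show "\<forall>\<^sub>F h in at_left 0. (1 / h) *\<^sub>R flat_exp p h = 0"
        using eventually_at_left_real[of "-1" 0, simplified] by (rule eventually_mono) (simp add: flat_exp_def)
    qed
    have "((\<lambda>h. (1 / h) *\<^sub>R flat_exp p h) \<longlongrightarrow> 0) (at 0)"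
      using l r by (simp add: filterlim_split_at)
    then have "((\<lambda>h. norm (flat_exp p h) / \<bar>h\<bar>) \<longlongrightarrow> 0) (at 0)"
      by (drule_tac tendsto_norm) (simp add: divide_inverse mult.commute)
    then have "(flat_exp p has_vector_derivative 0) (at 0)"
      unfolding has_vector_derivative_def has_derivative_at by (auto simp: flat_exp_def)
    then show ?thesis using 3 by (simp add: flat_exp_def)
  qed
qed

lemma smooth1_flat_exp: "smooth1 (flat_exp p)"
  by (coinduction arbitrary: p rule: smooth1.coinduct) (use flat_exp_deriv in blast)

text \<open>On (0, 1) this is exp(-1/x) exp(-1/(1 - x)). The reflected argument is written
  \<open>- 1 * x + 1\<close> to fit \<open>smooth1_affine\<close>.\<close>

definition bump1 :: "real \<Rightarrow> complex" where
  "bump1 x = flat_exp 1 x * flat_exp 1 (- 1 * x + 1)"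

lemma smooth1_bump1: "smooth1 bump1"
  unfolding bump1_def[abs_def] by (intro smooth1_mult smooth1_flat_exp smooth1_affine[of "flat_exp 1"])

lemma bump1_real: "bump1 x = of_real (Re (bump1 x))" "0 \<le> Re (bump1 x)"
  by (auto simp: bump1_def flat_exp_def complex_eq_iff)

lemma bump1_outside: "x \<le> 0 \<or> 1 \<le> x \<Longrightarrow> bump1 x = 0"
  by (auto simp: bump1_def flat_exp_def)

text \<open>The integral runs over \<open>{-1..x}\<close> so that it is differentiable at the left endpoint of the
  support as well; for \<open>x < -1\<close> it is the integral over the empty set.\<close>

definition smooth_step :: "real \<Rightarrow> complex" where
  "smooth_step x = of_real (integral {-1..x} (\<lambda>t. Re (bump1 t)) / integral {0..1} (\<lambda>t. Re (bump1 t)))"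

lemma bump1_re_cont: "continuous_on S (\<lambda>t. Re (bump1 t))"
  by (intro continuous_intros smooth1_cont smooth1_bump1)

lemma bump1_integral_pos: "0 < integral {0..1} (\<lambda>t. Re (bump1 t))"
proof -
  have "integral {0..1} (\<lambda>t. Re (bump1 t)) \<noteq> 0"
  proof
    assume "integral {0..1} (\<lambda>t. Re (bump1 t)) = 0"
    then have "Re (bump1 (1/2)) = 0"
      using integral_eq_0_iff[of 0 1 "\<lambda>t. Re (bump1 t)"] bump1_re_cont bump1_real(2) by auto
    then show False by (simp add: bump1_def flat_exp_def)
  qed
  moreover have "0 \<le> integral {0..1} (\<lambda>t. Re (bump1 t))"
    by (intro integral_nonneg integrable_continuous_real bump1_re_cont bump1_real(2))
  ultimately show ?thesis by simp
qed

lemma smooth_step_le_0: "x \<le> 0 \<Longrightarrow> smooth_step x = 0"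
proof -
  assume "x \<le> 0"
  then have "integral {-1..x} (\<lambda>t. Re (bump1 t)) = integral {-1..x} (\<lambda>t. 0)"
    by (intro Henstock_Kurzweil_Integration.integral_cong) (auto simp: bump1_outside)
  then show ?thesis by (simp add: smooth_step_def)
qed

lemma integral_bump1_split:
  assumes "0 \<le> x" shows "integral {-1..x} (\<lambda>t. Re (bump1 t)) = integral {0..x} (\<lambda>t. Re (bump1 t))"
proof -
  have "integral {-1..x} (\<lambda>t. Re (bump1 t)) = integral {-1..0} (\<lambda>t. Re (bump1 t)) + integral {0..x} (\<lambda>t. Re (bump1 t))"
    using assms by (intro Henstock_Kurzweil_Integration.integral_combine[symmetric] integrable_continuous_real bump1_re_cont) auto
  also have "integral {-1..0} (\<lambda>t. Re (bump1 t)) = integral {-1..0::real} (\<lambda>t. 0)"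
    by (intro Henstock_Kurzweil_Integration.integral_cong) (auto simp: bump1_outside)
  finally show ?thesis by simp
qed

lemma smooth_step_ge_1: "1 \<le> x \<Longrightarrow> smooth_step x = 1"
proof -
  assume x: "1 \<le> x"
  have "integral {0..x} (\<lambda>t. Re (bump1 t)) = integral {0..1} (\<lambda>t. Re (bump1 t)) + integral {1..x} (\<lambda>t. Re (bump1 t))"
    using x by (intro Henstock_Kurzweil_Integration.integral_combine[symmetric] integrable_continuous_real bump1_re_cont) auto
  also have "integral {1..x} (\<lambda>t. Re (bump1 t)) = integral {1..x} (\<lambda>t. 0)"
    by (intro Henstock_Kurzweil_Integration.integral_cong) (auto simp: bump1_outside)
  finally show ?thesis using x bump1_integral_pos by (simp add: smooth_step_def integral_bump1_split)
qed

lemma smooth1_smooth_step: "smooth1 smooth_step"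
proof (rule smooth1.intros)
  let ?c = "integral {0..1} (\<lambda>t. Re (bump1 t))"
  show "smooth1 (\<lambda>x. of_real (1 / ?c) * bump1 x)"
    by (intro smooth1_cmult smooth1_bump1)
  fix x :: real
  show "(smooth_step has_vector_derivative of_real (1 / ?c) * bump1 x) (at x)"
  proof (cases "x < 0")
    case True
    have "((\<lambda>x. 0) has_vector_derivative of_real (1 / ?c) * bump1 x) (at x)"
      using True by (simp add: bump1_outside)
    then show ?thesis
      by (rule has_vector_derivative_transform_within_open[of _ _ _ "{..<0}"]) (use True in \<open>auto simp: smooth_step_le_0\<close>)
  next
    case False
    \<comment> \<open>Any right end beyond \<open>x\<close> serves: \<open>x\<close> becomes an
      interior point, and the derivative within the interval becomes a full one.\<close>
    have "((\<lambda>u. integral {-1..u} (\<lambda>t. Re (bump1 t))) has_vector_derivative Re (bump1 x)) (at x within {-1..x+1})"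
      by (rule integral_has_vector_derivative[OF bump1_re_cont]) (use False in auto)
    then have "((\<lambda>u. integral {-1..u} (\<lambda>t. Re (bump1 t))) has_vector_derivative Re (bump1 x)) (at x)"
      using at_within_interior[of x "{-1..x+1}"] False by (simp add: interior_atLeastAtMost_real)
    then have "((\<lambda>u. (1 / ?c) * integral {-1..u} (\<lambda>t. Re (bump1 t))) has_vector_derivative (1 / ?c) * Re (bump1 x)) (at x)"
      by (rule has_vector_derivative_mult_right)
    then have "((\<lambda>u. of_real ((1 / ?c) * integral {-1..u} (\<lambda>t. Re (bump1 t)))) has_vector_derivative complex_of_real ((1 / ?c) * Re (bump1 x))) (at x)"
      by (intro has_vector_derivative_of_real) (simp only: has_real_derivative_iff_has_vector_derivative)
    then show ?thesis
      by (subst bump1_real(1)) (simp add: smooth_step_def[abs_def])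
  qed
qed

lemma smooth_step_norm_le: "norm (smooth_step x) \<le> 1"
proof -
  consider "x \<le> 0" | "1 \<le> x" | "0 < x" "x < 1" by linarith
  then show ?thesis
  proof cases
    case 3
    have "integral {0..x} (\<lambda>t. Re (bump1 t)) \<le> integral {0..1} (\<lambda>t. Re (bump1 t))"
      using 3 by (intro integral_subset_le integrable_continuous_real bump1_re_cont) (auto intro: bump1_real(2))
    moreover have "0 \<le> integral {0..x} (\<lambda>t. Re (bump1 t))"
      by (intro integral_nonneg integrable_continuous_real bump1_re_cont bump1_real(2))
    ultimately show ?thesis using 3 bump1_integral_pos
      by (simp add: smooth_step_def integral_bump1_split norm_divide)
  qed (simp_all add: smooth_step_le_0 smooth_step_ge_1)
qed

section \<open>The Fourier transform on the line\<close>

definition test1 :: "(real \<Rightarrow> complex) \<Rightarrow> bool" where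
  "test1 f \<longleftrightarrow> smooth1 f \<and> (\<exists>a. \<forall>x. a < \<bar>x\<bar> \<longrightarrow> f x = 0)"

definition schwartz1 :: "(real \<Rightarrow> complex) \<Rightarrow> bool" where
  "schwartz1 f \<longleftrightarrow> smooth1 f \<and> (\<forall>k m. \<exists>C. \<forall>x. \<bar>x\<bar> ^ k * norm ((D1 ^^ m) f x) \<le> C)"

lemma test1_smooth1: "test1 f \<Longrightarrow> smooth1 f"
  by (simp add: test1_def)

lemma schwartz1_smooth1: "schwartz1 f \<Longrightarrow> smooth1 f"
  by (simp add: schwartz1_def)

lemma test1_supportE:
  assumes "test1 f" obtains a where "0 < a" "\<And>x. a < \<bar>x\<bar> \<Longrightarrow> f x = 0"
proof -
  from assms obtain a where "\<And>x. a < \<bar>x\<bar> \<Longrightarrow> f x = 0" by (auto simp: test1_def)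
  then show thesis using that[of "max a 1"] by auto
qed

lemma D1_eq_0_outside:
  assumes "\<And>x. a < \<bar>x\<bar> \<Longrightarrow> f x = 0" "a < \<bar>x\<bar>" shows "D1 f x = 0"
proof -
  have o: "open {x::real. a < \<bar>x\<bar>}" by (intro open_Collect_less continuous_intros)
  have "((\<lambda>x. 0) has_vector_derivative 0) (at x)" by simp
  then have "(f has_vector_derivative 0) (at x)"
    by (rule has_vector_derivative_transform_within_open[OF _ o]) (use assms in auto)
  then show ?thesis by (simp add: D1_def vector_derivative_at)
qed

lemma test1_D1: "test1 f \<Longrightarrow> test1 (D1 f)"
  unfolding test1_def using D1_eq_0_outside[of _ f] smooth1_D1_self by metis

lemma test1_funpow_D1: "test1 f \<Longrightarrow> test1 ((D1 ^^ m) f)"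
  by (induction m) (auto intro: test1_D1)

lemma test1_mult: "test1 f \<Longrightarrow> smooth1 g \<Longrightarrow> test1 (\<lambda>x. f x * g x)"
  unfolding test1_def by (auto intro!: smooth1_mult)

lemma test1_mult': "smooth1 f \<Longrightarrow> test1 g \<Longrightarrow> test1 (\<lambda>x. f x * g x)"
  unfolding test1_def by (auto intro!: smooth1_mult)

lemma test1_add: "test1 f \<Longrightarrow> test1 g \<Longrightarrow> test1 (\<lambda>x. f x + g x)"
proof -
  assume f: "test1 f" and g: "test1 g"
  obtain a b where "\<And>x. a < \<bar>x\<bar> \<Longrightarrow> f x = 0" "\<And>x. b < \<bar>x\<bar> \<Longrightarrow> g x = 0"
    using test1_supportE[OF f] test1_supportE[OF g] by metis
  then have "\<forall>x. max a b < \<bar>x\<bar> \<longrightarrow> f x + g x = 0" by auto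
  then show ?thesis
    using f g smooth1_add unfolding test1_def by blast
qed

lemma test1_zero: "test1 (\<lambda>x. 0)"
  by (auto simp: test1_def intro: smooth1_const)

lemma test1_sum: "finite I \<Longrightarrow> (\<And>i. i \<in> I \<Longrightarrow> test1 (f i)) \<Longrightarrow> test1 (\<lambda>x. \<Sum>i\<in>I. f i x)"
  by (induction I rule: finite_induct) (auto intro: test1_zero test1_add)

lemma test1_bounded:
  assumes "test1 f" obtains C where "0 \<le> C" "\<And>x. norm (f x) \<le> C"
proof -
  obtain a where a: "0 < a" "\<And>x. a < \<bar>x\<bar> \<Longrightarrow> f x = 0" using test1_supportE[OF assms] by blast
  have "bounded (f ` {-a..a})"
    by (intro compact_imp_bounded compact_continuous_image smooth1_cont test1_smooth1 assms) auto
  then obtain C where C: "C > 0" "\<And>x. x \<in> {-a..a} \<Longrightarrow> norm (f x) \<le> C"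
    by (auto simp: bounded_pos)
  show thesis
  proof (rule that[of C])
    fix x show "norm (f x) \<le> C"
      using C a(2)[of x] by (cases "x \<in> {-a..a}") auto
  qed (use C in auto)
qed

lemma test1_schwartz1: assumes "test1 f" shows "schwartz1 f"
  unfolding schwartz1_def
proof (intro conjI allI)
  fix k m
  obtain a where a: "0 < a" "\<And>x. a < \<bar>x\<bar> \<Longrightarrow> (D1 ^^ m) f x = 0"
    using test1_supportE[OF test1_funpow_D1[OF assms]] by blast
  obtain C where C: "0 \<le> C" "\<And>x. norm ((D1 ^^ m) f x) \<le> C"
    using test1_bounded[OF test1_funpow_D1[OF assms]] by blast
  have "\<bar>x\<bar> ^ k * norm ((D1 ^^ m) f x) \<le> a ^ k * C" for x
  proof (cases "a < \<bar>x\<bar>")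
    case False
    then show ?thesis by (intro mult_mono power_mono C) (use a in auto)
  qed (use a C in auto)
  then show "\<exists>C. \<forall>x. \<bar>x\<bar> ^ k * norm ((D1 ^^ m) f x) \<le> C" by blast
qed (use assms test1_smooth1 in auto)

lemma schwartz1_funpow_D1: "schwartz1 f \<Longrightarrow> schwartz1 ((D1 ^^ m) f)"
  unfolding schwartz1_def using smooth1_funpow_D1
  by (auto simp: funpow_add[symmetric, THEN fun_cong, simplified o_def])

lemma schwartz1_D1: "schwartz1 f \<Longrightarrow> schwartz1 (D1 f)"
  using schwartz1_funpow_D1[of f 1] by simp

text \<open>Adding the bounds for the weights |x|^0 and |x|^2 bounds (1 + x^2) |f|, which gives an
  integrable majorant.\<close>

lemma schwartz1_decay:
  assumes "schwartz1 f" obtains C where "0 \<le> C" "\<And>x. norm (f x) \<le> C / (1 + x\<^sup>2)"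
proof -
  from assms obtain A B where A: "\<And>x. \<bar>x\<bar> ^ 0 * norm ((D1 ^^ 0) f x) \<le> A"
    and B: "\<And>x. \<bar>x\<bar> ^ 2 * norm ((D1 ^^ 0) f x) \<le> B"
    unfolding schwartz1_def by metis
  have "norm (f x) \<le> (A + B) / (1 + x\<^sup>2)" for x
    using A[of x] B[of x] by (simp add: field_simps add_pos_nonneg)
  moreover have "0 \<le> A + B"
    using A[of 0] B[of 0] norm_ge_zero[of "f 0"] by (simp, linarith)
  ultimately show thesis using that by blast
qed

lemma integrable_1_div_1_plus_square: "integrable lborel (\<lambda>x::real. 1 / (1 + x\<^sup>2))"
  using integrable_inverse_1_plus_square
  by (simp add: set_integrable_def einterval_eq inverse_eq_divide)

lemma decay_integrable:
  assumes [measurable]: "f \<in> borel_measurable borel" and "\<And>x. norm (f x :: complex) \<le> C / (1 + x\<^sup>2)"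
  shows "integrable lborel f"
proof (rule Bochner_Integration.integrable_bound)
  show "integrable lborel (\<lambda>x. C * (1 / (1 + x\<^sup>2)))"
    by (intro integrable_mult_right integrable_1_div_1_plus_square)
  show "AE x in lborel. norm (f x) \<le> norm (C * (1 / (1 + x\<^sup>2)))"
  proof (rule AE_I2)
    fix x show "norm (f x) \<le> norm (C * (1 / (1 + x\<^sup>2)))"
      using assms(2)[of x] abs_ge_self[of "C / (1 + x\<^sup>2)"] by simp
  qed
qed simp

lemma schwartz1_integrable: "schwartz1 f \<Longrightarrow> integrable lborel f"
  using schwartz1_decay decay_integrable schwartz1_smooth1 smooth1_measurable by metis

lemma test1_integrable: "test1 f \<Longrightarrow> integrable lborel f"
  by (intro schwartz1_integrable test1_schwartz1)

section \<open>The Fourier transform of compactly supported smooth functions\<close>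

definition echar :: "real \<Rightarrow> complex" where
  "echar u = exp (- 2 * of_real pi * \<i> * of_real u)"

definition F1 :: "(real \<Rightarrow> complex) \<Rightarrow> real \<Rightarrow> complex" where
  "F1 f \<xi> = (\<integral>x. echar (x * \<xi>) * f x \<partial>lborel)"

lemma norm_echar [simp]: "norm (echar u) = 1"
  by (simp add: echar_def)

lemma echar_add: "echar (u + v) = echar u * echar v"
  by (simp add: echar_def exp_add[symmetric] algebra_simps)

lemma echar_0 [simp]: "echar 0 = 1"
  by (simp add: echar_def)

lemma echar_sum: "finite I \<Longrightarrow> echar (\<Sum>i\<in>I. f i) = (\<Prod>i\<in>I. echar (f i))"
  by (induction I rule: finite_induct) (simp_all add: echar_add)

lemma continuous_on_echar [continuous_intros]:
  "continuous_on S f \<Longrightarrow> continuous_on S (\<lambda>x. echar (f x))"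
  unfolding echar_def by (intro continuous_intros)

lemma measurable_echar [measurable]: "echar \<in> borel_measurable borel"
  by (intro borel_measurable_continuous_onI continuous_intros)

lemma echar_deriv: "((\<lambda>x. echar (x * y)) has_vector_derivative (- 2 * of_real pi * \<i> * of_real y * echar (x * y))) (at x within S)"
proof -
  have "((\<lambda>z. exp (- 2 * of_real pi * \<i> * (z * of_real y))) has_field_derivative
      (- 2 * of_real pi * \<i> * of_real y * exp (- 2 * of_real pi * \<i> * (of_real x * of_real y)))) (at (complex_of_real x))"
    by (auto intro!: derivative_eq_intros)
  then show ?thesis
    unfolding echar_def using has_vector_derivative_real_field[of _ _ x S] by (simp add: o_def)
qed

lemma integrable_echar_mult: "integrable lborel f \<Longrightarrow> integrable lborel (\<lambda>x. echar (x * \<xi>) * f x)"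
  by (rule Bochner_Integration.integrable_bound[of _ f]) (auto simp: norm_mult)

lemma norm_F1_le: "norm (F1 f \<xi>) \<le> (\<integral>x. norm (f x) \<partial>lborel)"
  unfolding F1_def by (rule order_trans[OF integral_norm_bound]) (simp add: norm_mult)

lemma F1_add: "integrable lborel f \<Longrightarrow> integrable lborel g \<Longrightarrow> F1 (\<lambda>x. f x + g x) \<xi> = F1 f \<xi> + F1 g \<xi>"
  unfolding F1_def by (simp add: distrib_left integrable_echar_mult)

text \<open>Compact support permits differentiation under the integral sign: the transform becomes
  an integral over one fixed compact interval, where the Leibniz rule for continuous integrands
  applies.\<close>

lemma F1_deriv:
  assumes "test1 f"
  shows "(F1 f has_vector_derivative F1 (\<lambda>x. - 2 * of_real pi * \<i> * of_real x * f x) \<xi>) (at \<xi>)"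
proof -
  obtain a where a: "0 < a" "\<And>x. a < \<bar>x\<bar> \<Longrightarrow> f x = 0" using test1_supportE[OF assms] by blast
  have c: "continuous_on S f" for S by (intro smooth1_cont test1_smooth1 assms)
  have c2: "continuous_on S (\<lambda>p. f (snd p))" for S :: "(real \<times> real) set"
    by (intro continuous_on_compose2[OF c[of UNIV]] continuous_intros) auto
  have conv: "(\<integral>x. echar (x * \<xi>) * h x \<partial>lborel) = integral (cbox (-a) a) (\<lambda>x. echar (x * \<xi>) * h x)"
    if h: "continuous_on UNIV h" "\<And>x. a < \<bar>x\<bar> \<Longrightarrow> h x = 0" for h \<xi>
  proof -
    have "(\<integral>x. echar (x * \<xi>) * h x \<partial>lborel) = (LINT x:{-a..a}|lborel. echar (x * \<xi>) * h x)"
      unfolding set_lebesgue_integral_def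
    proof (intro Bochner_Integration.integral_cong refl)
      fix x show "echar (x * \<xi>) * h x = indicator {-a..a} x *\<^sub>R (echar (x * \<xi>) * h x)"
        using h(2)[of x] by (cases "a < \<bar>x\<bar>") (auto simp: indicator_def)
    qed
    also have "\<dots> = integral {-a..a} (\<lambda>x. echar (x * \<xi>) * h x)"
      by (intro set_borel_integral_eq_integral(2) borel_integrable_atLeastAtMost' continuous_intros continuous_on_subset[OF h(1)]) auto
    finally show ?thesis by simp
  qed
  have "((\<lambda>\<xi>. integral (cbox (-a) a) (\<lambda>x. echar (x * \<xi>) * f x)) has_vector_derivative
      integral (cbox (-a) a) (\<lambda>x. echar (x * \<xi>) * (- 2 * of_real pi * \<i> * of_real x * f x))) (at \<xi> within UNIV)"
  proof (rule leibniz_rule_vector_derivative)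
    fix \<xi> x
    have "((\<lambda>\<xi>. echar (\<xi> * x) * f x) has_vector_derivative (- 2 * of_real pi * \<i> * of_real x * echar (\<xi> * x)) * f x) (at \<xi>)"
      by (intro has_vector_derivative_mult_left echar_deriv)
    then show "((\<lambda>\<xi>. echar (x * \<xi>) * f x) has_vector_derivative echar (x * \<xi>) * (- 2 * of_real pi * \<i> * of_real x * f x)) (at \<xi>)"
      by (simp add: mult_ac)
    show "(\<lambda>x. echar (x * \<xi>) * f x) integrable_on cbox (-a) a"
      by (intro integrable_continuous continuous_intros c)
  qed (auto intro!: continuous_intros c2 simp: case_prod_unfold)
  then show ?thesis
    unfolding F1_def[abs_def] using conv[of f] conv[of "\<lambda>x. - 2 * of_real pi * \<i> * of_real x * f x"] a c
    by (simp add: continuous_intros)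
qed

lemma test1_mult_ident: "test1 f \<Longrightarrow> test1 (\<lambda>x. - 2 * of_real pi * \<i> * of_real x * f x)"
  by (intro test1_mult' smooth1_cmult smooth1_ident)

lemma F1_smooth1: assumes "test1 f" shows "smooth1 (F1 f)"
  using assms
  by (coinduction arbitrary: f rule: smooth1.coinduct) (use F1_deriv test1_mult_ident in blast)

lemma integral_D1_eq_0:
  assumes "test1 f" shows "(\<integral>x. D1 f x \<partial>lborel) = 0"
proof -
  obtain a where a: "0 < a" "\<And>x. a < \<bar>x\<bar> \<Longrightarrow> f x = 0" using test1_supportE[OF assms] by blast
  \<comment> \<open>The vanishing of \<open>f\<close> is known only strictly beyond
    \<open>a\<close>; the endpoints \<open>a + 1\<close> and \<open>- (a + 1)\<close> lie there, so
    both boundary values are 0.\<close>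
  have "(\<integral>x. D1 f x \<partial>lborel) = (\<integral>x. indicator {-(a+1)..a+1} x *\<^sub>R D1 f x \<partial>lborel)"
  proof (intro Bochner_Integration.integral_cong refl)
    fix x show "D1 f x = indicator {-(a+1)..a+1} x *\<^sub>R D1 f x"
      using D1_eq_0_outside[of a f x] a(2) by (cases "a < \<bar>x\<bar>") (auto simp: indicator_def)
  qed
  also have "\<dots> = f (a+1) - f (-(a+1))"
    using a by (intro integral_FTC_atLeastAtMost has_vector_derivative_at_within[OF has_D1] smooth1_cont smooth1_D1_self test1_smooth1 assms) auto
  also have "\<dots> = 0" using a by simp
  finally show ?thesis .
qed

lemma smooth1_echar: "smooth1 (\<lambda>x. echar (x * y))"
proof -
  have "smooth1 (\<lambda>x. c * echar (x * y))" for c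
  proof (coinduction arbitrary: c rule: smooth1.coinduct)
    case (smooth1 c)
    have "((\<lambda>x. c * echar (x * y)) has_vector_derivative (c * (- 2 * of_real pi * \<i> * of_real y)) * echar (x * y)) (at x)" for x
      using has_vector_derivative_mult_right[OF echar_deriv[of y x UNIV], of c] by (simp add: mult_ac)
    then show ?case
      by (intro exI[of _ "\<lambda>x. c * echar (x * y)"] exI[of _ "\<lambda>x. (c * (- 2 * of_real pi * \<i> * of_real y)) * echar (x * y)"])
        (intro conjI allI refl disjI1 exI[of _ "c * (- 2 * of_real pi * \<i> * of_real y)"])
  qed
  from this[of 1] show ?thesis by simp
qed

text \<open>Integration by parts: the derivative of \<open>echar (x * \<xi>) * f x\<close> has
  integral 0, and its two Leibniz terms are the two sides.\<close>

lemma F1_D1: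
  assumes "test1 f" shows "F1 (D1 f) \<xi> = 2 * of_real pi * \<i> * of_real \<xi> * F1 f \<xi>"
proof -
  have t: "test1 (\<lambda>x. echar (x * \<xi>) * f x)" by (intro test1_mult' smooth1_echar assms)
  have e: "D1 (\<lambda>x. echar (x * \<xi>)) = (\<lambda>x. - 2 * of_real pi * \<i> * of_real \<xi> * echar (x * \<xi>))"
    by (intro D1_eqI echar_deriv)
  have "0 = (\<integral>x. D1 (\<lambda>x. echar (x * \<xi>) * f x) x \<partial>lborel)"
    using integral_D1_eq_0[OF t] by simp
  also have "\<dots> = (\<integral>x. echar (x * \<xi>) * D1 f x + (- 2 * of_real pi * \<i> * of_real \<xi>) * (echar (x * \<xi>) * f x) \<partial>lborel)"
    unfolding D1_mult[OF smooth1_echar test1_smooth1[OF assms]] e by (simp add: mult_ac)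
  also have "\<dots> = F1 (D1 f) \<xi> + (- 2 * of_real pi * \<i> * of_real \<xi>) * F1 f \<xi>"
    unfolding F1_def
    by (subst Bochner_Integration.integral_add)
      (auto intro!: integrable_echar_mult integrable_mult_right test1_integrable[OF assms] test1_integrable[OF test1_D1[OF assms]])
  finally show ?thesis by (simp add: algebra_simps eq_neg_iff_add_eq_0)
qed

text \<open>Derivatives of a transform are again transforms of test functions, and powers of \<xi>
  are absorbed as derivatives of the test function. Each seminorm is thus bounded by the L^1 norm of
  some test function.\<close>

lemma F1_schwartz1: assumes "test1 f" shows "schwartz1 (F1 f)"
  unfolding schwartz1_def
proof (intro conjI allI F1_smooth1 assms)
  fix k m
  have D: "\<exists>g. test1 g \<and> (D1 ^^ m) (F1 f) = F1 g"
  proof (induction m)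
    case (Suc m)
    then obtain g where g: "test1 g" "(D1 ^^ m) (F1 f) = F1 g" by blast
    then have "D1 (F1 g) = F1 (\<lambda>x. - 2 * of_real pi * \<i> * of_real x * g x)" by (intro D1_eqI F1_deriv)
    with g show ?case using test1_mult_ident[OF g(1)] by auto
  qed (use assms in auto)
  then obtain g where g: "test1 g" "(D1 ^^ m) (F1 f) = F1 g" by blast
  have pw: "\<exists>g'. test1 g' \<and> (\<forall>\<xi>. (2 * pi * \<bar>\<xi>\<bar>) ^ k * norm (F1 g \<xi>) = norm (F1 g' \<xi>))"
  proof (induction k)
    case (Suc k)
    then obtain g' where "test1 g'" "\<forall>\<xi>. (2 * pi * \<bar>\<xi>\<bar>) ^ k * norm (F1 g \<xi>) = norm (F1 g' \<xi>)" by blast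
    then show ?case
      by (intro exI[of _ "D1 g'"]) (auto simp: F1_D1 test1_D1 norm_mult mult_ac)
  qed (use g in auto)
  then obtain g' where g': "test1 g'" "\<And>\<xi>. (2 * pi * \<bar>\<xi>\<bar>) ^ k * norm (F1 g \<xi>) = norm (F1 g' \<xi>)" by blast
  have "\<bar>\<xi>\<bar> ^ k * norm (F1 g \<xi>) \<le> (\<integral>x. norm (g' x) \<partial>lborel)" for \<xi>
  proof -
    have "1 * \<bar>\<xi>\<bar> \<le> 2 * pi * \<bar>\<xi>\<bar>" using pi_gt3 by (intro mult_right_mono) auto
    then have "\<bar>\<xi>\<bar> ^ k * norm (F1 g \<xi>) \<le> (2 * pi * \<bar>\<xi>\<bar>) ^ k * norm (F1 g \<xi>)"
      by (intro mult_right_mono power_mono) auto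
    also have "\<dots> \<le> (\<integral>x. norm (g' x) \<partial>lborel)" using g'(2) norm_F1_le by simp
    finally show ?thesis .
  qed
  then show "\<exists>C. \<forall>x. \<bar>x\<bar> ^ k * norm ((D1 ^^ m) (F1 f) x) \<le> C" using g(2) by auto
qed

text \<open>Unlike in \<open>F1_schwartz1\<close>, the constant is explicit in \<open>f\<close> and
  its second derivative, so that it can be made uniform over a family of functions.\<close>

lemma norm_F1_decay:
  assumes "test1 f"
  shows "norm (F1 f \<xi>) \<le> (\<integral>x. norm (f x) + norm (D1 (D1 f) x) \<partial>lborel) / (1 + \<xi>\<^sup>2)"
proof -
  have "\<xi>\<^sup>2 * norm (F1 f \<xi>) \<le> norm (F1 (D1 (D1 f)) \<xi>)"
  proof -
    have "norm (F1 (D1 (D1 f)) \<xi>) = (2 * pi)\<^sup>2 * (\<xi>\<^sup>2 * norm (F1 f \<xi>))"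
      using assms by (simp add: F1_D1 test1_D1 norm_mult power2_eq_square)
    moreover have "1 \<le> (2 * pi)\<^sup>2" using pi_gt3 by (intro one_le_power) auto
    ultimately show ?thesis
      using mult_right_mono[of 1 "(2 * pi)\<^sup>2" "\<xi>\<^sup>2 * norm (F1 f \<xi>)"] by simp
  qed
  also have "\<dots> \<le> (\<integral>x. norm (D1 (D1 f) x) \<partial>lborel)" by (rule norm_F1_le)
  finally have "(1 + \<xi>\<^sup>2) * norm (F1 f \<xi>) \<le> (\<integral>x. norm (f x) \<partial>lborel) + (\<integral>x. norm (D1 (D1 f) x) \<partial>lborel)"
    using norm_F1_le[of f \<xi>] by (simp add: algebra_simps)
  also have "\<dots> = (\<integral>x. norm (f x) + norm (D1 (D1 f) x) \<partial>lborel)"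
    by (subst Bochner_Integration.integral_add) (auto intro!: integrable_norm test1_integrable[OF assms] test1_integrable[OF test1_D1[OF test1_D1[OF assms]]])
  finally show ?thesis by (simp add: field_simps add_pos_nonneg)
qed

section \<open>Fourier inversion\<close>

lemma integrable_pair_mult:
  fixes f g :: "real \<Rightarrow> complex"
  assumes f: "integrable lborel f" and g: "integrable lborel g"
  shows "integrable (lborel \<Otimes>\<^sub>M lborel) (\<lambda>(x, y). f x * g y)"
proof (rule lborel_pair.Fubini_integrable)
  note [measurable] = borel_measurable_integrable[OF f] borel_measurable_integrable[OF g]
  show "(\<lambda>(x, y). f x * g y) \<in> borel_measurable (lborel \<Otimes>\<^sub>M lborel)" by measurable
  show "integrable lborel (\<lambda>x. \<integral>y. norm (case (x, y) of (x, y) \<Rightarrow> f x * g y) \<partial>lborel)"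
    using f by (simp add: norm_mult)
  show "AE x in lborel. integrable lborel (\<lambda>y. case (x, y) of (x, y) \<Rightarrow> f x * g y)"
    using g by simp
qed

text \<open>The double integral behind the formula does not converge absolutely. A Gaussian factor
  \<open>?n (e * x)\<close> makes Fubini applicable and turns the expression into an average of
  \<open>f\<close> around \<open>y\<close> at scale \<open>e\<close>; then \<open>e\<close> tends to
  0 on both sides.\<close>

lemma F1_inversion:
  assumes "test1 f" shows "(\<integral>x. echar (- x * y) * F1 f x \<partial>lborel) = f y"
proof -
  let ?n = std_normal_density
  have If: "integrable lborel f" and IF: "integrable lborel (F1 f)"
    by (rule schwartz1_integrable[OF test1_schwartz1[OF assms]], rule schwartz1_integrable[OF F1_schwartz1[OF assms]])
  note [measurable] = borel_measurable_integrable[OF If] borel_measurable_integrable[OF IF]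
  have In: "integrable lborel (\<lambda>x. complex_of_real (?n x))"
    using integrable_normal_density[of 1 0] by (intro integrable_of_real) auto
  have n0: "?n 0 = 1 / sqrt (2 * pi)" by (simp add: std_normal_density_def)
  have nn: "0 \<le> ?n x" for x by (simp add: std_normal_density_def)
  have n_le: "?n x \<le> ?n 0" for x
    by (auto simp: std_normal_density_def divide_right_mono)
  have ncont: "isCont ?n 0" unfolding std_normal_density_def[abs_def] by (intro continuous_intros) auto
  \<comment> \<open>The transform of the Gaussian is read off from the characteristic function of
    the standard normal law at -2 pi t.\<close>
  have char: "(\<integral>x. echar (x * t) * of_real (?n x) \<partial>lborel) = of_real (sqrt (2 * pi) * ?n (2 * pi * t))" for t
  proof -
    have "char std_normal_distribution (- 2 * pi * t) = (\<integral>x. ?n x *\<^sub>R iexp ((- 2 * pi * t) * x) \<partial>lborel)"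
      unfolding char_def by (subst integral_density) (auto simp: nn)
    also have "\<dots> = (\<integral>x. echar (x * t) * of_real (?n x) \<partial>lborel)"
      by (intro Bochner_Integration.integral_cong) (auto simp: echar_def scaleR_conv_of_real mult_ac)
    finally have "(\<integral>x. echar (x * t) * of_real (?n x) \<partial>lborel) = char std_normal_distribution (- 2 * pi * t)" ..
    also have "\<dots> = of_real (exp (- (2 * pi * t)\<^sup>2 / 2))"
      unfolding char_std_normal_distribution by simp
    also have "exp (- (2 * pi * t)\<^sup>2 / 2) = sqrt (2 * pi) * ?n (2 * pi * t)"
      by (simp add: std_normal_density_def)
    finally show ?thesis .
  qed
  have smoothed: "(\<integral>x. echar (- x * y) * F1 f x * of_real (?n (e * x)) \<partial>lborel) =
      of_real (1 / sqrt (2 * pi)) * (\<integral>v. f (y + (e / (2 * pi)) * v) * of_real (?n v) \<partial>lborel)"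
    if e: "e > 0" for e
  proof -
    have Ine: "integrable lborel (\<lambda>x. complex_of_real (?n (e * x)))"
      using lborel_integrable_real_affine[OF In, of e 0] e by simp
    have gauss: "(\<integral>x. echar (x * t) * of_real (?n (e * x)) \<partial>lborel) = of_real (sqrt (2 * pi) / e * ?n (2 * pi * t / e))" for t
    proof -
      have "(\<integral>x. echar (x * (t / e)) * of_real (?n x) \<partial>lborel) = e *\<^sub>R (\<integral>x. echar (x * t) * of_real (?n (e * x)) \<partial>lborel)"
        using e by (subst lborel_integral_real_affine[of e _ 0]) (auto simp: mult_ac)
      then have "of_real e * (\<integral>x. echar (x * t) * of_real (?n (e * x)) \<partial>lborel) = of_real (sqrt (2 * pi) * ?n (2 * pi * (t / e)))"
        unfolding char scaleR_conv_of_real by simp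
      then have "(\<integral>x. echar (x * t) * of_real (?n (e * x)) \<partial>lborel) = of_real (sqrt (2 * pi) * ?n (2 * pi * (t / e))) / of_real e"
        using e by (intro eq_divide_imp) (auto simp: mult.commute)
      then show ?thesis by simp
    qed
    have I2: "integrable (lborel \<Otimes>\<^sub>M lborel) (\<lambda>(x, s). (of_real (?n (e * x)) * f s) * (echar (- x * y) * echar (s * x)))"
    proof (rule Bochner_Integration.integrable_bound)
      show "integrable (lborel \<Otimes>\<^sub>M lborel) (\<lambda>(x, s). complex_of_real (?n (e * x)) * f s)"
        by (rule integrable_pair_mult[OF Ine If])
    qed (auto simp: norm_mult)
    have "(\<integral>x. echar (- x * y) * F1 f x * of_real (?n (e * x)) \<partial>lborel)
      = (\<integral>x. (\<integral>s. (of_real (?n (e * x)) * f s) * (echar (- x * y) * echar (s * x)) \<partial>lborel) \<partial>lborel)"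
      by (intro Bochner_Integration.integral_cong refl)
        (simp add: F1_def flip: integral_mult_right_zero integral_mult_left_zero, simp add: mult_ac)
    also have "\<dots> = (\<integral>s. (\<integral>x. (of_real (?n (e * x)) * f s) * (echar (- x * y) * echar (s * x)) \<partial>lborel) \<partial>lborel)"
      using lborel_pair.Fubini_integral[OF I2] by simp
    also have "\<dots> = (\<integral>s. f s * (\<integral>x. echar (x * (s - y)) * of_real (?n (e * x)) \<partial>lborel) \<partial>lborel)"
      by (intro Bochner_Integration.integral_cong refl)
        (simp add: algebra_simps flip: integral_mult_right_zero integral_mult_left_zero echar_add)
    also have "\<dots> = (\<integral>s. f s * of_real (sqrt (2 * pi) / e * ?n (2 * pi * (s - y) / e)) \<partial>lborel)"
      by (simp only: gauss)
    \<comment> \<open>Substitution \<open>s = y + (e / (2 * pi)) * v\<close>, after which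
      \<open>e\<close> no longer occurs in the argument of the Gaussian.\<close>
    also have "\<dots> = (e / (2 * pi)) *\<^sub>R (\<integral>v. f (y + (e / (2 * pi)) * v) * of_real (sqrt (2 * pi) / e * ?n v) \<partial>lborel)"
      using e by (subst lborel_integral_real_affine[of "e / (2 * pi)" _ y]) auto
    also have "\<dots> = of_real ((e / (2 * pi)) * (sqrt (2 * pi) / e)) * (\<integral>v. f (y + (e / (2 * pi)) * v) * of_real (?n v) \<partial>lborel)"
    proof -
      have "(\<integral>v. f (y + (e / (2 * pi)) * v) * of_real (c * ?n v) \<partial>lborel) = of_real c * (\<integral>v. f (y + (e / (2 * pi)) * v) * of_real (?n v) \<partial>lborel)" for c
        by (subst integral_mult_right_zero[symmetric]) (simp add: mult_ac)
      then show ?thesis by (simp add: scaleR_conv_of_real)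
    qed
    also have "(e / (2 * pi)) * (sqrt (2 * pi) / e) = 1 / sqrt (2 * pi)"
      using e real_sqrt_pow2[of "2 * pi"] by (simp add: field_simps power2_eq_square)
    finally show ?thesis .
  qed
  define e where "e j = 1 / (real j + 1)" for j :: nat
  have e: "e j > 0" "e \<longlonglongrightarrow> 0" for j
    unfolding e_def by (auto, real_asymp)
  have L: "(\<lambda>j. \<integral>x. echar (- x * y) * F1 f x * of_real (?n (e j * x)) \<partial>lborel) \<longlonglongrightarrow>
      (\<integral>x. echar (- x * y) * F1 f x * of_real (?n 0) \<partial>lborel)"
  proof (rule integral_dominated_convergence[where w = "\<lambda>x. norm (F1 f x) * ?n 0"])
    show "integrable lborel (\<lambda>x. norm (F1 f x) * ?n 0)"
      by (intro integrable_mult_left integrable_norm IF)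
    show "AE x in lborel. (\<lambda>j. echar (- x * y) * F1 f x * of_real (?n (e j * x))) \<longlonglongrightarrow> echar (- x * y) * F1 f x * of_real (?n 0)"
    proof (intro AE_I2 tendsto_intros isCont_tendsto_compose[OF ncont])
      fix x show "(\<lambda>j. e j * x) \<longlonglongrightarrow> 0" using tendsto_mult_right[OF e(2), of x] by simp
    qed
    show "AE x in lborel. norm (echar (- x * y) * F1 f x * of_real (?n (e j * x))) \<le> norm (F1 f x) * ?n 0" for j
      by (intro AE_I2) (auto simp: norm_mult nn intro!: mult_left_mono n_le)
  qed auto
  obtain C where C: "0 \<le> C" "\<And>x. norm (f x) \<le> C" using test1_bounded[OF assms] by blast
  have R: "(\<lambda>j. \<integral>v. f (y + (e j / (2 * pi)) * v) * of_real (?n v) \<partial>lborel) \<longlonglongrightarrow> (\<integral>v. f y * of_real (?n v) \<partial>lborel)"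
  proof (rule integral_dominated_convergence[where w = "\<lambda>v. C * ?n v"])
    show "integrable lborel (\<lambda>v. C * ?n v)" using integrable_normal_density[of 1 0] by auto
    have fc: "isCont f y" using smooth1_cont[OF test1_smooth1[OF assms], of UNIV] by (simp add: continuous_on_eq_continuous_at)
    show "AE v in lborel. (\<lambda>j. f (y + (e j / (2 * pi)) * v) * of_real (?n v)) \<longlonglongrightarrow> f y * of_real (?n v)"
    proof (intro AE_I2 tendsto_intros isCont_tendsto_compose[OF fc])
      fix v
      have "(\<lambda>j. y + (e j / (2 * pi)) * v) \<longlonglongrightarrow> y + (0 / (2 * pi)) * v"
        by (intro tendsto_intros e) auto
      then show "(\<lambda>j. y + (e j / (2 * pi)) * v) \<longlonglongrightarrow> y" by simp
    qed
    show "AE v in lborel. norm (f (y + (e j / (2 * pi)) * v) * of_real (?n v)) \<le> C * ?n v" for j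
      by (intro AE_I2) (auto simp: norm_mult nn intro!: mult_right_mono C)
  qed auto
  have "(\<integral>v. f y * of_real (?n v) \<partial>lborel) = f y"
    using integral_normal_density[of 1 0] by (simp add: integral_complex_of_real)
  then have "(\<lambda>j. of_real (1 / sqrt (2 * pi)) * (\<integral>v. f (y + (e j / (2 * pi)) * v) * of_real (?n v) \<partial>lborel)) \<longlonglongrightarrow> of_real (1 / sqrt (2 * pi)) * f y"
    using R by (intro tendsto_mult_left) simp
  then have "(\<lambda>j. \<integral>x. echar (- x * y) * F1 f x * of_real (?n (e j * x)) \<partial>lborel) \<longlonglongrightarrow> of_real (1 / sqrt (2 * pi)) * f y"
    using smoothed[OF e(1)] by simp
  \<comment> \<open>Both limits carry the factor 1 / sqrt (2 pi): on the left it is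
    \<open>?n 0\<close>, on the right it is the constant in \<open>smoothed\<close>.\<close>
  from LIMSEQ_unique[OF L this] show ?thesis by (simp add: n0)
qed

section \<open>Tensor products of one-dimensional functions\<close>

definition cutoff :: "real \<Rightarrow> complex" where
  "cutoff x = smooth_step (x + 2) * smooth_step (2 - x)"

lemma cutoff_eq_1: "\<bar>x\<bar> \<le> 1 \<Longrightarrow> cutoff x = 1"
  by (simp add: cutoff_def smooth_step_ge_1)

lemma cutoff_eq_0: "2 \<le> \<bar>x\<bar> \<Longrightarrow> cutoff x = 0"
  by (cases "x \<ge> 0") (auto simp: cutoff_def smooth_step_le_0)

lemma cutoff_norm_le: "norm (cutoff x) \<le> 1"
  using mult_mono[OF smooth_step_norm_le smooth_step_norm_le, of "x + 2" "2 - x"]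
  by (simp add: cutoff_def norm_mult mult.commute)

lemma test1_cutoff: "test1 cutoff"
  unfolding test1_def
proof
  show "smooth1 cutoff"
    using smooth1_mult[OF smooth1_affine[OF smooth1_smooth_step, of 1 2] smooth1_affine[OF smooth1_smooth_step, of "-1" 2]]
    by (simp add: cutoff_def[abs_def])
  show "\<exists>a. \<forall>x. a < \<bar>x\<bar> \<longrightarrow> cutoff x = 0" by (rule exI[of _ 2]) (auto simp: cutoff_eq_0)
qed

definition cutoff_dil :: "nat \<Rightarrow> real \<Rightarrow> complex" where
  "cutoff_dil j x = cutoff (1 / (real j + 1) * x)"

lemma test1_scale: assumes "test1 f" "a \<noteq> 0" shows "test1 (\<lambda>x. f (a * x))"
proof -
  obtain r where r: "0 < r" "\<And>x. r < \<bar>x\<bar> \<Longrightarrow> f x = 0" using test1_supportE[OF assms(1)] by blast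
  have "\<forall>x. r / \<bar>a\<bar> < \<bar>x\<bar> \<longrightarrow> f (a * x) = 0"
    using r assms(2) by (auto simp: abs_mult divide_less_eq mult.commute)
  moreover have "smooth1 (\<lambda>x. f (a * x))"
    using smooth1_affine[OF test1_smooth1[OF assms(1)], of a 0] by simp
  ultimately show ?thesis unfolding test1_def by blast
qed

lemma test1_cutoff_dil: "test1 (cutoff_dil j)"
  unfolding cutoff_dil_def[abs_def] by (intro test1_scale test1_cutoff) auto

lemma cutoff_dil_norm_le: "norm (cutoff_dil j x) \<le> 1"
  by (simp add: cutoff_dil_def cutoff_norm_le)

lemma cutoff_dil_eq_1: "\<bar>x\<bar> \<le> real j + 1 \<Longrightarrow> cutoff_dil j x = 1"
  unfolding cutoff_dil_def by (rule cutoff_eq_1) (simp add: abs_mult)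

lemma cutoff_dil_tendsto: "(\<lambda>j. cutoff_dil j x) \<longlonglongrightarrow> 1"
proof (rule tendsto_eventually)
  obtain N :: nat where "\<bar>x\<bar> \<le> real N" using real_arch_simple by blast
  then show "\<forall>\<^sub>F j in sequentially. cutoff_dil j x = 1"
    by (intro eventually_sequentiallyI[of N] cutoff_dil_eq_1) (auto simp flip: of_nat_le_iff)
qed

text \<open>For \<open>m = 0\<close> the difference vanishes unless |x| > j + 1, and it never
  exceeds 2; for larger \<open>m\<close> each derivative brings a factor 1/(j + 1). Conceding the
  growth 1 + |x| buys the rate 1/(j + 1) for all \<open>x\<close>, and the decay of a Schwartz
  factor will absorb this growth.\<close>

lemma cutoff_dil_minus_1_bound:
  "\<exists>C. \<forall>j x. norm ((D1 ^^ m) (\<lambda>x. cutoff_dil j x - 1) x) \<le> C * (1 + \<bar>x\<bar>) / (real j + 1)"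
proof (cases m)
  case 0
  have "norm (cutoff_dil j x - 1) \<le> 2 * (1 + \<bar>x\<bar>) / (real j + 1)" for j x
  proof (cases "\<bar>x\<bar> \<le> real j + 1")
    case False
    have "norm (cutoff_dil j x - 1) \<le> 2" using norm_triangle_ineq4[of "cutoff_dil j x" 1] cutoff_dil_norm_le[of j x] by simp
    also have "2 \<le> 2 * (1 + \<bar>x\<bar>) / (real j + 1)" using False by (simp add: field_simps)
    finally show ?thesis .
  qed (simp add: cutoff_dil_eq_1)
  then show ?thesis using 0 by (intro exI[of _ 2]) simp
next
  case (Suc n)
  obtain C where C: "0 \<le> C" "\<And>x. norm ((D1 ^^ m) cutoff x) \<le> C"
    using test1_bounded[OF test1_funpow_D1[OF test1_cutoff]] by blast
  have "norm ((D1 ^^ m) (\<lambda>x. cutoff_dil j x - 1) x) \<le> C * (1 + \<bar>x\<bar>) / (real j + 1)" for j x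
  proof -
    let ?a = "1 / (real j + 1)"
    have "(D1 ^^ m) (\<lambda>x. cutoff_dil j x - 1) x = (D1 ^^ m) (cutoff_dil j) x"
    proof -
      have "(D1 ^^ m) (\<lambda>x. 1) = (\<lambda>x. 0)" unfolding Suc by (rule funpow_D1_const)
      then show ?thesis using funpow_D1_diff[OF test1_smooth1[OF test1_cutoff_dil] smooth1_const, of m j 1] by simp
    qed
    also have "\<dots> = of_real ?a ^ m * (D1 ^^ m) cutoff (?a * x)"
      unfolding cutoff_dil_def[abs_def] funpow_D1_scale[OF test1_smooth1[OF test1_cutoff]] ..
    also have "norm \<dots> = ?a ^ m * norm ((D1 ^^ m) cutoff (?a * x))"
      by (simp only: norm_mult norm_power norm_of_real) simp
    also have "\<dots> \<le> ?a * C"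
    proof (intro mult_mono C)
      have "?a ^ m \<le> ?a ^ 1" using Suc by (intro power_decreasing) (auto simp: field_simps)
      then show "?a ^ m \<le> ?a" by simp
    qed auto
    also have "\<dots> \<le> C * (1 + \<bar>x\<bar>) / (real j + 1)" using C(1) by (simp add: field_simps)
    finally show ?thesis .
  qed
  then show ?thesis by blast
qed

text \<open>Induction on \<open>m\<close> through the Leibniz rule, which replaces the pair (u, h)
  by (u, h') and (u', h). This is why both functions are generalized and why the hypothesis covers
  all derivatives of \<open>u\<close>.\<close>

lemma family_mult_bound:
  fixes u :: "nat \<Rightarrow> real \<Rightarrow> complex"
  assumes "\<And>j. smooth1 (u j)" "schwartz1 h"
    and "\<And>m. \<exists>C. \<forall>j x. norm ((D1 ^^ m) (u j) x) \<le> C * (1 + \<bar>x\<bar>) / (real j + 1)"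
  shows "\<exists>C. \<forall>j x. \<bar>x\<bar> ^ k * norm ((D1 ^^ m) (\<lambda>x. u j x * h x) x) \<le> C / (real j + 1)"
  using assms
proof (induction m arbitrary: u h)
  case 0
  obtain C where C: "\<And>j x. norm ((D1 ^^ 0) (u j) x) \<le> C * (1 + \<bar>x\<bar>) / (real j + 1)"
    using "0.prems"(3) by blast
  obtain A B where A: "\<And>x. \<bar>x\<bar> ^ k * norm ((D1 ^^ 0) h x) \<le> A" and B: "\<And>x. \<bar>x\<bar> ^ Suc k * norm ((D1 ^^ 0) h x) \<le> B"
    using "0.prems"(2) unfolding schwartz1_def by metis
  have C0: "0 \<le> C" using order_trans[OF norm_ge_zero C[of 0 0]] by simp
  have "\<bar>x\<bar> ^ k * norm (u j x * h x) \<le> C * (A + B) / (real j + 1)" for j x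
  proof -
    have "\<bar>x\<bar> ^ k * norm (u j x * h x) = norm (u j x) * (\<bar>x\<bar> ^ k * norm (h x))" by (simp add: norm_mult mult_ac)
    also have "\<dots> \<le> (C * (1 + \<bar>x\<bar>) / (real j + 1)) * (\<bar>x\<bar> ^ k * norm (h x))"
      using C[of j x] by (intro mult_right_mono) auto
    \<comment> \<open>The growth 1 + |x| is absorbed here: it raises the weight on \<open>h\<close>
      by one power of |x|.\<close>
    also have "\<dots> = C / (real j + 1) * (\<bar>x\<bar> ^ k * norm (h x) + \<bar>x\<bar> ^ Suc k * norm (h x))"
      by (simp add: algebra_simps add_divide_distrib)
    also have "\<dots> \<le> C / (real j + 1) * (A + B)"
      using A[of x] B[of x] C0 by (intro mult_left_mono add_mono) auto
    finally show ?thesis by simp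
  qed
  then show ?case by auto
next
  case (Suc m)
  have s: "smooth1 (\<lambda>x. u j x * D1 h x)" "smooth1 (\<lambda>x. D1 (u j) x * h x)" for j
    using Suc.prems schwartz1_smooth1[OF Suc.prems(2)] by (auto intro!: smooth1_mult smooth1_D1_self)
  have eq: "(D1 ^^ Suc m) (\<lambda>x. u j x * h x) = (\<lambda>x. (D1 ^^ m) (\<lambda>x. u j x * D1 h x) x + (D1 ^^ m) (\<lambda>x. D1 (u j) x * h x) x)" for j
    unfolding funpow_Suc_right o_def D1_mult[OF Suc.prems(1) schwartz1_smooth1[OF Suc.prems(2)]]
    by (rule funpow_D1_add[OF s])
  obtain A where A: "\<And>j x. \<bar>x\<bar> ^ k * norm ((D1 ^^ m) (\<lambda>x. u j x * D1 h x) x) \<le> A / (real j + 1)"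
    using Suc.IH[of u "D1 h"] Suc.prems schwartz1_D1 by blast
  have "\<exists>C. \<forall>j x. norm ((D1 ^^ n) (D1 (u j)) x) \<le> C * (1 + \<bar>x\<bar>) / (real j + 1)" for n
    using Suc.prems(3)[of "Suc n"] by (simp only: funpow_Suc_right o_def)
  then obtain B where B: "\<And>j x. \<bar>x\<bar> ^ k * norm ((D1 ^^ m) (\<lambda>x. D1 (u j) x * h x) x) \<le> B / (real j + 1)"
    using Suc.IH[of "\<lambda>j. D1 (u j)" h] Suc.prems smooth1_D1_self by blast
  have "\<bar>x\<bar> ^ k * norm ((D1 ^^ Suc m) (\<lambda>x. u j x * h x) x) \<le> (A + B) / (real j + 1)" for j x
  proof -
    have "\<bar>x\<bar> ^ k * norm ((D1 ^^ Suc m) (\<lambda>x. u j x * h x) x) \<le>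
        \<bar>x\<bar> ^ k * (norm ((D1 ^^ m) (\<lambda>x. u j x * D1 h x) x) + norm ((D1 ^^ m) (\<lambda>x. D1 (u j) x * h x) x))"
      unfolding eq by (intro mult_left_mono norm_triangle_ineq) auto
    also have "\<dots> \<le> A / (real j + 1) + B / (real j + 1)"
      using A[of x j] B[of x j] by (simp add: distrib_left)
    finally show ?thesis by (simp add: add_divide_distrib)
  qed
  then show ?case by blast
qed

lemma cutoff_dil_mult_bound:
  assumes "schwartz1 h"
  shows "\<exists>C. \<forall>j x. \<bar>x\<bar> ^ k * norm ((D1 ^^ m) (\<lambda>x. cutoff_dil j x * h x) x - (D1 ^^ m) h x) \<le> C / (real j + 1)"
proof -
  have s: "smooth1 (\<lambda>x. cutoff_dil j x * h x)" for j
    by (intro smooth1_mult test1_smooth1 test1_cutoff_dil schwartz1_smooth1 assms)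
  have "(D1 ^^ m) (\<lambda>x. (cutoff_dil j x - 1) * h x) = (\<lambda>x. (D1 ^^ m) (\<lambda>x. cutoff_dil j x * h x) x - (D1 ^^ m) h x)" for j
    using funpow_D1_diff[OF s schwartz1_smooth1[OF assms], of m j] by (simp add: left_diff_distrib)
  then show ?thesis
    using family_mult_bound[of "\<lambda>j x. cutoff_dil j x - 1" h k m] assms cutoff_dil_minus_1_bound
    by (simp add: smooth1_diff smooth1_const test1_smooth1[OF test1_cutoff_dil])
qed

text \<open>The weight (1 + |x|)^k is preferred to |x|^k because in several variables the product of
  the 1 + |x_i| dominates the norm, so the weight can be shared among the factors of a tensor. The
  rate \<open>e\<close> is 1 for a single function and 1/(j + 1) for the cutoff errors.\<close>

lemma weight_bound:
  assumes "\<And>k. \<exists>C. \<forall>j x. \<bar>x\<bar> ^ k * norm (F j x :: complex) \<le> C * e j" "\<And>j. 0 \<le> e j"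
  shows "\<exists>C\<ge>0. \<forall>j x. (1 + \<bar>x\<bar>) ^ k * norm (F j x) \<le> C * e j"
proof -
  obtain A B where A: "\<And>j x. \<bar>x\<bar> ^ 0 * norm (F j x) \<le> A * e j" and B: "\<And>j x. \<bar>x\<bar> ^ k * norm (F j x) \<le> B * e j"
    using assms(1)[of 0] assms(1)[of k] by blast
  have w: "(1 + \<bar>x\<bar>) ^ k \<le> 2 ^ k * (1 + \<bar>x\<bar> ^ k)" for x :: real
  proof -
    have "(1 + \<bar>x\<bar>) ^ k \<le> (2 * max 1 \<bar>x\<bar>) ^ k" by (intro power_mono) auto
    also have "\<dots> = 2 ^ k * (max 1 \<bar>x\<bar>) ^ k" by (rule power_mult_distrib)
    also have "(max 1 \<bar>x\<bar>) ^ k \<le> 1 + \<bar>x\<bar> ^ k" by (auto simp: max_def)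
    finally show ?thesis by simp
  qed
  have "(1 + \<bar>x\<bar>) ^ k * norm (F j x) \<le> \<bar>2 ^ k * (A + B)\<bar> * e j" for j x
  proof -
    have "(1 + \<bar>x\<bar>) ^ k * norm (F j x) \<le> (2 ^ k * (1 + \<bar>x\<bar> ^ k)) * norm (F j x)"
      by (intro mult_right_mono w) auto
    also have "\<dots> = 2 ^ k * (norm (F j x) + \<bar>x\<bar> ^ k * norm (F j x))" by (simp add: algebra_simps)
    also have "\<dots> \<le> 2 ^ k * (A * e j + B * e j)"
      using A[where x=x] B[of x j] by (intro mult_left_mono add_mono) auto
    also have "\<dots> = (2 ^ k * (A + B)) * e j" by (simp add: algebra_simps)
    also have "\<dots> \<le> \<bar>2 ^ k * (A + B)\<bar> * e j" by (intro mult_right_mono abs_ge_self assms)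
    finally show ?thesis .
  qed
  then show ?thesis by (intro exI[of _ "\<bar>2 ^ k * (A + B)\<bar>"]) auto
qed

section \<open>Tensors and their Schwartz seminorms\<close>

definition tensor :: "('n::finite \<Rightarrow> real \<Rightarrow> complex) \<Rightarrow> real ^ 'n \<Rightarrow> complex" where
  "tensor h x = (\<Prod>i\<in>UNIV. h i (x $ i))"

lemma tensor_upd:
  "tensor (h(i := g)) x = g (x $ i) * (\<Prod>j\<in>UNIV - {i}. h j (x $ j))"
proof -
  have "tensor (h(i := g)) x = (h(i := g)) i (x $ i) * (\<Prod>j\<in>UNIV - {i}. (h(i := g)) j (x $ j))"
    unfolding tensor_def by (rule prod.remove) auto
  also have "(\<Prod>j\<in>UNIV - {i}. (h(i := g)) j (x $ j)) = (\<Prod>j\<in>UNIV - {i}. h j (x $ j))"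
    by (intro prod.cong) auto
  finally show ?thesis by (simp only: fun_upd_same)
qed

lemma tensor_partial:
  assumes "smooth1 (h i)"
  shows "((\<lambda>t. tensor h (x + t *\<^sub>R axis i 1)) has_vector_derivative tensor (h(i := D1 (h i))) x) (at 0)"
proof -
  let ?P = "\<Prod>j\<in>UNIV - {i}. h j (x $ j)"
  have eq: "tensor h (x + t *\<^sub>R axis i 1) = h i (1 * t + x $ i) * ?P" for t
  proof -
    have "tensor h (x + t *\<^sub>R axis i 1) = tensor (h(i := h i)) (x + t *\<^sub>R axis i 1)" by simp
    also have "\<dots> = h i (1 * t + x $ i) * (\<Prod>j\<in>UNIV - {i}. h j ((x + t *\<^sub>R axis i 1) $ j))"
      unfolding tensor_upd by (simp add: axis_def add.commute)
    also have "(\<Prod>j\<in>UNIV - {i}. h j ((x + t *\<^sub>R axis i 1) $ j)) = ?P"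
      by (intro prod.cong) (auto simp: axis_def)
    finally show ?thesis .
  qed
  have "((\<lambda>t. 1 * t + x $ i) has_vector_derivative 1) (at 0)"
    by (simp add: has_real_derivative_iff_has_vector_derivative[symmetric]) (auto intro!: derivative_eq_intros)
  then have "((\<lambda>t. h i (1 * t + x $ i)) has_vector_derivative D1 (h i) (x $ i)) (at 0)"
    using vector_diff_chain_at[of "\<lambda>t. 1 * t + x $ i" 1 0 "h i" "D1 (h i) (x $ i)"] has_D1[OF assms, of "x $ i"]
    by (simp add: o_def)
  then have "((\<lambda>t. h i (1 * t + x $ i) * ?P) has_vector_derivative D1 (h i) (x $ i) * ?P) (at 0)"
    by (rule has_vector_derivative_mult_left)
  then show ?thesis unfolding eq tensor_upd .
qed

text \<open>A partial derivative touches one factor only, so the factor \<open>i\<close> is affected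
  just by how often \<open>i\<close> occurs in the list.\<close>

lemma iter_partial_tensor:
  assumes "\<And>i. smooth1 (h i)"
  shows "iter_partial is (tensor h) = tensor (\<lambda>i. (D1 ^^ count_list is i) (h i))"
proof (induction "is")
  case (Cons i "is")
  let ?h = "\<lambda>i. (D1 ^^ count_list is i) (h i)"
  have "iter_partial (i # is) (tensor h) = tensor (?h(i := D1 (?h i)))"
    by (rule ext) (simp add: Cons partial_deriv_def vector_derivative_at[OF tensor_partial[OF smooth1_funpow_D1[OF assms]]])
  also have "?h(i := D1 (?h i)) = (\<lambda>j. (D1 ^^ count_list (i # is) j) (h j))" by auto
  finally show ?case .
qed simp

lemma iter_partial_tensor_diff:
  assumes "\<And>i. smooth1 (h i)" "\<And>i. smooth1 (g i)"
  shows "iter_partial is (\<lambda>x. tensor h x - tensor g x) =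
    (\<lambda>x. tensor (\<lambda>i. (D1 ^^ count_list is i) (h i)) x - tensor (\<lambda>i. (D1 ^^ count_list is i) (g i)) x)"
proof (induction "is")
  case (Cons i "is")
  let ?h = "\<lambda>i. (D1 ^^ count_list is i) (h i)"
  let ?g = "\<lambda>i. (D1 ^^ count_list is i) (g i)"
  have "iter_partial (i # is) (\<lambda>x. tensor h x - tensor g x) = (\<lambda>x. tensor (?h(i := D1 (?h i))) x - tensor (?g(i := D1 (?g i))) x)"
    by (rule ext) (simp add: Cons partial_deriv_def
      vector_derivative_at[OF has_vector_derivative_diff[OF tensor_partial[OF smooth1_funpow_D1[OF assms(1)]] tensor_partial[OF smooth1_funpow_D1[OF assms(2)]]]])
  also have "?h(i := D1 (?h i)) = (\<lambda>j. (D1 ^^ count_list (i # is) j) (h j))" by auto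
  also have "?g(i := D1 (?g i)) = (\<lambda>j. (D1 ^^ count_list (i # is) j) (g j))" by auto
  finally show ?case .
qed simp

lemma tensor_differentiable:
  assumes "\<And>i. smooth1 (h i)" shows "tensor h differentiable (at x)"
proof -
  have "((\<lambda>x. h i (x $ i)) has_derivative (\<lambda>y. (y $ i) *\<^sub>R D1 (h i) (x $ i))) (at x)" for i
    using has_derivative_compose[of "\<lambda>x. x $ i" "\<lambda>y. y $ i" x UNIV "h i"] has_D1[OF assms, of i "x $ i"]
    by (auto simp: has_vector_derivative_def intro!: derivative_intros bounded_linear_imp_has_derivative)
  then have "((\<lambda>x. \<Prod>i\<in>UNIV. h i (x $ i)) has_derivative
      (\<lambda>y. \<Sum>i\<in>UNIV. (y $ i) *\<^sub>R D1 (h i) (x $ i) * (\<Prod>j\<in>UNIV - {i}. h j (x $ j)))) (at x)"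
    by (intro has_derivative_prod) auto
  then show ?thesis unfolding tensor_def[abs_def] differentiable_def by blast
qed

lemma smooth_tensor: "(\<And>i. smooth1 (h i)) \<Longrightarrow> smooth (tensor h)"
  unfolding smooth_def
  by (auto simp: iter_partial_tensor intro!: differentiable_at_imp_differentiable_on tensor_differentiable smooth1_funpow_D1)

lemma sum_le_prod_1_plus:
  fixes f :: "'i \<Rightarrow> real"
  assumes "finite I" "\<And>i. 0 \<le> f i" shows "1 + (\<Sum>i\<in>I. f i) \<le> (\<Prod>i\<in>I. 1 + f i)"
  using assms(1)
proof (induction I rule: finite_induct)
  case (insert j I)
  have "1 + (\<Sum>i\<in>insert j I. f i) \<le> (1 + f j) * (1 + (\<Sum>i\<in>I. f i))"
    using insert assms(2) by (simp add: algebra_simps sum_nonneg)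
  also have "\<dots> \<le> (1 + f j) * (\<Prod>i\<in>I. 1 + f i)"
    using insert assms(2)[of j] by (intro mult_left_mono) auto
  finally show ?case using insert by simp
qed simp

text \<open>The right side factorizes over the coordinates, which reduces the seminorms of tensors
  to one-dimensional bounds.\<close>

lemma norm_le_weight: "norm (x :: real ^ 'n::finite) \<le> (\<Prod>i\<in>UNIV. (1 + \<bar>x $ i\<bar>))"
proof -
  have "norm x \<le> (\<Sum>i\<in>UNIV. \<bar>x $ i\<bar>)" by (rule norm_le_l1_cart)
  also have "\<dots> \<le> 1 + (\<Sum>i\<in>UNIV. \<bar>x $ i\<bar>)" by simp
  also have "\<dots> \<le> (\<Prod>i\<in>UNIV. (1 + \<bar>x $ i\<bar>))" by (rule sum_le_prod_1_plus) auto
  finally show ?thesis .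
qed

lemma weighted_tensor_le:
  fixes x :: "real ^ 'n::finite"
  shows "norm x ^ k * norm (c :: complex) \<le> norm ((\<Prod>i\<in>UNIV. of_real ((1 + \<bar>x $ i\<bar>) ^ k)) * c)"
proof -
  have "norm x ^ k \<le> (\<Prod>i\<in>UNIV. (1 + \<bar>x $ i\<bar>)) ^ k" by (intro power_mono norm_le_weight) auto
  also have "\<dots> = norm (\<Prod>i\<in>UNIV. complex_of_real ((1 + \<bar>x $ i\<bar>) ^ k))"
    by (simp add: prod_norm[symmetric] norm_power prod_power_distrib[symmetric] del: of_real_add of_real_power)
  finally show ?thesis by (simp add: norm_mult mult_right_mono)
qed

lemma schwartz1_weighted:
  assumes "schwartz1 h" shows "\<exists>C\<ge>0. \<forall>x. (1 + \<bar>x\<bar>) ^ k * norm ((D1 ^^ m) h x) \<le> C"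
  using weight_bound[of "\<lambda>_::nat. (D1 ^^ m) h" "\<lambda>_. 1" k] assms unfolding schwartz1_def by auto

lemma tensor_schwartz:
  assumes "\<And>i. schwartz1 (h i)" shows "tensor h \<in> schwartz"
  unfolding schwartz_def
proof (intro CollectI conjI allI)
  show "smooth (tensor h)" by (intro smooth_tensor schwartz1_smooth1 assms)
  fix k "is"
  have "\<forall>i. \<exists>C\<ge>0. \<forall>x. (1 + \<bar>x\<bar>) ^ k * norm ((D1 ^^ count_list is i) (h i) x) \<le> C"
    using schwartz1_weighted[OF assms] by blast
  then obtain C where C: "\<And>i. 0 \<le> C i" "\<And>i x. (1 + \<bar>x\<bar>) ^ k * norm ((D1 ^^ count_list is i) (h i) x) \<le> C i" by metis
  have "norm x ^ k * norm (iter_partial is (tensor h) x) \<le> (\<Prod>i\<in>UNIV. C i)" for x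
  proof -
    have "norm x ^ k * norm (iter_partial is (tensor h) x) \<le> norm ((\<Prod>i\<in>UNIV. of_real ((1 + \<bar>x $ i\<bar>) ^ k)) * iter_partial is (tensor h) x)"
      by (rule weighted_tensor_le)
    also have "\<dots> = (\<Prod>i\<in>UNIV. (1 + \<bar>x $ i\<bar>) ^ k * norm ((D1 ^^ count_list is i) (h i) (x $ i)))"
      by (simp add: iter_partial_tensor schwartz1_smooth1 assms tensor_def prod.distrib[symmetric] prod_norm[symmetric] norm_mult norm_power del: of_real_add of_real_power)
    also have "\<dots> \<le> (\<Prod>i\<in>UNIV. C i)" by (intro prod_mono conjI C) auto
    finally show ?thesis .
  qed
  then show "bounded (range (\<lambda>x. norm x ^ k * norm (iter_partial is (tensor h) x)))"
    by (auto simp: bounded_iff intro!: exI[of _ "\<Prod>i\<in>UNIV. C i"])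
qed

text \<open>The factors are exchanged one at a time, each exchange costing \<open>e\<close> times a
  product of remaining factors; \<open>1 \<le> B\<close> allows all powers of \<open>B\<close> to be
  raised to the largest one.\<close>

lemma prod_diff_bound:
  fixes a b :: "'i \<Rightarrow> complex" and B e :: real
  assumes "finite I" "\<And>i. i \<in> I \<Longrightarrow> norm (a i) \<le> B" "\<And>i. i \<in> I \<Longrightarrow> norm (b i) \<le> B" "1 \<le> B"
    "\<And>i. i \<in> I \<Longrightarrow> norm (a i - b i) \<le> e" "0 \<le> e"
  shows "norm ((\<Prod>i\<in>I. a i) - (\<Prod>i\<in>I. b i)) \<le> card I * B ^ card I * e"
  using assms(1-3,5)
proof (induction I rule: finite_induct)
  case (insert j I)
  have b: "norm (\<Prod>i\<in>I. b i) \<le> B ^ card I"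
    unfolding prod_norm[symmetric] using insert prod_le_power[of I "\<lambda>i. norm (b i)" B "card I"] assms(4) by auto
  have "(\<Prod>i\<in>insert j I. a i) - (\<Prod>i\<in>insert j I. b i) = a j * ((\<Prod>i\<in>I. a i) - (\<Prod>i\<in>I. b i)) + (a j - b j) * (\<Prod>i\<in>I. b i)"
    using insert by (simp add: algebra_simps)
  also have "norm \<dots> \<le> norm (a j) * norm ((\<Prod>i\<in>I. a i) - (\<Prod>i\<in>I. b i)) + norm (a j - b j) * norm (\<Prod>i\<in>I. b i)"
    by (rule norm_triangle_le) (simp add: norm_mult)
  also have "\<dots> \<le> B * (card I * B ^ card I * e) + e * B ^ card I"
    using insert assms b by (intro add_mono mult_mono) auto
  also have "\<dots> \<le> B * (card I * B ^ card I * e) + e * B ^ Suc (card I)"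
    using assms by (intro add_left_mono mult_left_mono power_increasing) auto
  also have "\<dots> = card (insert j I) * B ^ card (insert j I) * e"
    using insert by (simp add: algebra_simps)
  finally show ?case .
qed simp

text \<open>Once the weight is distributed over the factors, the seminorm concerns a difference of
  two products whose corresponding factors are O(1/(j + 1)) apart, and
  \<open>prod_diff_bound\<close> preserves this rate.\<close>

lemma schwartz_tendsto_cutoff_dil:
  fixes h :: "'n::finite \<Rightarrow> real \<Rightarrow> complex"
  assumes "\<And>i. schwartz1 (h i)"
  shows "schwartz_tendsto (\<lambda>j. tensor (\<lambda>i x. cutoff_dil j x * h i x)) (tensor h)"
  unfolding schwartz_tendsto_def
proof (intro allI)
  fix k and "is" :: "'n list"
  let ?g = "\<lambda>j i x. cutoff_dil j x * h i x" and ?n = "count_list is"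
  let ?w = "\<lambda>x. complex_of_real ((1 + \<bar>x\<bar>) ^ k)"
  have sm: "smooth1 (?g j i)" "smooth1 (h i)" for i j
    by (intro smooth1_mult test1_smooth1 test1_cutoff_dil schwartz1_smooth1 assms)+
  have "\<forall>i. \<exists>C\<ge>0. \<forall>j x. (1 + \<bar>x\<bar>) ^ k * norm ((D1 ^^ ?n i) (?g j i) x - (D1 ^^ ?n i) (h i) x) \<le> C * (1 / (real j + 1))"
    using cutoff_dil_mult_bound[OF assms] by (intro allI weight_bound) auto
  then obtain A where A: "\<And>i. 0 \<le> A i" "\<And>i j x. (1 + \<bar>x\<bar>) ^ k * norm ((D1 ^^ ?n i) (?g j i) x - (D1 ^^ ?n i) (h i) x) \<le> A i * (1 / (real j + 1))" by metis
  have "\<forall>i. \<exists>C\<ge>0. \<forall>x. (1 + \<bar>x\<bar>) ^ k * norm ((D1 ^^ ?n i) (h i) x) \<le> C"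
    using schwartz1_weighted[OF assms] by blast
  then obtain C where C: "\<And>i. 0 \<le> C i" "\<And>i x. (1 + \<bar>x\<bar>) ^ k * norm ((D1 ^^ ?n i) (h i) x) \<le> C i" by metis
  define E where "E = (\<Sum>i\<in>UNIV. A i)"
  \<comment> \<open>The weighted original factor is bounded by \<open>C i\<close> and its cut-off
    version differs from it by at most \<open>A i\<close>, so \<open>A i + C i\<close> bounds both;
    the leading 1 provides \<open>1 \<le> B\<close>.\<close>
  define B where "B = 1 + (\<Sum>i\<in>UNIV. A i + C i)"
  have E: "A i \<le> E" "0 \<le> E" for i
    unfolding E_def using A(1) by (auto intro!: member_le_sum sum_nonneg)
  have B: "A i + C i \<le> B" "1 \<le> B" for i
  proof -
    have "A i + C i \<le> (\<Sum>i\<in>UNIV. A i + C i)" using A(1) C(1) by (intro member_le_sum) auto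
    then show "A i + C i \<le> B" by (simp add: B_def)
    show "1 \<le> B" unfolding B_def using A(1) C(1) by (auto intro!: sum_nonneg add_nonneg_nonneg)
  qed
  define K where "K = real CARD('n) * B ^ CARD('n) * E"
  have bd: "norm x ^ k * norm (iter_partial is (\<lambda>x. tensor (?g j) x - tensor h x) x) \<le> K / (real j + 1)" for j x
  proof -
    let ?a = "\<lambda>i. ?w (x $ i) * (D1 ^^ ?n i) (?g j i) (x $ i)" and ?b = "\<lambda>i. ?w (x $ i) * (D1 ^^ ?n i) (h i) (x $ i)"
    have d: "norm (?a i - ?b i) \<le> A i * (1 / (real j + 1))" for i
      using A(2)[of "x $ i" i j] by (simp add: right_diff_distrib[symmetric] norm_mult norm_power del: of_real_add of_real_power)
    have bb: "norm (?b i) \<le> C i" for i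
      using C(2)[of "x $ i" i] by (simp add: norm_mult norm_power del: of_real_add of_real_power)
    have Aj: "A i * (1 / (real j + 1)) \<le> A i" for i
      using A(1)[of i] by (simp add: field_simps)
    have aa: "norm (?a i) \<le> A i + C i" for i
      using norm_triangle_sub[of "?a i" "?b i"] d[of i] bb[of i] Aj[of i] by linarith
    have "norm x ^ k * norm (iter_partial is (\<lambda>x. tensor (?g j) x - tensor h x) x) \<le>
        norm ((\<Prod>i\<in>UNIV. ?w (x $ i)) * iter_partial is (\<lambda>x. tensor (?g j) x - tensor h x) x)"
      by (rule weighted_tensor_le)
    also have "\<dots> = norm ((\<Prod>i\<in>UNIV. ?a i) - (\<Prod>i\<in>UNIV. ?b i))"
      by (subst iter_partial_tensor_diff[OF sm]) (simp only: tensor_def prod.distrib right_diff_distrib)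
    also have "\<dots> \<le> card (UNIV :: 'n set) * B ^ card (UNIV :: 'n set) * (E * (1 / (real j + 1)))"
    proof (rule prod_diff_bound)
      fix i
      show "norm (?a i) \<le> B" using aa B(1) order_trans by blast
      show "norm (?b i) \<le> B" using bb[of i] B(1)[of i] A(1)[of i] by linarith
      show "norm (?a i - ?b i) \<le> E * (1 / (real j + 1))"
        by (rule order_trans[OF d]) (intro mult_right_mono E, simp)
    qed (use B E in auto)
    finally show ?thesis by (simp add: K_def)
  qed
  have up: "schwartz_seminorm k is (\<lambda>x. tensor (?g j) x - tensor h x) \<le> K / (real j + 1)" for j
    unfolding schwartz_seminorm_def by (intro cSUP_least bd) auto
  have low: "0 \<le> schwartz_seminorm k is (\<lambda>x. tensor (?g j) x - tensor h x)" for j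
    unfolding schwartz_seminorm_def
  proof (rule cSUP_upper2[of _ _ 0])
    show "bdd_above (range (\<lambda>x. norm x ^ k * norm (iter_partial is (\<lambda>x. tensor (?g j) x - tensor h x) x)))"
      by (rule bdd_aboveI[of _ "K / (real j + 1)"]) (use bd in blast)
  qed simp_all
  have lim: "(\<lambda>j. K / (real j + 1)) \<longlonglongrightarrow> 0" by real_asymp
  show "(\<lambda>j. schwartz_seminorm k is (\<lambda>x. tensor (?g j) x - tensor h x)) \<longlonglongrightarrow> 0"
    by (rule tendsto_sandwich[OF always_eventually always_eventually tendsto_const lim]) (use low up in blast)+
qed

lemma tensor_test_functions:
  assumes "\<And>i. test1 (h i)" shows "tensor h \<in> test_functions"
  unfolding test_functions_def
proof (intro CollectI conjI)
  show "smooth (tensor h)" by (intro smooth_tensor test1_smooth1 assms)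
  have "\<forall>i. \<exists>a. \<forall>x. a < \<bar>x\<bar> \<longrightarrow> h i x = 0" using assms by (auto simp: test1_def)
  then obtain a where a: "\<And>i x. a i < \<bar>x\<bar> \<Longrightarrow> h i x = 0" by metis
  have "{x. tensor h x \<noteq> 0} \<subseteq> cbox (\<chi> i. - a i) (\<chi> i. a i)"
  proof
    fix x assume "x \<in> {x. tensor h x \<noteq> 0}"
    then have "h i (x $ i) \<noteq> 0" for i by (auto simp: tensor_def)
    then have "\<bar>x $ i\<bar> \<le> a i" for i using a[of i "x $ i"] by force
    then show "x \<in> cbox (\<chi> i. - a i) (\<chi> i. a i)" by (auto simp: mem_box_cart abs_le_iff minus_le_iff)
  qed
  then show "compact (supp (tensor h))"
    unfolding supp_def using bounded_subset[OF bounded_cbox] by (simp add: compact_closure)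
qed

lemma tensor_measurable:
  assumes [measurable]: "\<And>i. h i \<in> borel_measurable borel"
  shows "tensor h \<in> borel_measurable borel"
  unfolding tensor_def[abs_def] by measurable

section \<open>Lebesgue measure as a product measure, and integrals of tensors\<close>

lemma lborel_vec_eq:
  "(lborel :: (real ^ 'n::finite) measure) = distr (\<Pi>\<^sub>M i\<in>UNIV. lborel) borel (\<lambda>f. \<chi> i. f i)"
proof (rule lborel_eqI)
  interpret product_sigma_finite "\<lambda>i::'n. lborel :: real measure" ..
  have [measurable]: "(\<lambda>f. (\<chi> i. f i) :: real ^ 'n) \<in> (\<Pi>\<^sub>M i\<in>UNIV. lborel) \<rightarrow>\<^sub>M borel"
    by (rule borel_measurable_euclidean_space[THEN iffD2]) (auto simp: Basis_vec_def inner_axis)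
  fix l u :: "real ^ 'n" assume le: "\<And>b. b \<in> Basis \<Longrightarrow> l \<bullet> b \<le> u \<bullet> b"
  have le': "l $ i \<le> u $ i" for i
    using le[of "axis i 1"] by (simp add: axis_in_Basis_iff inner_axis)
  have "emeasure (distr (\<Pi>\<^sub>M i\<in>UNIV. lborel) borel (\<lambda>f. (\<chi> i. f i) :: real ^ 'n)) (box l u) =
      emeasure (\<Pi>\<^sub>M i\<in>(UNIV::'n set). lborel) (\<Pi>\<^sub>E i\<in>UNIV. {l $ i<..<u $ i})"
    by (subst emeasure_distr) (auto simp: mem_box_cart space_PiM PiE_iff intro!: arg_cong2[where f=emeasure])
  also have "\<dots> = (\<Prod>i\<in>UNIV. emeasure lborel {l $ i<..<u $ i})"
    by (rule emeasure_PiM) auto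
  also have "\<dots> = (\<Prod>i\<in>UNIV. ennreal (u $ i - l $ i))"
    using le' by (intro prod.cong) auto
  also have "\<dots> = ennreal (\<Prod>i\<in>UNIV. u $ i - l $ i)"
    using le' by (intro prod_ennreal) auto
  also have "(\<Prod>i\<in>UNIV. u $ i - l $ i) = (\<Prod>b\<in>Basis. (u - l) \<bullet> b)"
    unfolding Basis_vec_def
    by (subst prod.reindex_bij_betw[of "\<lambda>i. axis i 1" UNIV, symmetric])
      (auto simp: bij_betw_def inj_on_def axis_eq_axis inner_axis)
  finally show "emeasure (distr (\<Pi>\<^sub>M i\<in>UNIV. lborel) borel (\<lambda>f. (\<chi> i. f i) :: real ^ 'n)) (box l u) = (\<Prod>b\<in>Basis. (u - l) \<bullet> b)" .
qed simp

lemma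
  fixes h :: "'n::finite \<Rightarrow> real \<Rightarrow> 'b::{real_normed_field, banach, second_countable_topology}"
  assumes "\<And>i. integrable lborel (h i)"
  shows integrable_prod_vec: "integrable lborel (\<lambda>x :: real ^ 'n. \<Prod>i\<in>UNIV. h i (x $ i))"
    and integral_prod_vec: "(\<integral>x. (\<Prod>i\<in>UNIV. h i (x $ i)) \<partial>(lborel :: (real ^ 'n) measure)) = (\<Prod>i\<in>UNIV. \<integral>t. h i t \<partial>lborel)"
proof -
  interpret product_sigma_finite "\<lambda>i::'n. lborel :: real measure" ..
  have m[measurable]: "(\<lambda>f. (\<chi> i. f i) :: real ^ 'n) \<in> (\<Pi>\<^sub>M i\<in>UNIV. lborel) \<rightarrow>\<^sub>M borel"
    by (rule borel_measurable_euclidean_space[THEN iffD2]) (auto simp: Basis_vec_def inner_axis)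
  have [measurable]: "h i \<in> borel_measurable borel" for i using borel_measurable_integrable[OF assms] by simp
  have [measurable]: "(\<lambda>x :: real ^ 'n. \<Prod>i\<in>UNIV. h i (x $ i)) \<in> borel_measurable borel" by measurable
  show "integrable lborel (\<lambda>x :: real ^ 'n. \<Prod>i\<in>UNIV. h i (x $ i))"
    unfolding lborel_vec_eq by (subst integrable_distr_eq) (auto intro!: product_integrable_prod assms)
  show "(\<integral>x. (\<Prod>i\<in>UNIV. h i (x $ i)) \<partial>(lborel :: (real ^ 'n) measure)) = (\<Prod>i\<in>UNIV. \<integral>t. h i t \<partial>lborel)"
    unfolding lborel_vec_eq by (subst integral_distr) (auto intro!: product_integral_prod assms)
qed

lemma integrable_tensor: "(\<And>i. integrable lborel (h i)) \<Longrightarrow> integrable lborel (tensor h)"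
  unfolding tensor_def[abs_def] by (rule integrable_prod_vec)

lemma fourier_tensor:
  fixes h :: "'n::finite \<Rightarrow> real \<Rightarrow> complex"
  assumes "\<And>i. integrable lborel (h i)"
  shows "fourier (tensor h) = tensor (\<lambda>i. F1 (h i))"
proof
  fix \<xi> :: "real ^ 'n"
  have [measurable]: "h i \<in> borel_measurable borel" for i using borel_measurable_integrable[OF assms] by simp
  have eq: "exp (- 2 * of_real pi * \<i> * of_real (x \<bullet> \<xi>)) * tensor h x = (\<Prod>i\<in>UNIV. echar (x $ i * \<xi> $ i) * h i (x $ i))" for x
  proof -
    have "exp (- 2 * of_real pi * \<i> * of_real (x \<bullet> \<xi>)) = echar (\<Sum>i\<in>UNIV. x $ i * \<xi> $ i)"
      by (simp add: echar_def inner_vec_def)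
    then show ?thesis by (simp add: echar_sum tensor_def prod.distrib)
  qed
  have "fourier (tensor h) \<xi> = (\<integral>x. (\<Prod>i\<in>UNIV. echar (x $ i * \<xi> $ i) * h i (x $ i)) \<partial>lebesgue)"
    unfolding fourier_def eq ..
  also have "\<dots> = (\<integral>x. (\<Prod>i\<in>UNIV. echar (x $ i * \<xi> $ i) * h i (x $ i)) \<partial>(lborel :: (real ^ 'n) measure))"
    by (rule integral_completion) measurable
  also have "\<dots> = (\<Prod>i\<in>UNIV. \<integral>t. echar (t * \<xi> $ i) * h i t \<partial>lborel)"
    by (rule integral_prod_vec) (intro integrable_echar_mult assms)
  finally show "fourier (tensor h) \<xi> = tensor (\<lambda>i. F1 (h i)) \<xi>" by (simp add: tensor_def F1_def)
qed

section \<open>Distributions tested on tensors\<close>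

text \<open>Membership in L^1 + L^infinity, expressed by truncation: the part of \<open>f\<close>
  above the level \<open>s\<close> is integrable and the rest is bounded by \<open>s\<close>. This
  is how \<open>f\<close> is paired with Schwartz tensors, which are bounded and integrable but need
  not have compact support.\<close>

definition L1_plus_Linf :: "('a::euclidean_space \<Rightarrow> complex) \<Rightarrow> bool" where
  "L1_plus_Linf f \<longleftrightarrow> f \<in> borel_measurable borel \<and>
     (\<exists>s\<ge>0. (\<integral>\<^sup>+x. ennreal (norm (f x)) * indicator {x. s < norm (f x)} x \<partial>lborel) < \<infinity>)"

lemma L1_plus_Linf_measurable: "L1_plus_Linf f \<Longrightarrow> f \<in> borel_measurable borel"
  by (simp add: L1_plus_Linf_def)

lemma nn_integral_mult_split_le:
  fixes f :: "'a::euclidean_space \<Rightarrow> complex"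
  assumes [measurable]: "f \<in> borel_measurable borel" "g \<in> borel_measurable borel"
    and "\<And>x. norm (g x :: complex) \<le> B" "0 \<le> s"
  shows "(\<integral>\<^sup>+x. ennreal (norm (f x * g x)) \<partial>lborel) \<le>
    ennreal s * (\<integral>\<^sup>+x. ennreal (norm (g x)) \<partial>lborel) +
    ennreal B * (\<integral>\<^sup>+x. ennreal (norm (f x)) * indicator {x. s < norm (f x)} x \<partial>lborel)"
proof -
  have B: "0 \<le> B" using order_trans[OF norm_ge_zero assms(3)] .
  have "(\<integral>\<^sup>+x. ennreal (norm (f x * g x)) \<partial>lborel) \<le>
    (\<integral>\<^sup>+x. ennreal s * ennreal (norm (g x)) + ennreal B * (ennreal (norm (f x)) * indicator {x. s < norm (f x)} x) \<partial>lborel)"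
  proof (intro nn_integral_mono)
    fix x
    show "ennreal (norm (f x * g x)) \<le> ennreal s * ennreal (norm (g x)) + ennreal B * (ennreal (norm (f x)) * indicator {x. s < norm (f x)} x)"
    proof (cases "s < norm (f x)")
      case True
      have "norm (f x * g x) \<le> s * norm (g x) + B * norm (f x)"
        using assms(3)[of x] assms(4) mult_left_mono[OF assms(3)[of x], of "norm (f x)"]
        by (simp add: norm_mult mult.commute add_increasing)
      then show ?thesis using True B assms(4) by (simp add: ennreal_mult[symmetric] ennreal_plus[symmetric] del: ennreal_plus)
    next
      case False
      then have "norm (f x * g x) \<le> s * norm (g x)" by (simp add: norm_mult mult_right_mono)
      then show ?thesis using False assms(4) by (simp add: ennreal_mult[symmetric])
    qed
  qed
  also have "\<dots> = ennreal s * (\<integral>\<^sup>+x. ennreal (norm (g x)) \<partial>lborel) +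
    ennreal B * (\<integral>\<^sup>+x. ennreal (norm (f x)) * indicator {x. s < norm (f x)} x \<partial>lborel)"
    by (simp add: nn_integral_add nn_integral_cmult)
  finally show ?thesis .
qed

lemma L1_plus_Linf_mult_integrable:
  assumes f: "L1_plus_Linf f" and g: "integrable lborel g" "\<And>x. norm (g x) \<le> B"
  shows "integrable lborel (\<lambda>x. f x * g x :: complex)"
proof -
  note [measurable] = L1_plus_Linf_measurable[OF f]
  have [measurable]: "g \<in> borel_measurable borel" using borel_measurable_integrable[OF g(1)] by simp
  obtain s where s: "0 \<le> s" "(\<integral>\<^sup>+x. ennreal (norm (f x)) * indicator {x. s < norm (f x)} x \<partial>lborel) < \<infinity>"
    using f by (auto simp: L1_plus_Linf_def)
  have "(\<integral>\<^sup>+x. ennreal (norm (f x * g x)) \<partial>lborel) < \<infinity>"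
    by (rule le_less_trans[OF nn_integral_mult_split_le[OF _ _ g(2) s(1)]])
      (use g(1) s in \<open>auto simp: integrable_iff_bounded ennreal_mult_less_top\<close>)
  then show ?thesis by (intro integrableI_bounded) auto
qed

lemma tensor_norm_bound:
  fixes h :: "'n::finite \<Rightarrow> real \<Rightarrow> complex"
  assumes "\<And>i. schwartz1 (h i)" obtains B where "\<And>x. norm (tensor h x) \<le> B"
proof -
  have "\<exists>C\<ge>0. \<forall>x. norm (h i x) \<le> C" for i
    using schwartz1_weighted[OF assms, where k=0 and m=0] by simp
  then obtain C where C: "\<And>i x. norm (h i x) \<le> C i" by metis
  have "norm (tensor h x) \<le> (\<Prod>i\<in>UNIV. C i)" for x
    unfolding tensor_def prod_norm[symmetric] by (intro prod_mono conjI C) auto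
  then show thesis using that by blast
qed

text \<open>The representation by \<open>f\<close> is known on test functions only. Cutting off the
  factors gives test tensors converging in the Schwartz space: \<open>T\<close> follows by
  continuity, the integrals by domination with \<open>norm (f x * tensor h x)\<close>.\<close>

lemma tempered_tensor_eq_integral:
  fixes h :: "'n::finite \<Rightarrow> real \<Rightarrow> complex"
  assumes T: "tempered T" and f: "L1_plus_Linf f"
    and rep: "\<And>\<phi>. \<phi> \<in> test_functions \<Longrightarrow> \<phi> \<in> borel_measurable borel \<Longrightarrow> T \<phi> = (\<integral>x. f x * \<phi> x \<partial>lborel)"
    and h: "\<And>i. schwartz1 (h i)"
  shows "T (tensor h) = (\<integral>x. f x * tensor h x \<partial>lborel)"
proof -
  let ?g = "\<lambda>j i x. cutoff_dil j x * h i x"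
  note [measurable] = L1_plus_Linf_measurable[OF f]
  have hm [measurable]: "tensor h \<in> borel_measurable borel"
    by (intro tensor_measurable smooth1_measurable schwartz1_smooth1 h)
  have test: "test1 (?g j i)" for i j by (intro test1_mult test1_cutoff_dil schwartz1_smooth1 h)
  have gm [measurable]: "tensor (?g j) \<in> borel_measurable borel" for j
    by (intro tensor_measurable smooth1_measurable test1_smooth1 test)
  have "(\<lambda>j. T (tensor (?g j))) \<longlonglongrightarrow> T (tensor h)"
  proof -
    have "\<forall>j. tensor (?g j) \<in> schwartz" by (intro allI tensor_schwartz test1_schwartz1 test)
    moreover have "tensor h \<in> schwartz" by (intro tensor_schwartz h)
    moreover have "schwartz_tendsto (\<lambda>j. tensor (?g j)) (tensor h)" by (intro schwartz_tendsto_cutoff_dil h)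
    ultimately show ?thesis using T unfolding tempered_def by simp
  qed
  moreover have "T (tensor (?g j)) = (\<integral>x. f x * tensor (?g j) x \<partial>lborel)" for j
    by (intro rep tensor_test_functions test gm)
  moreover have "(\<lambda>j. \<integral>x. f x * tensor (?g j) x \<partial>lborel) \<longlonglongrightarrow> (\<integral>x. f x * tensor h x \<partial>lborel)"
  proof (rule integral_dominated_convergence[where w = "\<lambda>x. norm (f x * tensor h x)"])
    obtain B where "\<And>x. norm (tensor h x) \<le> B" using tensor_norm_bound[of h] h by blast
    then show "integrable lborel (\<lambda>x. norm (f x * tensor h x))"
      by (intro integrable_norm L1_plus_Linf_mult_integrable f integrable_tensor schwartz1_integrable h)
    show "AE x in lborel. (\<lambda>j. f x * tensor (?g j) x) \<longlonglongrightarrow> f x * tensor h x"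
    proof (intro AE_I2 tendsto_intros)
      fix x :: "real ^ 'n"
      have "(\<lambda>j. \<Prod>i\<in>UNIV. cutoff_dil j (x $ i) * h i (x $ i)) \<longlonglongrightarrow> (\<Prod>i\<in>UNIV. 1 * h i (x $ i))"
        by (intro tendsto_intros cutoff_dil_tendsto)
      then show "(\<lambda>j. tensor (?g j) x) \<longlonglongrightarrow> tensor h x" by (simp add: tensor_def)
    qed
    show "AE x in lborel. norm (f x * tensor (?g j) x) \<le> norm (f x * tensor h x)" for j
    proof (intro AE_I2)
      fix x :: "real ^ 'n"
      have "norm (tensor (?g j) x) \<le> norm (tensor h x)"
        unfolding tensor_def prod_norm[symmetric]
        by (intro prod_mono) (auto simp: norm_mult intro!: mult_left_le_one_le cutoff_dil_norm_le)
      then show "norm (f x * tensor (?g j) x) \<le> norm (f x * tensor h x)"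
        by (simp add: norm_mult mult_left_mono)
    qed
  qed measurable
  ultimately show ?thesis using LIMSEQ_unique by simp
qed

section \<open>The transformed distribution as a multilinear functional of the factors\<close>

context
  fixes T :: "(real ^ 'n::finite \<Rightarrow> complex) \<Rightarrow> complex"
  assumes T: "tempered T"
begin

abbreviation FT :: "('n \<Rightarrow> real \<Rightarrow> complex) \<Rightarrow> complex" where
  "FT g \<equiv> T (fourier (tensor g))"

lemma T_zero: "T (\<lambda>x. 0) = 0"
proof -
  have "tensor (\<lambda>i::'n. \<lambda>x::real. 0) \<in> schwartz" by (intro tensor_schwartz test1_schwartz1 test1_zero)
  then have "T (\<lambda>x. 0 * tensor (\<lambda>i::'n. \<lambda>x::real. 0) x) = 0 * T (tensor (\<lambda>i::'n. \<lambda>x::real. 0))"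
    using T unfolding tempered_def by blast
  then show ?thesis by simp
qed

lemma FT_eq: "(\<And>i. test1 (g i)) \<Longrightarrow> FT g = T (tensor (\<lambda>i. F1 (g i)))"
  by (simp add: fourier_tensor test1_integrable)

text \<open>Additivity of \<open>T\<close> is available on \<open>schwartz\<close> only, so both
  summands are first exhibited as Schwartz tensors, namely as transforms of test tensors.\<close>

lemma FT_add:
  assumes g: "\<And>i. test1 (g i)" and a: "test1 a" and b: "test1 b"
  shows "FT (g(i := \<lambda>x. a x + b x)) = FT (g(i := a)) + FT (g(i := b))"
proof -
  have u: "(\<lambda>j. F1 ((g(i := c)) j)) = (\<lambda>j. F1 (g j))(i := F1 c)" for c by auto
  have t: "test1 ((g(i := c)) j)" if "test1 c" for c j using that g by simp
  have S: "tensor ((\<lambda>j. F1 (g j))(i := F1 c)) \<in> schwartz" if "test1 c" for c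
    unfolding u[symmetric] by (intro tensor_schwartz F1_schwartz1 t that)
  have "tensor ((\<lambda>j. F1 (g j))(i := F1 (\<lambda>x. a x + b x))) = (\<lambda>x. tensor ((\<lambda>j. F1 (g j))(i := F1 a)) x + tensor ((\<lambda>j. F1 (g j))(i := F1 b)) x)"
    by (rule ext) (simp add: tensor_upd F1_add test1_integrable a b distrib_right)
  moreover have Fc: "FT (g(i := c)) = T (tensor ((\<lambda>j. F1 (g j))(i := F1 c)))" if "test1 c" for c
    unfolding u[symmetric] by (rule FT_eq) (rule t[OF that])
  ultimately have "FT (g(i := \<lambda>x. a x + b x)) = T (\<lambda>x. tensor ((\<lambda>j. F1 (g j))(i := F1 a)) x + tensor ((\<lambda>j. F1 (g j))(i := F1 b)) x)"
    using test1_add[OF a b] by simp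
  also have "\<dots> = T (tensor ((\<lambda>j. F1 (g j))(i := F1 a))) + T (tensor ((\<lambda>j. F1 (g j))(i := F1 b)))"
    using T S[OF a] S[OF b] unfolding tempered_def by blast
  also have "\<dots> = FT (g(i := a)) + FT (g(i := b))"
    by (simp only: Fc a b)
  finally show ?thesis .
qed

lemma FT_zero: assumes "\<And>x. tensor g x = 0" shows "FT g = 0"
proof -
  have "tensor g = (\<lambda>x. 0)" using assms by auto
  then have "fourier (tensor g) = (\<lambda>x. 0)" by (simp add: fourier_def[abs_def])
  then show ?thesis using T_zero by simp
qed

lemma FT_sum:
  assumes g: "\<And>i. test1 (g i)" and "finite K" "\<And>k. k \<in> K \<Longrightarrow> test1 (a k)"
  shows "FT (g(i := \<lambda>x. \<Sum>k\<in>K. a k x)) = (\<Sum>k\<in>K. FT (g(i := a k)))"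
  using assms(2,3)
proof (induction K rule: finite_induct)
  case empty
  show ?case unfolding sum.empty by (rule FT_zero) (simp only: tensor_upd mult_zero_left)
next
  case (insert k K)
  have "FT (g(i := \<lambda>x. a k x + (\<Sum>k\<in>K. a k x))) = FT (g(i := a k)) + FT (g(i := \<lambda>x. \<Sum>k\<in>K. a k x))"
    using insert by (intro FT_add g test1_sum) auto
  then show ?case
    unfolding sum.insert[OF insert(1,2)] using insert.IH insert.prems by (simp only: insert_iff simp_thms)
qed

end

lemma supp_mono: "(\<And>x. \<phi> x \<noteq> 0 \<Longrightarrow> \<psi> x \<noteq> 0) \<Longrightarrow> supp \<phi> \<subseteq> supp \<psi>"
  unfolding supp_def by (intro closure_mono) auto

text \<open>A smooth partition of unity at scale \<open>d\<close> splits each factor of the tensor in turn, until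
  every piece is supported in a single open set on which the distribution vanishes.\<close>

lemma FT_vanishes_off_dist_supp:
  fixes T :: "(real ^ 'n::finite \<Rightarrow> complex) \<Rightarrow> complex"
  assumes T: "tempered T" and g: "\<And>i. test1 (g i)"
    and disj: "supp (tensor g) \<inter> dist_supp (fourier_dist T) = {}"
  shows "T (fourier (tensor g)) = 0"
proof -
  define K where "K = supp (tensor g)"
  define \<U> where "\<U> = {U. open U \<and> (\<forall>\<phi>\<in>test_functions. supp \<phi> \<subseteq> U \<longrightarrow> fourier_dist T \<phi> = 0)}"
  have comp: "compact K" using tensor_test_functions[of g] g by (simp add: K_def test_functions_def)
  have cov: "K \<subseteq> \<Union>\<U>" using disj unfolding K_def dist_supp_def \<U>_def by auto
  have op: "open U" if "U \<in> \<U>" for U using that by (simp add: \<U>_def)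
  obtain e where e: "0 < e" "\<And>x. x \<in> K \<Longrightarrow> \<exists>U\<in>\<U>. ball x e \<subseteq> U"
    using Heine_Borel_lemma[OF comp cov] op by metis
  \<comment> \<open>In a fully localized piece every coordinate ranges over an interval of length
    \<open>2 * d\<close>, so two of its points are at distance at most
    \<open>CARD('n) * (2 * d) = e / 2\<close>.\<close>
  define d where "d = e / (4 * real CARD('n))"
  have d: "0 < d" using e by (simp add: d_def)
  \<comment> \<open>Here \<open>S\<close> is the set of coordinates not yet localized. The claim is
    generalized over all test tensors supported in \<open>K\<close>, since splitting a factor
    changes the tensor.\<close>
  have main: "T (fourier (tensor g)) = 0"
    if "finite S" "\<And>i. test1 (g i)" "supp (tensor g) \<subseteq> K"
      "\<And>i. i \<notin> S \<Longrightarrow> \<exists>a. \<forall>x. g i x \<noteq> 0 \<longrightarrow> a \<le> x \<and> x \<le> a + 2 * d" for S g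
    using that
  proof (induction S arbitrary: g rule: finite_induct)
    case empty
    show ?case
    proof (cases "\<exists>x. tensor g x \<noteq> 0")
      case True
      then obtain x where x: "tensor g x \<noteq> 0" by blast
      then have "x \<in> K" using empty.prems(2) closure_subset[of "{x. tensor g x \<noteq> 0}"] unfolding supp_def by auto
      then obtain U where U: "U \<in> \<U>" "ball x e \<subseteq> U" using e by blast
      \<comment> \<open>Half of the Lebesgue number \<open>e\<close> leaves room for the closure
        that \<open>supp\<close> takes.\<close>
      have "{y. tensor g y \<noteq> 0} \<subseteq> cball x (e / 2)"
      proof
        fix y assume y: "y \<in> {y. tensor g y \<noteq> 0}"
        have "\<bar>(x - y) $ i\<bar> \<le> 2 * d" for i
        proof -
          obtain a where a: "\<And>x. g i x \<noteq> 0 \<Longrightarrow> a \<le> x \<and> x \<le> a + 2 * d" using empty.prems(3) by blast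
          have "g i (x $ i) \<noteq> 0" "g i (y $ i) \<noteq> 0" using x y by (auto simp: tensor_def)
          then show ?thesis using a[of "x $ i"] a[of "y $ i"] by auto
        qed
        then have "norm (x - y) \<le> (\<Sum>i\<in>(UNIV::'n set). 2 * d)"
          by (intro order_trans[OF norm_le_l1_cart] sum_mono) auto
        also have "\<dots> = e / 2" by (simp add: d_def)
        finally show "y \<in> cball x (e / 2)" by (simp add: dist_norm)
      qed
      then have "supp (tensor g) \<subseteq> cball x (e / 2)" unfolding supp_def by (rule closure_minimal) simp
      also have "\<dots> \<subseteq> ball x e" using e(1) by (simp add: subset_iff)
      finally have sub: "supp (tensor g) \<subseteq> U" using U(2) by (rule subset_trans)
      have tt: "tensor g \<in> test_functions" by (intro tensor_test_functions empty.prems(1))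
      have "\<forall>\<phi>\<in>test_functions. supp \<phi> \<subseteq> U \<longrightarrow> fourier_dist T \<phi> = 0"
        using U(1) unfolding \<U>_def mem_Collect_eq by (rule conjunct2)
      from this[rule_format, OF tt sub] show ?thesis unfolding fourier_dist_def .
    next
      case False
      then show ?thesis by (intro FT_zero[OF T]) simp
    qed
  next
    case (insert i S)
    obtain r where r: "0 < r" "\<And>x. r < \<bar>x\<bar> \<Longrightarrow> g i x = 0" using test1_supportE[OF insert.prems(1)] by blast
    obtain N :: nat where N: "r / d + 1 \<le> real N" using real_arch_simple by blast
    \<comment> \<open>\<open>G k\<close> climbs from 0 to 1 between \<open>d * (k - N)\<close> and
      \<open>d * (k + 1 - N)\<close>, so a difference of neighbours lives on an interval of length
      \<open>2 * d\<close>. The differences telescope, and \<open>N\<close> is so large that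
      \<open>G 0 = 1\<close> and \<open>G (2 * N) = 0\<close> for all |x| \<le> r.\<close>
    define G where "G k x = smooth_step ((1 / d) * x + (real N - real k))" for k x
    have Gs: "smooth1 (G k)" for k unfolding G_def[abs_def] by (intro smooth1_affine smooth1_smooth_step)
    define p where "p k x = g i x * (G k x - G (Suc k) x)" for k x
    have pt: "test1 (p k)" for k
      unfolding p_def[abs_def] by (intro test1_mult smooth1_diff Gs insert.prems)
    have sum: "(\<Sum>k<2*N. p k x) = g i x" for x
    proof (cases "r < \<bar>x\<bar>")
      case False
      have "(\<Sum>k<2*N. G k x - G (Suc k) x) = G 0 x - G (2 * N) x" by (rule sum_lessThan_telescope')
      also have "G 0 x = 1"
      proof -
        have "- (r / d) \<le> (1 / d) * x" using False d by (simp add: field_simps)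
        then show ?thesis unfolding G_def using N by (intro smooth_step_ge_1) simp
      qed
      also have "G (2 * N) x = 0"
      proof -
        have "(1 / d) * x \<le> r / d" using False d by (simp add: field_simps)
        then show ?thesis unfolding G_def using N by (intro smooth_step_le_0) simp
      qed
      finally show ?thesis by (simp add: p_def sum_distrib_left[symmetric])
    qed (simp add: p_def r)
    have pz: "T (fourier (tensor (g(i := p k)))) = 0" for k
    proof (rule insert.IH)
      show "test1 ((g(i := p k)) j)" for j using insert.prems(1) pt by simp
      have "tensor g x \<noteq> 0" if "tensor (g(i := p k)) x \<noteq> 0" for x
        using that tensor_upd[of g i "g i" x] by (auto simp: tensor_upd p_def)
      then show "supp (tensor (g(i := p k))) \<subseteq> K" using supp_mono insert.prems(2) by blast
      fix j assume "j \<notin> S"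
      show "\<exists>a. \<forall>x. (g(i := p k)) j x \<noteq> 0 \<longrightarrow> a \<le> x \<and> x \<le> a + 2 * d"
      proof (cases "j = i")
        case True
        have "d * (real k - real N) \<le> x \<and> x \<le> d * (real k - real N) + 2 * d" if "p k x \<noteq> 0" for x
        proof (rule ccontr)
          assume "\<not> ?thesis"
          then have "x \<le> d * (real k - real N) \<or> d * (real k - real N + 2) \<le> x" by (auto simp: algebra_simps)
          then consider "(1 / d) * x + (real N - real k) \<le> 0" | "2 \<le> (1 / d) * x + (real N - real k)"
          proof
            assume "x \<le> d * (real k - real N)"
            then have "x / d \<le> real k - real N" using d by (simp add: pos_divide_le_eq mult.commute)
            then show ?thesis using that(1) by simp
          next
            assume "d * (real k - real N + 2) \<le> x"
            then have "real k - real N + 2 \<le> x / d" using d by (simp add: pos_le_divide_eq mult.commute)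
            then show ?thesis using that(2) by simp
          qed
          then have "G k x = G (Suc k) x"
            by cases (auto simp: G_def smooth_step_le_0 smooth_step_ge_1)
          with that show False by (simp add: p_def)
        qed
        then show ?thesis using True by auto
      qed (use \<open>j \<notin> S\<close> insert.prems(3) in auto)
    qed
    have "T (fourier (tensor g)) = T (fourier (tensor (g(i := \<lambda>x. \<Sum>k<2*N. p k x))))"
      by (simp add: sum)
    also have "\<dots> = (\<Sum>k<2*N. T (fourier (tensor (g(i := p k)))))"
      by (intro FT_sum[OF T] insert.prems pt) auto
    finally show ?case by (simp add: pz)
  qed
  show ?thesis using main[of UNIV g] g by (simp add: K_def)
qed

text \<open>The factor \<eta> is inserted one coordinate at a time. Each insertion leaves an error
  tensor with the factor \<open>1 - \<eta>\<close> in some coordinate \<open>j\<close>; its support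
  lies in |x_j| >= R' > R, off the ball, so the distribution annihilates it. The product cutoff is
  accordingly 1 on a cube containing the ball.\<close>

lemma FT_bandlimit:
  fixes T :: "(real ^ 'n::finite \<Rightarrow> complex) \<Rightarrow> complex"
  assumes T: "tempered T" and g: "\<And>i. test1 (g i)" and \<eta>: "test1 \<eta>"
    and band: "dist_supp (fourier_dist T) \<subseteq> cball 0 R"
    and one: "\<And>x. \<bar>x\<bar> \<le> R' \<Longrightarrow> \<eta> x = 1" and R: "R < R'"
  shows "T (fourier (tensor (\<lambda>i x. g i x * \<eta> x))) = T (fourier (tensor g))"
proof -
  let ?h = "\<lambda>S i. if i \<in> S then (\<lambda>x. g i x * \<eta> x) else g i"
  have "T (fourier (tensor (?h S))) = T (fourier (tensor g))" if "finite S" for S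
    using that
  proof (induction S rule: finite_induct)
    case (insert j S)
    let ?c = "\<lambda>x. g j x * (1 - \<eta> x)" and ?b = "\<lambda>x. g j x * \<eta> x"
    have t: "test1 (?h S i)" for i using g \<eta> test1_mult test1_smooth1 by auto
    have tc: "test1 ?c" and tb: "test1 ?b"
      by (auto intro!: test1_mult smooth1_diff smooth1_const test1_smooth1[OF \<eta>] g)
    have "T (fourier (tensor ((?h S)(j := ?c)))) = 0"
    proof (rule FT_vanishes_off_dist_supp[OF T])
      show "test1 (((?h S)(j := ?c)) i)" for i using t tc by simp
      have "\<not> \<bar>x $ j\<bar> \<le> R'" if "tensor ((?h S)(j := ?c)) x \<noteq> 0" for x
        using that one[of "x $ j"] by (auto simp: tensor_upd)
      then have "{x. tensor ((?h S)(j := ?c)) x \<noteq> 0} \<subseteq> {x. R' \<le> \<bar>x $ j\<bar>}" by force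
      then have "supp (tensor ((?h S)(j := ?c))) \<subseteq> {x. R' \<le> \<bar>x $ j\<bar>}"
        unfolding supp_def by (rule closure_minimal) (intro closed_Collect_le continuous_intros)
      moreover have "\<bar>x $ j\<bar> \<le> R" if "x \<in> cball 0 R" for x
        using that component_le_norm_cart[of x j] by simp
      ultimately show "supp (tensor ((?h S)(j := ?c))) \<inter> dist_supp (fourier_dist T) = {}"
        using band R by (smt (verit, ccfv_SIG) disjoint_iff mem_Collect_eq subset_iff)
    qed
    moreover have "T (fourier (tensor ((?h S)(j := \<lambda>x. ?b x + ?c x)))) = T (fourier (tensor ((?h S)(j := ?b)))) + T (fourier (tensor ((?h S)(j := ?c))))"
      by (intro FT_add[OF T] t tb tc)
    moreover have "(?h S)(j := \<lambda>x. ?b x + ?c x) = ?h S"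
      using insert by (auto simp: fun_eq_iff algebra_simps)
    moreover have "(?h S)(j := ?b) = ?h (insert j S)" by auto
    ultimately show ?case using insert by simp
  qed simp
  from this[of UNIV] show ?thesis by simp
qed

section \<open>Reproduction of band-limited functions by convolution\<close>

lemma schwartz1_reflect: assumes "schwartz1 f" shows "schwartz1 (\<lambda>x. f (- x))"
  unfolding schwartz1_def
proof (intro conjI allI)
  have s: "smooth1 f" by (rule schwartz1_smooth1[OF assms])
  show "smooth1 (\<lambda>x. f (- x))" using smooth1_affine[OF s, of "-1" 0] by simp
  fix k m
  obtain C where C: "\<And>x. \<bar>x\<bar> ^ k * norm ((D1 ^^ m) f x) \<le> C" using assms unfolding schwartz1_def by blast
  have "\<bar>x\<bar> ^ k * norm ((D1 ^^ m) (\<lambda>x. f (- x)) x) \<le> C" for x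
    using C[of "- x"] funpow_D1_scale[OF s, of m "-1"] by (simp add: norm_mult norm_power)
  then show "\<exists>C. \<forall>x. \<bar>x\<bar> ^ k * norm ((D1 ^^ m) (\<lambda>x. f (- x)) x) \<le> C" by blast
qed

text \<open>Inversion read as a representation: every test function is the transform of a Schwartz
  function.\<close>

lemma F1_F1_reflect: "test1 f \<Longrightarrow> F1 (\<lambda>x. F1 f (- x)) y = f y"
proof -
  assume f: "test1 f"
  have "F1 (\<lambda>x. F1 f (- x)) y = (\<integral>x. echar (- x * y) * F1 f x \<partial>lborel)"
    unfolding F1_def[of "\<lambda>x. F1 f (- x)"]
    by (subst lborel_integral_real_affine[of "-1" _ 0]) auto
  then show ?thesis using F1_inversion[OF f] by simp
qed

text \<open>\<eta> is replaced by its inversion integral; after Fubini the other factor is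
  transformed at the shifted frequency \<open>x - y\<close>.\<close>

lemma F1_mult:
  assumes g: "test1 g" and \<eta>: "test1 \<eta>"
  shows "F1 (\<lambda>x. g x * \<eta> x) x = (\<integral>z. F1 \<eta> (x - z) * F1 g z \<partial>lborel)"
proof -
  have Ig: "integrable lborel g" and I\<eta>: "integrable lborel (F1 \<eta>)"
    by (rule test1_integrable[OF g], rule schwartz1_integrable[OF F1_schwartz1[OF \<eta>]])
  note [measurable] = borel_measurable_integrable[OF Ig] borel_measurable_integrable[OF I\<eta>]
  have I2: "integrable (lborel \<Otimes>\<^sub>M lborel) (\<lambda>(t, y). (g t * F1 \<eta> y) * (echar (t * x) * echar (- y * t)))"
    by (rule Bochner_Integration.integrable_bound[OF integrable_pair_mult[OF Ig I\<eta>]])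
      (auto simp: norm_mult)
  have "F1 (\<lambda>x. g x * \<eta> x) x = (\<integral>t. (\<integral>y. (g t * F1 \<eta> y) * (echar (t * x) * echar (- y * t)) \<partial>lborel) \<partial>lborel)"
    unfolding F1_def[of "\<lambda>x. g x * \<eta> x"]
  proof (intro Bochner_Integration.integral_cong refl)
    fix t
    have "echar (t * x) * (g t * \<eta> t) = (echar (t * x) * g t) * (\<integral>y. echar (- y * t) * F1 \<eta> y \<partial>lborel)"
      using F1_inversion[OF \<eta>, of t] by simp
    also have "\<dots> = (\<integral>y. (g t * F1 \<eta> y) * (echar (t * x) * echar (- y * t)) \<partial>lborel)"
      by (subst integral_mult_right_zero[symmetric]) (simp add: mult_ac)
    finally show "echar (t * x) * (g t * \<eta> t) = (\<integral>y. (g t * F1 \<eta> y) * (echar (t * x) * echar (- y * t)) \<partial>lborel)" .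
  qed
  also have "\<dots> = (\<integral>y. (\<integral>t. (g t * F1 \<eta> y) * (echar (t * x) * echar (- y * t)) \<partial>lborel) \<partial>lborel)"
    using lborel_pair.Fubini_integral[OF I2] by simp
  also have "\<dots> = (\<integral>y. F1 \<eta> y * F1 g (x - y) \<partial>lborel)"
  proof (intro Bochner_Integration.integral_cong refl)
    fix y
    have e: "echar (t * x) * echar (- y * t) = echar (t * (x - y))" for t
      by (simp add: algebra_simps flip: echar_add)
    show "(\<integral>t. (g t * F1 \<eta> y) * (echar (t * x) * echar (- y * t)) \<partial>lborel) = F1 \<eta> y * F1 g (x - y)"
      unfolding e F1_def[of g] by (subst integral_mult_right_zero[symmetric]) (simp add: mult_ac)
  qed
  also have "\<dots> = (\<integral>z. F1 \<eta> (x - z) * F1 g z \<partial>lborel)"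
    by (subst lborel_integral_real_affine[of "-1" _ x]) auto
  finally show ?thesis .
qed

lemma schwartz1_mult_integrable:
  assumes "schwartz1 f" "schwartz1 g" shows "integrable lborel (\<lambda>t. f (x - t) * g t)"
proof -
  obtain C where C: "\<And>x. norm (f x) \<le> C" using schwartz1_weighted[OF assms(1), where k=0 and m=0] by auto
  have [measurable]: "f \<in> borel_measurable borel" by (intro smooth1_measurable schwartz1_smooth1 assms)
  have g: "integrable lborel g" by (intro schwartz1_integrable assms)
  note [measurable] = borel_measurable_integrable[OF g]
  show ?thesis
    by (rule Bochner_Integration.integrable_bound[OF integrable_mult_right[OF g, of "complex_of_real C"]])
      (auto simp: norm_mult intro!: mult_right_mono order_trans[OF C] abs_ge_self)
qed

lemma tensor_F1_mult:
  fixes g :: "'n::finite \<Rightarrow> real \<Rightarrow> complex"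
  assumes g: "\<And>i. test1 (g i)" and \<eta>: "test1 \<eta>"
  shows "tensor (\<lambda>i. F1 (\<lambda>x. g i x * \<eta> x)) x = (\<integral>z. tensor (\<lambda>i. F1 \<eta>) (x - z) * tensor (\<lambda>i. F1 (g i)) z \<partial>lborel)"
proof -
  have "(\<integral>z. tensor (\<lambda>i. F1 \<eta>) (x - z) * tensor (\<lambda>i. F1 (g i)) z \<partial>lborel) =
    (\<integral>z. (\<Prod>i\<in>UNIV. F1 \<eta> (x $ i - z $ i) * F1 (g i) (z $ i)) \<partial>(lborel :: (real ^ 'n) measure))"
    by (simp add: tensor_def prod.distrib)
  also have "\<dots> = (\<Prod>i\<in>UNIV. \<integral>t. F1 \<eta> (x $ i - t) * F1 (g i) t \<partial>lborel)"
    by (rule integral_prod_vec) (intro schwartz1_mult_integrable F1_schwartz1 g \<eta>)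
  finally show ?thesis by (simp add: tensor_def F1_mult[OF g \<eta>])
qed

section \<open>Transposed convolution\<close>

lemma tensor_translate_integrable:
  fixes z :: "real ^ 'n::finite"
  assumes "schwartz1 k"
  shows "integrable lborel (\<lambda>x. tensor (\<lambda>i::'n. k) (x - z))"
proof -
  have "integrable lborel (\<lambda>x. \<Prod>i\<in>UNIV. k (x $ i - z $ i))"
  proof (rule integrable_prod_vec)
    fix i show "integrable lborel (\<lambda>t. k (t - z $ i))"
      using lborel_integrable_real_affine[OF schwartz1_integrable[OF assms], of 1 "- z $ i"] by simp
  qed
  then show ?thesis by (simp add: tensor_def)
qed

text \<open>This is the transpose of convolution with the tensor kernel, hence the argument
  \<open>x - z\<close> with integration in \<open>x\<close>: in terms of \<open>z\<close> it is
  convolution with the reflected kernel. \<open>conv_fubini\<close> uses it to move a convolution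
  from the test function to \<open>f\<close>.\<close>

definition conv_kernel :: "(real ^ 'n \<Rightarrow> complex) \<Rightarrow> (real \<Rightarrow> complex) \<Rightarrow> real ^ 'n::finite \<Rightarrow> complex" where
  "conv_kernel f k z = (\<integral>x. f x * tensor (\<lambda>i. k) (x - z) \<partial>lborel)"

text \<open>The uniform bound \<open>M\<close> serves twice: it gives the absolute convergence that
  Fubini needs, and it is the supremum bound for the convolution.\<close>

context
  fixes f :: "real ^ 'n::finite \<Rightarrow> complex" and k :: "real \<Rightarrow> complex" and M :: real
  assumes f: "L1_plus_Linf f" and k: "schwartz1 k"
    and M: "\<And>z. (\<integral>\<^sup>+x. ennreal (norm (f x * tensor (\<lambda>i. k) (x - z))) \<partial>lborel) \<le> ennreal M" and M0: "0 \<le> M"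
begin

lemma conv_meas [measurable]:
  "f \<in> borel_measurable borel" "tensor (\<lambda>i::'n. k) \<in> borel_measurable borel"
  by (rule L1_plus_Linf_measurable[OF f], intro tensor_measurable smooth1_measurable schwartz1_smooth1 k)

lemma conv_integrable: "integrable lborel (\<lambda>x. f x * tensor (\<lambda>i. k) (x - z))"
  by (rule integrableI_bounded) (auto intro: le_less_trans[OF M])

lemma conv_norm_int: "(\<integral>x. norm (f x * tensor (\<lambda>i. k) (x - z)) \<partial>lborel) \<le> M"
  using M[of z] M0 nn_integral_eq_integral[OF integrable_norm[OF conv_integrable[of z]]] by simp

lemma conv_kernel_bound: "norm (conv_kernel f k z) \<le> M"
  unfolding conv_kernel_def by (rule order_trans[OF integral_norm_bound conv_norm_int])

lemma conv_kernel_measurable [measurable]: "conv_kernel f k \<in> borel_measurable borel"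
  unfolding conv_kernel_def[abs_def] by measurable

lemma conv_fubini:
  assumes \<Phi>: "integrable lborel \<Phi>"
  shows "(\<integral>x. f x * (\<integral>z. tensor (\<lambda>i. k) (x - z) * \<Phi> z \<partial>lborel) \<partial>lborel) = (\<integral>z. conv_kernel f k z * \<Phi> z \<partial>lborel)"
proof -
  have [measurable]: "\<Phi> \<in> borel_measurable borel" using borel_measurable_integrable[OF \<Phi>] by simp
  have I2: "integrable (lborel \<Otimes>\<^sub>M lborel) (\<lambda>(z, x). (f x * tensor (\<lambda>i. k) (x - z)) * \<Phi> z)"
  proof (rule lborel_pair.Fubini_integrable)
    show "(\<lambda>(z, x). (f x * tensor (\<lambda>i. k) (x - z)) * \<Phi> z) \<in> borel_measurable (lborel \<Otimes>\<^sub>M lborel)"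
      by measurable
    show "AE z in lborel. integrable lborel (\<lambda>x. case (z, x) of (z, x) \<Rightarrow> (f x * tensor (\<lambda>i. k) (x - z)) * \<Phi> z)"
      using conv_integrable by (intro AE_I2) simp
    show "integrable lborel (\<lambda>z. \<integral>x. norm (case (z, x) of (z, x) \<Rightarrow> (f x * tensor (\<lambda>i. k) (x - z)) * \<Phi> z) \<partial>lborel)"
    proof (rule Bochner_Integration.integrable_bound)
      show "integrable lborel (\<lambda>z. M * norm (\<Phi> z))" using \<Phi> by auto
      show "AE z in lborel. norm (\<integral>x. norm (case (z, x) of (z, x) \<Rightarrow> (f x * tensor (\<lambda>i. k) (x - z)) * \<Phi> z) \<partial>lborel) \<le> norm (M * norm (\<Phi> z))"
      proof (rule AE_I2)
        fix z
        have "(\<integral>x. norm (f x * tensor (\<lambda>i. k) (x - z) * \<Phi> z) \<partial>lborel) = (\<integral>x. norm (f x * tensor (\<lambda>i. k) (x - z)) \<partial>lborel) * norm (\<Phi> z)"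
          by (subst integral_mult_left_zero[symmetric]) (simp add: norm_mult)
        also have "\<dots> \<le> M * norm (\<Phi> z)" by (intro mult_right_mono conv_norm_int) auto
        finally show "norm (\<integral>x. norm (case (z, x) of (z, x) \<Rightarrow> (f x * tensor (\<lambda>i. k) (x - z)) * \<Phi> z) \<partial>lborel) \<le> norm (M * norm (\<Phi> z))"
          using M0 by (simp add: integral_nonneg abs_mult)
      qed
    qed measurable
  qed
  have "(\<integral>x. f x * (\<integral>z. tensor (\<lambda>i. k) (x - z) * \<Phi> z \<partial>lborel) \<partial>lborel) = (\<integral>x. (\<integral>z. (f x * tensor (\<lambda>i. k) (x - z)) * \<Phi> z \<partial>lborel) \<partial>lborel)"
    by (simp add: mult.assoc)
  also have "\<dots> = (\<integral>z. (\<integral>x. (f x * tensor (\<lambda>i. k) (x - z)) * \<Phi> z \<partial>lborel) \<partial>lborel)"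
    using lborel_pair.Fubini_integral[OF I2] by simp
  finally show ?thesis by (simp add: conv_kernel_def)
qed

end

section \<open>Approximation of test tensors by Fourier transforms\<close>

lemma tensor_inverse_square_integrable:
  fixes C :: "'n::finite \<Rightarrow> real"
  shows "integrable lborel (\<lambda>x::real^'n. \<Prod>i\<in>UNIV. C i / (1 + (x $ i)\<^sup>2))"
proof (rule integrable_prod_vec)
  fix i show "integrable lborel (\<lambda>t. C i / (1 + t\<^sup>2))"
    using integrable_mult_right[OF integrable_1_div_1_plus_square, of "C i"] by simp
qed

lemma L1_plus_Linf_bounded: "f \<in> borel_measurable borel \<Longrightarrow> (\<And>x. norm (f x) \<le> M) \<Longrightarrow> L1_plus_Linf f"
  unfolding L1_plus_Linf_def
proof (intro conjI exI[of _ M])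
  assume "\<And>x. norm (f x) \<le> M"
  then have "{x. M < norm (f x)} = {}" by (auto simp: not_less)
  then show "(\<integral>\<^sup>+x. ennreal (norm (f x)) * indicator {x. M < norm (f x)} x \<partial>lborel) < \<infinity>" by simp
  show "0 \<le> M" using \<open>\<And>x. norm (f x) \<le> M\<close> norm_ge_zero order_trans by blast
qed

text \<open>The majorant must not depend on \<open>j\<close>. By \<open>norm_F1_decay\<close> it is
  enough to bound the cut-off functions and their second derivatives by a multiple of (1 + |x|)^(-2)
  uniformly in \<open>j\<close>, and \<open>cutoff_dil_mult_bound\<close> keeps them close to
  \<open>p\<close> and its second derivative in that weight.\<close>

lemma cutoff_dil_F1_decay:
  assumes p: "schwartz1 p"
  shows "\<exists>C\<ge>0. \<forall>j x. norm (F1 (\<lambda>x. cutoff_dil j x * p x) x) \<le> C / (1 + x\<^sup>2)"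
proof -
  have t: "test1 (\<lambda>x. cutoff_dil j x * p x)" for j by (intro test1_mult test1_cutoff_dil schwartz1_smooth1 p)
  have "\<exists>C\<ge>0. \<forall>j x. (1 + \<bar>x\<bar>) ^ 2 * norm ((D1 ^^ m) (\<lambda>x. cutoff_dil j x * p x) x) \<le> C" for m
  proof -
    have "\<exists>C\<ge>0. \<forall>j x. (1 + \<bar>x\<bar>) ^ 2 * norm ((D1 ^^ m) (\<lambda>x. cutoff_dil j x * p x) x - (D1 ^^ m) p x) \<le> C * (1 / (real j + 1))"
      using cutoff_dil_mult_bound[OF p] by (intro weight_bound) auto
    then obtain A where A: "0 \<le> A" "\<And>j x. (1 + \<bar>x\<bar>) ^ 2 * norm ((D1 ^^ m) (\<lambda>x. cutoff_dil j x * p x) x - (D1 ^^ m) p x) \<le> A * (1 / (real j + 1))" by blast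
    obtain B where B: "0 \<le> B" "\<And>x. (1 + \<bar>x\<bar>) ^ 2 * norm ((D1 ^^ m) p x) \<le> B"
      using schwartz1_weighted[OF p] by blast
    have "(1 + \<bar>x\<bar>) ^ 2 * norm ((D1 ^^ m) (\<lambda>x. cutoff_dil j x * p x) x) \<le> A + B" for j x
    proof -
      have "(1 + \<bar>x\<bar>) ^ 2 * norm ((D1 ^^ m) (\<lambda>x. cutoff_dil j x * p x) x) \<le>
        (1 + \<bar>x\<bar>) ^ 2 * (norm ((D1 ^^ m) p x) + norm ((D1 ^^ m) (\<lambda>x. cutoff_dil j x * p x) x - (D1 ^^ m) p x))"
        by (intro mult_left_mono norm_triangle_sub) auto
      also have "\<dots> \<le> B + A * (1 / (real j + 1))" using A(2)[of x j] B(2)[of x] by (simp add: distrib_left)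
      also have "A * (1 / (real j + 1)) \<le> A" using A(1) by (simp add: field_simps)
      finally show ?thesis by simp
    qed
    then show ?thesis using A(1) B(1) by (intro exI[of _ "A + B"]) auto
  qed
  from this[of 0] this[of 2] obtain A B where A: "0 \<le> A" "\<And>j x. (1 + \<bar>x\<bar>) ^ 2 * norm (cutoff_dil j x * p x) \<le> A"
    and B: "0 \<le> B" "\<And>j x. (1 + \<bar>x\<bar>) ^ 2 * norm (D1 (D1 (\<lambda>x. cutoff_dil j x * p x)) x) \<le> B"
    by (auto simp: numeral_2_eq_2)
  define C where "C = (\<integral>x. (A + B) * (1 / (1 + x\<^sup>2)) \<partial>(lborel :: real measure))"
  have "norm (F1 (\<lambda>x. cutoff_dil j x * p x) x) \<le> C / (1 + x\<^sup>2)" for j x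
  proof -
    have "norm (F1 (\<lambda>x. cutoff_dil j x * p x) x) \<le>
      (\<integral>x. norm (cutoff_dil j x * p x) + norm (D1 (D1 (\<lambda>x. cutoff_dil j x * p x)) x) \<partial>lborel) / (1 + x\<^sup>2)"
      by (rule norm_F1_decay[OF t])
    also have "\<dots> \<le> C / (1 + x\<^sup>2)"
      unfolding C_def
    proof (intro divide_right_mono integral_mono)
      show "integrable lborel (\<lambda>x. norm (cutoff_dil j x * p x) + norm (D1 (D1 (\<lambda>x. cutoff_dil j x * p x)) x))"
        by (intro Bochner_Integration.integrable_add integrable_norm test1_integrable[OF t] test1_integrable[OF test1_D1[OF test1_D1[OF t]]])
      show "integrable lborel (\<lambda>x::real. (A + B) * (1 / (1 + x\<^sup>2)))"
        by (intro integrable_mult_right integrable_1_div_1_plus_square)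
      fix x :: real
      have w: "1 + x\<^sup>2 \<le> (1 + \<bar>x\<bar>) ^ 2" by (simp add: power2_eq_square algebra_simps)
      have "(1 + x\<^sup>2) * (norm (cutoff_dil j x * p x) + norm (D1 (D1 (\<lambda>x. cutoff_dil j x * p x)) x)) \<le>
        (1 + \<bar>x\<bar>) ^ 2 * (norm (cutoff_dil j x * p x) + norm (D1 (D1 (\<lambda>x. cutoff_dil j x * p x)) x))"
        by (intro mult_right_mono w) auto
      also have "\<dots> \<le> A + B" using A(2)[of x j] B(2)[of x j] by (simp add: distrib_left)
      finally show "norm (cutoff_dil j x * p x) + norm (D1 (D1 (\<lambda>x. cutoff_dil j x * p x)) x) \<le> (A + B) * (1 / (1 + x\<^sup>2))"
        by (simp add: field_simps add_pos_nonneg)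
    qed auto
    finally show ?thesis .
  qed
  moreover have "0 \<le> C" unfolding C_def using A(1) B(1) by (intro Bochner_Integration.integral_nonneg) auto
  ultimately show ?thesis by blast
qed

lemma cutoff_dil_F1_tendsto:
  assumes p: "schwartz1 p" shows "(\<lambda>j. F1 (\<lambda>x. cutoff_dil j x * p x) x) \<longlonglongrightarrow> F1 p x"
proof -
  have [measurable]: "p \<in> borel_measurable borel" by (intro smooth1_measurable schwartz1_smooth1 p)
  have [measurable]: "cutoff_dil j \<in> borel_measurable borel" for j by (intro smooth1_measurable test1_smooth1 test1_cutoff_dil)
  show ?thesis
    unfolding F1_def
  proof (rule integral_dominated_convergence[where w = "\<lambda>x. norm (p x)"])
    show "integrable lborel (\<lambda>x. norm (p x))" by (intro integrable_norm schwartz1_integrable p)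
    show "AE t in lborel. (\<lambda>j. echar (t * x) * (cutoff_dil j t * p t)) \<longlonglongrightarrow> echar (t * x) * p t"
    proof (rule AE_I2)
      fix t
      have "(\<lambda>j. echar (t * x) * (cutoff_dil j t * p t)) \<longlonglongrightarrow> echar (t * x) * (1 * p t)"
        by (intro tendsto_intros cutoff_dil_tendsto)
      then show "(\<lambda>j. echar (t * x) * (cutoff_dil j t * p t)) \<longlonglongrightarrow> echar (t * x) * p t" by simp
    qed
    show "AE t in lborel. norm (echar (t * x) * (cutoff_dil j t * p t)) \<le> norm (p t)" for j
      by (intro AE_I2) (auto simp: norm_mult intro!: mult_left_le_one_le cutoff_dil_norm_le)
  qed measurable
qed

text \<open>Identities for \<open>f\<close> will be available against transforms of compactly
  supported functions only, whereas a test tensor is the transform of a tensor that is merely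
  Schwartz. Cutting off before transforming gives admissible tensors converging to
  \<open>tensor \<psi>\<close>.\<close>

lemma integral_tensor_limit:
  fixes \<psi> :: "'n::finite \<Rightarrow> real \<Rightarrow> complex"
  assumes \<psi>: "\<And>i. test1 (\<psi> i)" and f: "L1_plus_Linf f"
  shows "(\<lambda>j. \<integral>x. f x * tensor (\<lambda>i. F1 (\<lambda>x. cutoff_dil j x * F1 (\<psi> i) (- x))) x \<partial>lborel) \<longlonglongrightarrow> (\<integral>x. f x * tensor \<psi> x \<partial>lborel)"
proof -
  let ?p = "\<lambda>i x. F1 (\<psi> i) (- x)"
  have p: "schwartz1 (?p i)" for i by (intro schwartz1_reflect F1_schwartz1 \<psi>)
  note [measurable] = L1_plus_Linf_measurable[OF f]
  have [measurable]: "tensor \<psi> \<in> borel_measurable borel"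
    by (intro tensor_measurable smooth1_measurable test1_smooth1 \<psi>)
  have [measurable]: "tensor (\<lambda>i. F1 (\<lambda>x. cutoff_dil j x * ?p i x)) \<in> borel_measurable borel" for j
    by (intro tensor_measurable smooth1_measurable F1_smooth1 test1_mult test1_cutoff_dil schwartz1_smooth1 p)
  have "\<forall>i. \<exists>C\<ge>0. \<forall>j x. norm (F1 (\<lambda>x. cutoff_dil j x * ?p i x) x) \<le> C / (1 + x\<^sup>2)"
    using cutoff_dil_F1_decay[OF p] by blast
  then obtain C where C: "\<And>i. 0 \<le> C i" "\<And>i j x. norm (F1 (\<lambda>x. cutoff_dil j x * ?p i x) x) \<le> C i / (1 + x\<^sup>2)" by metis
  \<comment> \<open>\<open>W\<close> is both integrable and bounded, so its product with a function
    in L^1 + L^infinity is integrable and can dominate.\<close>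
  define W where "W x = complex_of_real (\<Prod>i\<in>UNIV. C i / (1 + (x $ i)\<^sup>2))" for x :: "real ^ 'n"
  have W: "integrable lborel W" unfolding W_def[abs_def] by (intro integrable_of_real tensor_inverse_square_integrable)
  note [measurable] = borel_measurable_integrable[OF W]
  have nW: "norm (W x) = (\<Prod>i\<in>UNIV. C i / (1 + (x $ i)\<^sup>2))" for x
    unfolding W_def norm_of_real using C(1) by (intro abs_of_nonneg prod_nonneg) auto
  have WB: "norm (W x) \<le> (\<Prod>i\<in>UNIV. C i)" for x
    unfolding nW
  proof (intro prod_mono conjI)
    fix i
    have "C i / (1 + (x $ i)\<^sup>2) \<le> C i / 1" using C(1) by (intro divide_left_mono) (auto simp: add_pos_nonneg)
    then show "C i / (1 + (x $ i)\<^sup>2) \<le> C i" by simp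
  qed (use C(1) in auto)
  show ?thesis
  proof (rule integral_dominated_convergence[where w = "\<lambda>x. norm (f x * W x)"])
    show "integrable lborel (\<lambda>x. norm (f x * W x))"
      by (intro integrable_norm L1_plus_Linf_mult_integrable[OF f W WB])
    show "AE x in lborel. (\<lambda>j. f x * tensor (\<lambda>i. F1 (\<lambda>x. cutoff_dil j x * ?p i x)) x) \<longlonglongrightarrow> f x * tensor \<psi> x"
    proof (intro AE_I2 tendsto_mult tendsto_const)
      fix x :: "real ^ 'n"
      have "(\<lambda>j. \<Prod>i\<in>UNIV. F1 (\<lambda>x. cutoff_dil j x * ?p i x) (x $ i)) \<longlonglongrightarrow> (\<Prod>i\<in>UNIV. F1 (?p i) (x $ i))"
        by (intro tendsto_prod cutoff_dil_F1_tendsto p)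
      then show "(\<lambda>j. tensor (\<lambda>i. F1 (\<lambda>x. cutoff_dil j x * ?p i x)) x) \<longlonglongrightarrow> tensor \<psi> x"
        by (simp add: tensor_def F1_F1_reflect[OF \<psi>])
    qed
    show "AE x in lborel. norm (f x * tensor (\<lambda>i. F1 (\<lambda>x. cutoff_dil j x * ?p i x)) x) \<le> norm (f x * W x)" for j
    proof (rule AE_I2)
      fix x :: "real ^ 'n"
      have "norm (tensor (\<lambda>i. F1 (\<lambda>x. cutoff_dil j x * ?p i x)) x) \<le> norm (W x)"
        unfolding nW tensor_def prod_norm[symmetric] by (intro prod_mono conjI C) auto
      then show "norm (f x * tensor (\<lambda>i. F1 (\<lambda>x. cutoff_dil j x * ?p i x)) x) \<le> norm (f x * W x)"
        by (simp add: norm_mult mult_left_mono)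
    qed
  qed measurable
qed

section \<open>Recovering a function from its integrals over boxes\<close>

definition box_approx :: "real \<Rightarrow> real \<Rightarrow> nat \<Rightarrow> real \<Rightarrow> complex" where
  "box_approx a b j x = smooth_step ((real j + 1) * x + (real j + 1) * (- a)) * smooth_step (- (real j + 1) * x + (real j + 1) * b)"

lemma box_approx_outside: "\<not> (a < x \<and> x < b) \<Longrightarrow> box_approx a b j x = 0"
proof -
  assume "\<not> (a < x \<and> x < b)"
  then consider "x \<le> a" | "b \<le> x" by linarith
  then show ?thesis
  proof cases
    case 1
    then have "(real j + 1) * x \<le> (real j + 1) * a" by (intro mult_left_mono) auto
    then show ?thesis by (simp add: box_approx_def smooth_step_le_0)
  next
    case 2
    then have "(real j + 1) * b \<le> (real j + 1) * x" by (intro mult_left_mono) auto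
    then have "- (real j + 1) * x + (real j + 1) * b \<le> 0" by (simp add: algebra_simps)
    then show ?thesis unfolding box_approx_def by (simp only: smooth_step_le_0 mult_zero_right)
  qed
qed

lemma test1_box_approx: "test1 (box_approx a b j)"
  unfolding test1_def
proof
  show "smooth1 (box_approx a b j)"
    unfolding box_approx_def[abs_def] by (intro smooth1_mult smooth1_affine smooth1_smooth_step)
  show "\<exists>r. \<forall>x. r < \<bar>x\<bar> \<longrightarrow> box_approx a b j x = 0"
    by (rule exI[of _ "max \<bar>a\<bar> \<bar>b\<bar>"]) (auto intro!: box_approx_outside)
qed

lemma box_approx_norm_le: "norm (box_approx a b j x) \<le> indicator {a<..<b} x"
proof (cases "a < x \<and> x < b")
  case True
  then show ?thesis
    using mult_mono[OF smooth_step_norm_le smooth_step_norm_le] by (auto simp: box_approx_def norm_mult)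
qed (simp add: box_approx_outside)

lemma box_approx_tendsto: "(\<lambda>j. box_approx a b j x) \<longlonglongrightarrow> indicator {a<..<b} x"
proof (cases "a < x \<and> x < b")
  case True
  obtain N :: nat where N: "1 / (x - a) \<le> real N" "1 / (b - x) \<le> real N"
    using real_arch_simple[of "max (1 / (x - a)) (1 / (b - x))"] by auto
  have "box_approx a b j x = 1" if "j \<ge> N" for j
  proof -
    have "1 / (x - a) \<le> real j + 1" "1 / (b - x) \<le> real j + 1" using N that by linarith+
    then have "1 \<le> (real j + 1) * (x - a)" "1 \<le> (real j + 1) * (b - x)"
      using True by (auto simp: pos_divide_le_eq)
    then show ?thesis by (simp add: box_approx_def smooth_step_ge_1 algebra_simps)
  qed
  then show ?thesis using True by (intro tendsto_eventually eventually_sequentiallyI[of N]) auto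
qed (simp add: box_approx_outside)

lemma indicator_box_prod:
  "indicator (box l u) x = (\<Prod>i\<in>UNIV. indicator {l $ i<..<u $ i} (x $ i) :: 'b::{comm_semiring_1})"
  for l u x :: "real ^ 'n::finite"
proof (cases "x \<in> box l u")
  case True
  then show ?thesis by (auto simp: mem_box_cart)
next
  case False
  then obtain i where "\<not> (l $ i < x $ i \<and> x $ i < u $ i)" by (auto simp: mem_box_cart)
  then have "(\<Prod>i\<in>UNIV. indicator {l $ i<..<u $ i} (x $ i) :: 'b) = 0"
    by (intro prod_zero) (auto intro!: exI[of _ i])
  with False show ?thesis by simp
qed

lemma box_integrable:
  assumes f: "L1_plus_Linf (f :: 'a::euclidean_space \<Rightarrow> complex)" shows "integrable lborel (\<lambda>x. f x * indicator (box l u) x)"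
proof (rule L1_plus_Linf_mult_integrable[OF f])
  show "integrable lborel (indicator (box l u) :: 'a \<Rightarrow> complex)"
    by (rule integrable_real_indicator[THEN integrable_of_real[where 'a=complex], simplified of_real_indicator]) (auto simp: emeasure_lborel_box_eq)
  show "norm (indicator (box l u) x :: complex) \<le> 1" for x by (simp add: indicator_def)
qed

lemma integral_box_limit:
  fixes l u :: "real ^ 'n::finite"
  assumes f: "L1_plus_Linf f"
  shows "(\<lambda>j. \<integral>x. f x * tensor (\<lambda>i. box_approx (l $ i) (u $ i) j) x \<partial>lborel) \<longlonglongrightarrow> (\<integral>x. f x * indicator (box l u) x \<partial>lborel)"
proof -
  note [measurable] = L1_plus_Linf_measurable[OF f]
  have [measurable]: "tensor (\<lambda>i. box_approx (l $ i) (u $ i) j) \<in> borel_measurable borel" for j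
    by (intro tensor_measurable smooth1_measurable test1_smooth1 test1_box_approx)
  show ?thesis
  proof (rule integral_dominated_convergence[where w = "\<lambda>x. norm (f x * indicator (box l u) x)"])
    show "integrable lborel (\<lambda>x. norm (f x * indicator (box l u) x))" by (intro integrable_norm box_integrable f)
    show "AE x in lborel. (\<lambda>j. f x * tensor (\<lambda>i. box_approx (l $ i) (u $ i) j) x) \<longlonglongrightarrow> f x * indicator (box l u) x"
      unfolding tensor_def indicator_box_prod by (intro AE_I2 tendsto_intros box_approx_tendsto)
    show "AE x in lborel. norm (f x * tensor (\<lambda>i. box_approx (l $ i) (u $ i) j) x) \<le> norm (f x * indicator (box l u) x)" for j
    proof (rule AE_I2)
      fix x :: "real ^ 'n"
      have "norm (tensor (\<lambda>i. box_approx (l $ i) (u $ i) j) x) \<le> (\<Prod>i\<in>UNIV. indicator {l $ i<..<u $ i} (x $ i))"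
        unfolding tensor_def prod_norm[symmetric] by (intro prod_mono conjI box_approx_norm_le) auto
      also have "\<dots> = norm (indicator (box l u) x :: complex)"
        unfolding indicator_box_prod[symmetric] by (simp add: indicator_def)
      finally show "norm (f x * tensor (\<lambda>i. box_approx (l $ i) (u $ i) j) x) \<le> norm (f x * indicator (box l u) x)"
        by (simp add: norm_mult mult_left_mono)
    qed
  qed measurable
qed

text \<open>Boxes are stable under intersection and generate the Borel sets. Inside one fixed box
  \<open>h\<close> is integrable, which makes complements and disjoint unions tractable; countably
  many boxes then exhaust the space.\<close>

lemma AE_zero_if_box_integrals_zero:
  fixes h :: "'a::euclidean_space \<Rightarrow> complex"
  assumes int: "\<And>l u. integrable lborel (\<lambda>x. h x * indicator (box l u) x)"
    and zero: "\<And>l u. (\<integral>x. h x * indicator (box l u) x \<partial>lborel) = 0"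
  shows "AE x in lborel. h x = 0"
proof -
  have "AE x in lborel. h x * indicator (box l u) x = 0" for l u
  proof (rule sigma_finite_measure.density_zero[OF sigma_finite_lborel int[of l u]])
    fix A :: "'a set" assume A: "A \<in> sets lborel"
    let ?h = "\<lambda>x. h x * indicator (box l u) x"
    have si: "set_integrable lborel B ?h" if "B \<in> sets borel" for B
      unfolding set_integrable_def by (rule integrable_mult_indicator[OF _ int]) (use that in simp)
    let ?G = "range (\<lambda>(a, b). box a b) :: 'a set set"
    have "Int_stable ?G" "?G \<subseteq> Pow UNIV" by (auto simp: Int_stable_def box_Int_box)
    moreover have "A \<in> sigma_sets UNIV ?G"
      using A by (simp add: borel_eq_box sets_measure_of)
    ultimately show "set_lebesgue_integral lborel A ?h = 0"
    proof (induction rule: sigma_sets_induct_disjoint)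
      case (basic A)
      then obtain a b where ab: "A = box a b" by auto
      obtain c d where cd: "box a b \<inter> box l u = box c d" using box_Int_box by blast
      have "set_lebesgue_integral lborel A ?h = (\<integral>x. h x * indicator (box c d) x \<partial>lborel)"
        unfolding set_lebesgue_integral_def ab cd[symmetric]
        by (intro Bochner_Integration.integral_cong) (auto simp: indicator_def)
      then show ?case using zero by simp
    next
      case empty
      then show ?case by (simp add: set_lebesgue_integral_def)
    next
      case (compl A)
      then have A: "A \<in> sets borel" by (simp add: borel_eq_box sets_measure_of)
      have "set_lebesgue_integral lborel UNIV ?h = set_lebesgue_integral lborel A ?h + set_lebesgue_integral lborel (UNIV - A) ?h"
        using A si by (subst set_integral_Un[symmetric]) auto
      moreover have "set_lebesgue_integral lborel UNIV ?h = 0"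
        using zero by (simp add: set_lebesgue_integral_def)
      ultimately show ?case using compl by simp
    next
      case (union A)
      then have A: "A i \<in> sets borel" for i by (auto simp: borel_eq_box sets_measure_of)
      have "set_lebesgue_integral lborel (\<Union>i. A i) ?h = (\<Sum>i. set_lebesgue_integral lborel (A i) ?h)"
        using A union by (intro lebesgue_integral_countable_add si) (auto simp: disjoint_family_on_def)
      then show ?case using union by simp
    qed
  qed
  then have "AE x in lborel. \<forall>n::nat. h x * indicator (box (- (real n *\<^sub>R One)) (real n *\<^sub>R One)) x = 0"
    unfolding AE_all_countable by blast
  then show ?thesis
  proof (rule AE_mp, intro AE_I2 impI)
    fix x assume "\<forall>n::nat. h x * indicator (box (- (real n *\<^sub>R One)) (real n *\<^sub>R One)) x = 0"
    moreover have "x \<in> (\<Union>n::nat. box (- (real n *\<^sub>R One)) (real n *\<^sub>R One))" using UN_box_eq_UNIV by auto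
    ultimately show "h x = 0" by (auto simp: indicator_def split: if_splits)
  qed
qed

text \<open>\<open>f\<close> and its convolution \<open>u\<close> have the same integrals against
  transforms of test tensors (\<open>F\<close>), then against test tensors (\<open>G\<close>), then
  against indicators of boxes (\<open>B\<close>). So they agree almost everywhere, and the bound on
  \<open>u\<close> passes to \<open>f\<close>.\<close>

lemma bandlimited_AE_bound:
  fixes f :: "real ^ 'n::finite \<Rightarrow> complex"
  assumes T: "tempered T" and f: "L1_plus_Linf f"
    and rep: "\<And>\<phi>. \<phi> \<in> test_functions \<Longrightarrow> \<phi> \<in> borel_measurable borel \<Longrightarrow> T \<phi> = (\<integral>x. f x * \<phi> x \<partial>lborel)"
    and band: "dist_supp (fourier_dist T) \<subseteq> cball 0 R"
    and \<eta>: "test1 \<eta>" "\<And>x. \<bar>x\<bar> \<le> R' \<Longrightarrow> \<eta> x = 1" "R < R'"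
    and M: "\<And>z. (\<integral>\<^sup>+x. ennreal (norm (f x * tensor (\<lambda>i. F1 \<eta>) (x - z))) \<partial>lborel) \<le> ennreal M" "0 \<le> M"
  shows "AE x in lborel. norm (f x) \<le> M"
proof -
  let ?k = "F1 \<eta>"
  have k: "schwartz1 ?k" by (rule F1_schwartz1[OF \<eta>(1)])
  define u where "u = conv_kernel f ?k"
  have ub: "norm (u z) \<le> M" for z unfolding u_def by (rule conv_kernel_bound[OF f k M])
  have um [measurable]: "u \<in> borel_measurable borel" unfolding u_def by (rule conv_kernel_measurable[OF f k M])
  have u: "L1_plus_Linf u" by (rule L1_plus_Linf_bounded[OF um ub])
  have F: "(\<integral>x. f x * tensor (\<lambda>i. F1 (g i)) x \<partial>lborel) = (\<integral>x. u x * tensor (\<lambda>i. F1 (g i)) x \<partial>lborel)"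
    if g: "\<And>i. test1 (g i)" for g
  proof -
    have t: "test1 (\<lambda>x. g i x * \<eta> x)" for i by (intro test1_mult g test1_smooth1 \<eta>(1))
    have S: "T (fourier (tensor h)) = (\<integral>x. f x * tensor (\<lambda>i. F1 (h i)) x \<partial>lborel)" if "\<And>i. test1 (h i)" for h
    proof -
      have "fourier (tensor h) = tensor (\<lambda>i. F1 (h i))" by (intro fourier_tensor test1_integrable that)
      moreover have "T (tensor (\<lambda>i. F1 (h i))) = (\<integral>x. f x * tensor (\<lambda>i. F1 (h i)) x \<partial>lborel)"
        by (rule tempered_tensor_eq_integral[OF T f rep]) (auto intro!: F1_schwartz1 that)
      ultimately show ?thesis by simp
    qed
    have "(\<integral>x. f x * tensor (\<lambda>i. F1 (g i)) x \<partial>lborel) = (\<integral>x. f x * tensor (\<lambda>i. F1 (\<lambda>x. g i x * \<eta> x)) x \<partial>lborel)"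
      using FT_bandlimit[OF T g \<eta>(1) band \<eta>(2,3)] S[of g] S[of "\<lambda>i x. g i x * \<eta> x"] g t by simp
    also have "\<dots> = (\<integral>x. f x * (\<integral>z. tensor (\<lambda>i. ?k) (x - z) * tensor (\<lambda>i. F1 (g i)) z \<partial>lborel) \<partial>lborel)"
      by (simp add: tensor_F1_mult[OF g \<eta>(1)])
    also have "\<dots> = (\<integral>z. u z * tensor (\<lambda>i. F1 (g i)) z \<partial>lborel)"
      unfolding u_def by (rule conv_fubini[OF f k M]) (intro integrable_tensor schwartz1_integrable F1_schwartz1 g)
    finally show ?thesis .
  qed
  have G: "(\<integral>x. f x * tensor \<psi> x \<partial>lborel) = (\<integral>x. u x * tensor \<psi> x \<partial>lborel)" if \<psi>: "\<And>i. test1 (\<psi> i)" for \<psi>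
  proof -
    have t: "test1 (\<lambda>x. cutoff_dil j x * F1 (\<psi> i) (- x))" for i j
      by (intro test1_mult test1_cutoff_dil schwartz1_smooth1 schwartz1_reflect F1_schwartz1 \<psi>)
    show ?thesis
      using LIMSEQ_unique[OF integral_tensor_limit[OF \<psi> f]] integral_tensor_limit[OF \<psi> u] F[OF t] by simp
  qed
  have B: "(\<integral>x. f x * indicator (box l r) x \<partial>lborel) = (\<integral>x. u x * indicator (box l r) x \<partial>lborel)" for l r
  proof -
    have "(\<lambda>j. \<integral>x. u x * tensor (\<lambda>i. box_approx (l $ i) (r $ i) j) x \<partial>lborel) \<longlonglongrightarrow> (\<integral>x. f x * indicator (box l r) x \<partial>lborel)"
      using integral_box_limit[OF f, of l r] G[OF test1_box_approx] by simp
    then show ?thesis using LIMSEQ_unique integral_box_limit[OF u, of l r] by blast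
  qed
  have "AE x in lborel. f x - u x = 0"
  proof (rule AE_zero_if_box_integrals_zero)
    fix l r
    show "integrable lborel (\<lambda>x. (f x - u x) * indicator (box l r) x)"
      unfolding left_diff_distrib by (intro Bochner_Integration.integrable_diff box_integrable f u)
    show "(\<integral>x. (f x - u x) * indicator (box l r) x \<partial>lborel) = 0"
      unfolding left_diff_distrib using B by (subst Bochner_Integration.integral_diff) (auto intro!: box_integrable f u)
  qed
  then show ?thesis by (rule AE_mp) (use ub in auto)
qed

section \<open>Rearrangements\<close>

lemma rearrangement_antimono: "t \<le> t' \<Longrightarrow> rearrangement f t' \<le> rearrangement f t"
  unfolding rearrangement_def
  by (rule Inf_superset_mono) (use ennreal_leI order_trans in blast)

text \<open>This allows \<open>f\<close> to be replaced by a Borel representative, to which the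
  product measure arguments apply.\<close>

lemma rearrangement_cong_AE:
  assumes [measurable]: "f \<in> borel_measurable lebesgue" "g \<in> borel_measurable lebesgue" and "AE x in lebesgue. f x = g x"
  shows "rearrangement f = rearrangement g"
proof
  fix t
  have "emeasure lebesgue {x. s < norm (f x)} = emeasure lebesgue {x. s < norm (g x)}" for s
  proof (rule emeasure_eq_AE)
    show "AE x in lebesgue. (x \<in> {x. s < norm (f x)}) = (x \<in> {x. s < norm (g x)})"
      using assms(3) by (rule AE_mp) (intro AE_I2, simp)
    have "{x \<in> space lebesgue. s < norm (f x)} \<in> sets lebesgue" "{x \<in> space lebesgue. s < norm (g x)} \<in> sets lebesgue"
      by measurable
    then show "{x. s < norm (f x)} \<in> sets lebesgue" "{x. s < norm (g x)} \<in> sets lebesgue" by simp_all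
  qed
  then show "rearrangement f t = rearrangement g t" unfolding rearrangement_def by simp
qed

lemma rearrangement_le:
  assumes "0 \<le> M" "f \<in> borel_measurable lebesgue" "AE x in lebesgue. norm (f x) \<le> M"
  shows "rearrangement f t \<le> ennreal M"
proof -
  have "emeasure lebesgue {x \<in> space lebesgue. M < norm (f x)} = 0"
    by (rule emeasure_eq_0_AE) (use assms(3) in \<open>auto simp: not_less\<close>)
  then show ?thesis
    unfolding rearrangement_def by (intro Inf_lower) (auto intro!: exI[of _ M] assms)
qed

section \<open>The distribution function and the layer cake formula\<close>

definition distr_fun :: "(real ^ 'n::finite \<Rightarrow> complex) \<Rightarrow> real \<Rightarrow> ennreal" where
  "distr_fun f s = emeasure lborel {x. s < norm (f x)}"

context
  fixes f :: "real ^ 'n::finite \<Rightarrow> complex"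
  assumes [measurable]: "f \<in> borel_measurable borel"
begin

lemma distr_fun_sets [measurable]: "{x. s < norm (f x)} \<in> sets borel"
  by measurable

lemma rearrangement_eq: "rearrangement f t = Inf {ennreal s |s. 0 \<le> s \<and> distr_fun f s \<le> ennreal t}"
  unfolding rearrangement_def distr_fun_def by simp

lemma distr_fun_antimono: "s \<le> s' \<Longrightarrow> distr_fun f s' \<le> distr_fun f s"
  unfolding distr_fun_def by (intro emeasure_mono) auto

lemma distr_fun_measurable [measurable]: "distr_fun f \<in> borel_measurable borel"
proof -
  have "distr_fun f = (\<lambda>s. \<integral>\<^sup>+x. indicator {p. fst p < norm (f (snd p))} (s, x) \<partial>lborel)"
  proof
    fix s
    have "distr_fun f s = (\<integral>\<^sup>+x. indicator {x. s < norm (f x)} x \<partial>lborel)"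
      unfolding distr_fun_def by (subst nn_integral_indicator) auto
    also have "\<dots> = (\<integral>\<^sup>+x. indicator {p. fst p < norm (f (snd p))} (s, x) \<partial>lborel)"
      by (intro nn_integral_cong) (auto simp: indicator_def)
    finally show "distr_fun f s = (\<integral>\<^sup>+x. indicator {p. fst p < norm (f (snd p))} (s, x) \<partial>lborel)" .
  qed
  also have "\<dots> \<in> borel_measurable borel"
    by measurable
  finally show ?thesis .
qed

text \<open>The infimum that defines the rearrangement is attained: the set where |f| > r is the
  increasing union of the sets where |f| > r + 1/(n + 1), and measure is continuous from
  below.\<close>

lemma distr_fun_rearrangement:
  assumes r: "rearrangement f t = ennreal r" "0 \<le> r"
  shows "distr_fun f r \<le> ennreal t"
proof -
  have le: "distr_fun f (r + 1 / (real n + 1)) \<le> ennreal t" for n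
  proof -
    have "rearrangement f t < ennreal (r + 1 / (real n + 1))"
      using r by (simp add: ennreal_less_iff)
    then obtain s where s: "0 \<le> s" "distr_fun f s \<le> ennreal t" "ennreal s < ennreal (r + 1 / (real n + 1))"
      unfolding rearrangement_eq Inf_less_iff by auto
    then have "s \<le> r + 1 / (real n + 1)" by (simp add: ennreal_less_iff)
    then show ?thesis using s(2) distr_fun_antimono order_trans by blast
  qed
  have "{x. r < norm (f x)} = (\<Union>n. {x. r + 1 / (real n + 1) < norm (f x)})"
  proof (intro set_eqI iffI)
    fix x assume "x \<in> {x. r < norm (f x)}"
    then obtain n where "inverse (real (Suc n)) < norm (f x) - r" using reals_Archimedean[of "norm (f x) - r"] by auto
    then show "x \<in> (\<Union>n. {x. r + 1 / (real n + 1) < norm (f x)})"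
      by (auto simp: inverse_eq_divide add.commute intro!: exI[of _ n])
  next
    fix x assume "x \<in> (\<Union>n. {x. r + 1 / (real n + 1) < norm (f x)})"
    then obtain n where "r + 1 / (real n + 1) < norm (f x)" by auto
    moreover have "0 < 1 / (real n + 1)" by simp
    ultimately show "x \<in> {x. r < norm (f x)}" by (simp, linarith)
  qed
  then have "distr_fun f r = emeasure lborel (\<Union>n. {x. r + 1 / (real n + 1) < norm (f x)})"
    by (simp add: distr_fun_def)
  also have "\<dots> = (SUP n. emeasure lborel {x. r + 1 / (real n + 1) < norm (f x)})"
  proof (rule SUP_emeasure_incseq[symmetric])
    show "incseq (\<lambda>n. {x. r + 1 / (real n + 1) < norm (f x)})"
    proof (rule incseq_SucI, rule subsetI)
      fix n x assume "x \<in> {x. r + 1 / (real n + 1) < norm (f x)}"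
      moreover have "1 / (real (Suc n) + 1) \<le> 1 / (real n + 1)" by (intro divide_left_mono) auto
      ultimately show "x \<in> {x. r + 1 / (real (Suc n) + 1) < norm (f x)}" by (simp del: of_nat_Suc)
    qed
  qed auto
  also have "\<dots> \<le> ennreal t" using le by (intro SUP_least) (simp add: distr_fun_def)
  finally show ?thesis .
qed

lemma le_rearrangement: "0 \<le> s \<Longrightarrow> ennreal t < distr_fun f s \<Longrightarrow> ennreal s \<le> rearrangement f t"
  unfolding rearrangement_eq
proof (rule Inf_greatest)
  fix x assume "ennreal t < distr_fun f s" "x \<in> {ennreal s |s. 0 \<le> s \<and> distr_fun f s \<le> ennreal t}"
  then obtain s' where "x = ennreal s'" "distr_fun f s' \<le> ennreal t" "0 \<le> s'" by auto
  then show "ennreal s \<le> x"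
    using \<open>ennreal t < distr_fun f s\<close> distr_fun_antimono[of s' s] by (cases "s \<le> s'") (auto intro: ennreal_leI)
qed

text \<open>Layer cake in both directions. The left side integrates, over \<open>s \<ge> 0\<close>,
  the measure of the set where |f| exceeds \<open>max s s0\<close>. This measure is at most both
  \<open>T\<close> and \<open>distr_fun f s\<close>, hence at most the length of the set of t in (0,
  T) with t < \<open>distr_fun f s\<close>. After exchanging the integrals, the section at
  \<open>t\<close> lies between 0 and \<open>rearrangement f t\<close>.\<close>

lemma nn_integral_large_values_le:
  assumes s0: "0 \<le> s0" "distr_fun f s0 \<le> ennreal T"
  shows "(\<integral>\<^sup>+x. ennreal (norm (f x)) * indicator {x. s0 < norm (f x)} x \<partial>lborel) \<le>
    (\<integral>\<^sup>+t. rearrangement f t * indicator {0<..<T} t \<partial>lborel)"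
proof -
  have "(\<integral>\<^sup>+x. ennreal (norm (f x)) * indicator {x. s0 < norm (f x)} x \<partial>lborel) =
    (\<integral>\<^sup>+x. (\<integral>\<^sup>+s. indicator {p. 0 \<le> snd p \<and> max (snd p) s0 < norm (f (fst p))} (x, s) \<partial>lborel) \<partial>lborel)"
  proof (intro nn_integral_cong)
    fix x
    show "ennreal (norm (f x)) * indicator {x. s0 < norm (f x)} x =
      (\<integral>\<^sup>+s. indicator {p. 0 \<le> snd p \<and> max (snd p) s0 < norm (f (fst p))} (x, s) \<partial>lborel)"
    proof (cases "s0 < norm (f x)")
      case True
      have "(\<integral>\<^sup>+s. indicator {p. 0 \<le> snd p \<and> max (snd p) s0 < norm (f (fst p))} (x, s) \<partial>lborel) =
        (\<integral>\<^sup>+s. indicator {0..<norm (f x)} s \<partial>lborel)"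
        using True by (intro nn_integral_cong) (auto simp: indicator_def)
      then show ?thesis using True by simp
    next
      case False
      then have "(\<integral>\<^sup>+s. indicator {p. 0 \<le> snd p \<and> max (snd p) s0 < norm (f (fst p))} (x, s) \<partial>lborel) = (\<integral>\<^sup>+s. 0 \<partial>(lborel :: real measure))"
        by (intro nn_integral_cong) (auto simp: indicator_def)
      then show ?thesis using False by simp
    qed
  qed
  also have "\<dots> = (\<integral>\<^sup>+s. (\<integral>\<^sup>+x. indicator {p. 0 \<le> snd p \<and> max (snd p) s0 < norm (f (fst p))} (x, s) \<partial>lborel) \<partial>lborel)"
    by (rule lborel_pair.Fubini') measurable
  also have "\<dots> \<le> (\<integral>\<^sup>+s. (\<integral>\<^sup>+t. indicator {p. 0 \<le> fst p \<and> 0 < snd p \<and> snd p < T \<and> ennreal (snd p) < distr_fun f (fst p)} (s, t) \<partial>lborel) \<partial>lborel)"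
  proof (intro nn_integral_mono)
    fix s :: real
    show "(\<integral>\<^sup>+x. indicator {p. 0 \<le> snd p \<and> max (snd p) s0 < norm (f (fst p))} (x, s) \<partial>lborel) \<le>
      (\<integral>\<^sup>+t. indicator {p. 0 \<le> fst p \<and> 0 < snd p \<and> snd p < T \<and> ennreal (snd p) < distr_fun f (fst p)} (s, t) \<partial>lborel)"
    proof (cases "0 \<le> s")
      case True
      let ?a = "distr_fun f (max s s0)"
      have a: "?a \<le> ennreal T" "?a \<le> distr_fun f s"
        using s0(2) distr_fun_antimono[of s0 "max s s0"] distr_fun_antimono[of s "max s s0"] by (auto intro: order_trans)
      then obtain r where r: "?a = ennreal r" "0 \<le> r" by (cases ?a) (auto simp: top_unique)
      have "(\<integral>\<^sup>+x. indicator {p. 0 \<le> snd p \<and> max (snd p) s0 < norm (f (fst p))} (x, s) \<partial>lborel) =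
        (\<integral>\<^sup>+x. indicator {x. max s s0 < norm (f x)} x \<partial>lborel)"
        using True by (intro nn_integral_cong) (auto simp: indicator_def)
      also have "\<dots> = ?a" unfolding distr_fun_def by (subst nn_integral_indicator) auto
      also have "\<dots> = (\<integral>\<^sup>+t. indicator {0<..<r} t \<partial>lborel)" using r by simp
      also have "\<dots> \<le> (\<integral>\<^sup>+t. indicator {p. 0 \<le> fst p \<and> 0 < snd p \<and> snd p < T \<and> ennreal (snd p) < distr_fun f (fst p)} (s, t) \<partial>lborel)"
      proof (intro nn_integral_mono)
        fix t :: real
        have "t < T \<and> ennreal t < distr_fun f s" if t: "0 < t" "t < r"
        proof -
          have "ennreal t < ennreal r" using t by (simp add: ennreal_less_iff)
          then have "ennreal t < ennreal T" "ennreal t < distr_fun f s" using a r(1) by auto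
          then show ?thesis using t by (simp add: ennreal_less_iff)
        qed
        then show "(indicator {0<..<r} t :: ennreal) \<le> indicator {p. 0 \<le> fst p \<and> 0 < snd p \<and> snd p < T \<and> ennreal (snd p) < distr_fun f (fst p)} (s, t)"
          using True by (auto simp: indicator_def)
      qed
      finally show ?thesis .
    qed (simp add: indicator_def)
  qed
  also have "\<dots> = (\<integral>\<^sup>+t. (\<integral>\<^sup>+s. indicator {p. 0 \<le> fst p \<and> 0 < snd p \<and> snd p < T \<and> ennreal (snd p) < distr_fun f (fst p)} (s, t) \<partial>lborel) \<partial>lborel)"
    by (rule lborel_pair.Fubini') measurable
  also have "\<dots> \<le> (\<integral>\<^sup>+t. rearrangement f t * indicator {0<..<T} t \<partial>lborel)"
  proof (intro nn_integral_mono)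
    fix t :: real
    show "(\<integral>\<^sup>+s. indicator {p. 0 \<le> fst p \<and> 0 < snd p \<and> snd p < T \<and> ennreal (snd p) < distr_fun f (fst p)} (s, t) \<partial>lborel) \<le>
      rearrangement f t * indicator {0<..<T} t"
    proof (cases "0 < t \<and> t < T")
      case True
      show ?thesis
      proof (cases "rearrangement f t")
        case (real r)
        have "(\<integral>\<^sup>+s. indicator {p. 0 \<le> fst p \<and> 0 < snd p \<and> snd p < T \<and> ennreal (snd p) < distr_fun f (fst p)} (s, t) \<partial>lborel)
          \<le> (\<integral>\<^sup>+s. indicator {0..r} s \<partial>lborel)"
        proof (intro nn_integral_mono)
          fix s
          have "s \<le> r" if "0 \<le> s" "ennreal t < distr_fun f s"
            using le_rearrangement[OF that] real by (simp add: ennreal_le_iff)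
          then show "indicator {p. 0 \<le> fst p \<and> 0 < snd p \<and> snd p < T \<and> ennreal (snd p) < distr_fun f (fst p)} (s, t) \<le> (indicator {0..r} s :: ennreal)"
            by (auto simp: indicator_def)
        qed
        also have "\<dots> = ennreal r" using real by simp
        finally show ?thesis using True real by simp
      qed (use True in simp)
    qed (auto simp: indicator_def)
  qed
  finally show ?thesis .
qed

end

lemma rearrangement_measurable [measurable]: "rearrangement f \<in> borel_measurable borel"
proof (rule borel_measurableI_less)
  fix y
  have "is_interval {t. rearrangement f t < y}"
    unfolding is_interval_1 using le_less_trans[OF rearrangement_antimono] by blast
  then have "{t. rearrangement f t < y} \<in> sets borel"
    by (rule real_interval_borel_measurable)
  then show "{t \<in> space borel. rearrangement f t < y} \<in> sets borel" by simp
qed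

section \<open>Broken logarithms\<close>

lemma broken_log_pos [simp]: "0 < broken_log A t"
  by (simp add: broken_log_def)

lemma broken_log_nonneg [simp]: "0 \<le> broken_log A t"
  by (simp add: less_imp_le)

lemma broken_log_add: "broken_log (A + B) t = broken_log A t * broken_log B t"
  by (simp add: broken_log_def powr_add)

lemma broken_log_uminus: "broken_log (- A) t = 1 / broken_log A t"
  by (simp add: broken_log_def powr_minus divide_inverse)

lemma broken_log_powr: "broken_log A t powr r = broken_log (r *\<^sub>R A) t"
  by (simp add: broken_log_def powr_powr mult.commute)

lemma broken_log_measurable [measurable]: "broken_log A \<in> borel_measurable borel"
  unfolding broken_log_def[abs_def] by measurable

text \<open>\<open>1 + x\<close> and \<open>1 + y\<close> differ by a factor of at most
  \<open>1 + L\<close> in either direction, which covers both signs of the exponent.\<close>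

lemma powr_quot_bound:
  fixes x y L \<beta> \<kappa> :: real
  assumes "0 \<le> x" "0 \<le> y" "0 \<le> L" "x \<le> y + L" "y \<le> x + L" "\<bar>\<beta>\<bar> \<le> \<kappa>"
  shows "(1 + x) powr \<beta> \<le> (1 + L) powr \<kappa> * (1 + y) powr \<beta>"
proof -
  have e1: "1 + x \<le> (1 + L) * (1 + y)" and e2: "1 + y \<le> (1 + L) * (1 + x)"
  proof -
    have p: "0 \<le> L * y" "0 \<le> L * x" using assms by simp_all
    have m: "(1 + L) * (1 + z) = 1 + L + z + L * z" for z by (simp add: algebra_simps)
    show "1 + x \<le> (1 + L) * (1 + y)" using assms p m[of y] by linarith
    show "1 + y \<le> (1 + L) * (1 + x)" using assms p m[of x] by linarith
  qed
  have "(1 + x) powr \<beta> \<le> (1 + L) powr \<bar>\<beta>\<bar> * (1 + y) powr \<beta>"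
  proof (cases "0 \<le> \<beta>")
    case True
    have "(1 + x) powr \<beta> \<le> ((1 + L) * (1 + y)) powr \<beta>" using e1 assms True by (intro powr_mono2) auto
    then show ?thesis using True assms by (simp add: powr_mult)
  next
    case False
    have "(1 + y) powr (- \<beta>) \<le> ((1 + L) * (1 + x)) powr (- \<beta>)" using e2 assms False by (intro powr_mono2) auto
    also have "\<dots> = (1 + L) powr (- \<beta>) * (1 + x) powr (- \<beta>)" using assms by (simp add: powr_mult)
    finally show ?thesis using False assms by (simp add: powr_minus field_simps)
  qed
  also have "\<dots> \<le> (1 + L) powr \<kappa> * (1 + y) powr \<beta>"
    using assms by (intro mult_right_mono powr_mono) auto
  finally show ?thesis .
qed

text \<open>Both exponents are added because a comparison across the point 1 pays for both
  branches.\<close>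

definition expo :: "real \<times> real \<Rightarrow> real" where
  "expo A = \<bar>fst A\<bar> + \<bar>snd A\<bar>"

text \<open>Slow variation in quantitative form. On one side of 1 a single exponent is involved. On
  opposite sides |ln (s/t)| equals |ln s| + |ln t|, and the comparison passes through the value 1
  taken at the point 1.\<close>

lemma broken_log_slow:
  assumes "0 < s" "0 < t"
  shows "broken_log A s \<le> (1 + \<bar>ln (s / t)\<bar>) powr expo A * broken_log A t"
proof -
  let ?L = "\<bar>ln (s / t)\<bar>"
  have L: "?L = \<bar>ln s - ln t\<bar>" using assms by (simp add: ln_div)
  show ?thesis
  proof (cases "s \<le> 1 \<longleftrightarrow> t \<le> 1")
    case True
    then show ?thesis unfolding broken_log_def L
      by (cases "t \<le> 1") (auto intro!: powr_quot_bound simp: expo_def)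
  next
    case False
    define \<beta> where "\<beta> = (if s \<le> 1 then fst A else snd A)"
    define \<gamma> where "\<gamma> = (if t \<le> 1 then fst A else snd A)"
    have sum: "\<bar>\<beta>\<bar> + \<bar>\<gamma>\<bar> = expo A" using False by (auto simp: \<beta>_def \<gamma>_def expo_def)
    have "?L = \<bar>ln s\<bar> + \<bar>ln t\<bar>"
    proof (cases "s \<le> 1")
      case True
      then have "ln s \<le> 0" "0 \<le> ln t" using False assms by auto
      then show ?thesis unfolding L by linarith
    next
      case False': False
      then have "0 \<le> ln s" "ln t \<le> 0" using False assms by auto
      then show ?thesis unfolding L by linarith
    qed
    note L' = this
    have 1: "(1 + \<bar>ln s\<bar>) powr \<beta> \<le> (1 + ?L) powr \<bar>\<beta>\<bar> * (1 + 0) powr \<beta>"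
      by (rule powr_quot_bound) (auto simp: L')
    have 2: "(1 + 0) powr \<gamma> \<le> (1 + ?L) powr \<bar>\<gamma>\<bar> * (1 + \<bar>ln t\<bar>) powr \<gamma>"
      by (rule powr_quot_bound) (auto simp: L')
    have "broken_log A s \<le> (1 + ?L) powr \<bar>\<beta>\<bar> * 1" using 1 by (simp add: broken_log_def \<beta>_def)
    also have "\<dots> \<le> (1 + ?L) powr \<bar>\<beta>\<bar> * ((1 + ?L) powr \<bar>\<gamma>\<bar> * (1 + \<bar>ln t\<bar>) powr \<gamma>)"
      using 2 by (intro mult_left_mono) auto
    also have "\<dots> = (1 + ?L) powr expo A * broken_log A t"
      by (simp add: broken_log_def \<gamma>_def powr_add flip: sum)
    finally show ?thesis .
  qed
qed

lemma log_le_power: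
  fixes \<kappa> \<delta> :: real
  assumes "0 \<le> \<kappa>" "0 < \<delta>"
  shows "\<exists>C>0. \<forall>u\<ge>1::real. (1 + ln u) powr \<kappa> \<le> C * u powr \<delta>"
proof -
  \<comment> \<open>Chosen so that \<open>e * \<kappa> \<le> \<delta>\<close>; the added 1 covers
    \<open>\<kappa> = 0\<close>.\<close>
  define e where "e = \<delta> / (\<kappa> + 1)"
  have e: "0 < e" "e * \<kappa> \<le> \<delta>" using assms by (auto simp: e_def field_simps)
  have e1: "0 < 1 + 1 / e" using e by (simp add: add_pos_pos)
  have "(1 + ln u) powr \<kappa> \<le> (1 + 1 / e) powr \<kappa> * u powr \<delta>" if u: "1 \<le> u" for u
  proof -
    have "ln (u powr e) \<le> u powr e - 1" using u by (intro ln_le_minus_one) auto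
    then have "ln u \<le> u powr e / e" using u e by (simp add: ln_powr field_simps)
    moreover have "1 \<le> u powr e" using u e by (simp add: ge_one_powr_ge_zero)
    ultimately have "1 + ln u \<le> (1 + 1 / e) * u powr e" by (simp add: algebra_simps)
    then have "(1 + ln u) powr \<kappa> \<le> ((1 + 1 / e) * u powr e) powr \<kappa>"
      using u assms by (intro powr_mono2) auto
    also have "\<dots> = (1 + 1 / e) powr \<kappa> * u powr (e * \<kappa>)"
      using e1 by (simp add: powr_mult powr_powr)
    also have "\<dots> \<le> (1 + 1 / e) powr \<kappa> * u powr \<delta>"
      using u e by (intro mult_left_mono powr_mono) auto
    finally show ?thesis .
  qed
  moreover have "0 < (1 + 1 / e) powr \<kappa>" using e1 by simp
  ultimately show ?thesis by blast
qed

section \<open>Integrals of powers and logarithms\<close>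

lemma nn_integral_UN_le:
  fixes g :: "real \<Rightarrow> ennreal"
  assumes [measurable]: "g \<in> borel_measurable borel" and A: "\<And>n::nat. A n \<in> sets borel" "incseq A"
    and le: "\<And>n. (\<integral>\<^sup>+x. g x * indicator (A n) x \<partial>lborel) \<le> c"
  shows "(\<integral>\<^sup>+x. g x * indicator (\<Union>n. A n) x \<partial>lborel) \<le> c"
proof -
  have "emeasure (density lborel g) (\<Union>n. A n) = (SUP n. emeasure (density lborel g) (A n))"
    using A by (intro SUP_emeasure_incseq[symmetric]) auto
  also have "\<dots> \<le> c" using A le by (intro SUP_least) (simp add: emeasure_density)
  finally show ?thesis using A by (simp add: emeasure_density)
qed

text \<open>Only an upper bound is wanted, so nonnegativity of \<open>F\<close> takes the place of
  its limit at 0: the terms \<open>- F (a n)\<close> are simply dropped.\<close>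

lemma nn_integral_Ioc_le:
  fixes F g :: "real \<Rightarrow> real"
  assumes [measurable]: "g \<in> borel_measurable borel"
    and D: "\<And>x. 0 < x \<Longrightarrow> x \<le> T \<Longrightarrow> (F has_real_derivative g x) (at x)"
    and nn: "\<And>x. 0 < x \<Longrightarrow> x \<le> T \<Longrightarrow> 0 \<le> g x" "\<And>x. 0 < x \<Longrightarrow> x \<le> T \<Longrightarrow> 0 \<le> F x" and T: "0 < T"
  shows "(\<integral>\<^sup>+x. ennreal (g x) * indicator {0<..T} x \<partial>lborel) \<le> ennreal (F T)"
proof -
  define a where "a n = T / (real n + 1)" for n
  have a: "0 < a n" "a n \<le> T" for n using T by (auto simp: a_def field_simps)
  have dec: "a (Suc n) \<le> a n" for n unfolding a_def using T by (intro divide_left_mono) auto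
  have cov: "{0<..T} = (\<Union>n. {a n..T})"
  proof (intro set_eqI iffI)
    fix x assume x: "x \<in> {0<..T}"
    obtain n :: nat where "T / x \<le> real n" using real_arch_simple by blast
    then have "T \<le> real n * x" using x by (simp add: pos_divide_le_eq)
    also have "\<dots> \<le> (real n + 1) * x" using x by simp
    finally have "a n \<le> x" by (simp add: a_def pos_divide_le_eq mult.commute)
    then show "x \<in> (\<Union>n. {a n..T})" using x by auto
  qed (use a in \<open>auto intro: less_le_trans\<close>)
  show ?thesis
    unfolding cov
  proof (rule nn_integral_UN_le)
    show "incseq (\<lambda>n. {a n..T})" using dec by (intro incseq_SucI) (auto intro: order_trans)
    fix n
    have "(\<integral>\<^sup>+x. ennreal (g x) * indicator {a n..T} x \<partial>lborel) = F T - F (a n)"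
      using a[of n] by (intro nn_integral_FTC_Icc) (auto intro!: D nn simp: less_le_trans)
    also have "\<dots> \<le> ennreal (F T)" using nn(2)[OF a] by (intro ennreal_leI) simp
    finally show "(\<integral>\<^sup>+x. ennreal (g x) * indicator {a n..T} x \<partial>lborel) \<le> ennreal (F T)" .
  qed auto
qed

lemma nn_integral_Ici_le:
  fixes F g :: "real \<Rightarrow> real"
  assumes [measurable]: "g \<in> borel_measurable borel"
    and D: "\<And>x. T \<le> x \<Longrightarrow> (F has_real_derivative - g x) (at x)"
    and nn: "\<And>x. T \<le> x \<Longrightarrow> 0 \<le> g x" "\<And>x. T \<le> x \<Longrightarrow> 0 \<le> F x"
  shows "(\<integral>\<^sup>+x. ennreal (g x) * indicator {T..} x \<partial>lborel) \<le> ennreal (F T)"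
proof -
  have cov: "{T..} = (\<Union>n::nat. {T..T + real n})"
  proof (intro set_eqI iffI)
    fix x assume x: "x \<in> {T..}"
    obtain n :: nat where "x - T \<le> real n" using real_arch_simple by blast
    then show "x \<in> (\<Union>n. {T..T + real n})" using x by (auto intro!: exI[of _ n])
  qed auto
  show ?thesis
    unfolding cov
  proof (rule nn_integral_UN_le)
    show "incseq (\<lambda>n. {T..T + real n})" by (intro incseq_SucI) auto
    fix n :: nat
    have "(\<integral>\<^sup>+x. ennreal (g x) * indicator {T..T + real n} x \<partial>lborel) = (- F (T + real n)) - (- F T)"
    proof (intro nn_integral_FTC_Icc)
      fix x assume "x \<in> {T..T + real n}"
      then show "((\<lambda>x. - F x) has_real_derivative g x) (at x)"
        using DERIV_minus[OF D] by auto
    qed (auto intro!: nn)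
    also have "\<dots> \<le> ennreal (F T)" using nn(2)[of "T + real n"] by (intro ennreal_leI) simp
    finally show "(\<integral>\<^sup>+x. ennreal (g x) * indicator {T..T + real n} x \<partial>lborel) \<le> ennreal (F T)" .
  qed auto
qed

lemma nn_integral_power_Ioc_le:
  assumes "0 < a" "0 < T"
  shows "(\<integral>\<^sup>+t. ennreal (t powr (a - 1)) * indicator {0<..T} t \<partial>lborel) \<le> ennreal (T powr a / a)"
  by (rule nn_integral_Ioc_le[where F = "\<lambda>t. t powr a / a"])
    (use assms in \<open>auto intro!: derivative_eq_intros\<close>)

lemma nn_integral_power_Ici_le:
  assumes "0 < a" "0 < T"
  shows "(\<integral>\<^sup>+t. ennreal (t powr (- a - 1)) * indicator {T..} t \<partial>lborel) \<le> ennreal (T powr (- a) / a)"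
  by (rule nn_integral_Ici_le[where F = "\<lambda>t. t powr (- a) / a"])
    (use assms in \<open>auto intro!: derivative_eq_intros\<close>)

lemma nn_integral_log_le_1:
  assumes "\<gamma> < - 1" "0 < T" "T \<le> 1"
  shows "(\<integral>\<^sup>+t. ennreal (1 / t * (1 - ln t) powr \<gamma>) * indicator {0<..T} t \<partial>lborel) \<le> ennreal ((1 - ln T) powr (\<gamma> + 1) / - (\<gamma> + 1))"
proof (rule nn_integral_Ioc_le[where F = "\<lambda>t. (1 - ln t) powr (\<gamma> + 1) / - (\<gamma> + 1)"])
  fix x assume x: "0 < x" "x \<le> T"
  have l: "0 < 1 - ln x" using x assms ln_le_zero_iff[of x] by linarith
  show "((\<lambda>t. (1 - ln t) powr (\<gamma> + 1) / - (\<gamma> + 1)) has_real_derivative 1 / x * (1 - ln x) powr \<gamma>) (at x)"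
  proof -
    have "((\<lambda>t. (1 - ln t) powr (\<gamma> + 1)) has_real_derivative (\<gamma> + 1) * (1 - ln x) powr (\<gamma> + 1 - 1) * (- (1 / x))) (at x)"
      by (rule DERIV_chain2[where g = "\<lambda>t. 1 - ln t"], rule has_real_derivative_powr[OF l]) (use x in \<open>auto intro!: derivative_eq_intros\<close>)
    note d = DERIV_cdivide[OF this, of "- (\<gamma> + 1)"]
    have g: "c \<noteq> 0 \<Longrightarrow> c * P * - (1 / x) / - c = 1 / x * P" for c P :: real by (simp add: field_simps)
    have "(\<gamma> + 1) * (1 - ln x) powr (\<gamma> + 1 - 1) * - (1 / x) / - (\<gamma> + 1) = 1 / x * (1 - ln x) powr (\<gamma> + 1 - 1)"
      by (rule g) (use assms in simp)
    with d show ?thesis by (simp only: add_diff_cancel_right')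
  qed
  show "0 \<le> (1 - ln x) powr (\<gamma> + 1) / - (\<gamma> + 1)" using assms by (intro divide_nonneg_pos) auto
qed (use assms in auto)

lemma nn_integral_log_ge_1:
  assumes "- 1 < \<gamma>" "1 \<le> T"
  shows "(\<integral>\<^sup>+t. ennreal (1 / t * (1 + ln t) powr \<gamma>) * indicator {1..T} t \<partial>lborel) \<le> ennreal ((1 + ln T) powr (\<gamma> + 1) / (\<gamma> + 1))"
proof -
  have "(\<integral>\<^sup>+t. ennreal (1 / t * (1 + ln t) powr \<gamma>) * indicator {1..T} t \<partial>lborel) =
    (1 + ln T) powr (\<gamma> + 1) / (\<gamma> + 1) - (1 + ln 1) powr (\<gamma> + 1) / (\<gamma> + 1)"
  proof (rule nn_integral_FTC_Icc)
    fix x assume "x \<in> {1..T}"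
    then have x: "1 \<le> x" "x \<le> T" by auto
    have l: "0 < 1 + ln x" using x ln_ge_zero[of x] by linarith
    show "((\<lambda>t. (1 + ln t) powr (\<gamma> + 1) / (\<gamma> + 1)) has_real_derivative 1 / x * (1 + ln x) powr \<gamma>) (at x)"
    proof -
      have "((\<lambda>t. (1 + ln t) powr (\<gamma> + 1)) has_real_derivative (\<gamma> + 1) * (1 + ln x) powr (\<gamma> + 1 - 1) * (1 / x)) (at x)"
        by (rule DERIV_chain2[where g = "\<lambda>t. 1 + ln t"], rule has_real_derivative_powr[OF l]) (use x in \<open>auto intro!: derivative_eq_intros\<close>)
      from DERIV_cdivide[OF this, of "\<gamma> + 1"] show ?thesis using assms by (simp add: mult.commute)
    qed
  qed (use assms in auto)
  also have "\<dots> \<le> ennreal ((1 + ln T) powr (\<gamma> + 1) / (\<gamma> + 1))"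
    using assms by (intro ennreal_leI) simp
  finally show ?thesis .
qed

text \<open>\<open>fst G < - 1\<close> gives convergence at 0, and \<open>- 1 < snd G\<close> lets
  the upper end govern the integral for large \<open>T\<close>. In both ranges integrating 1/t
  against the logarithm raises the exponent by one, which is the factor 1 + |ln T|.\<close>

lemma nn_integral_broken_log_le:
  assumes G: "fst G < - 1" "- 1 < snd G"
  shows "\<exists>C>0. \<forall>T>0. (\<integral>\<^sup>+t. ennreal (1 / t * broken_log G t) * indicator {0<..T} t \<partial>lborel) \<le>
    ennreal (C * (broken_log G T * (1 + \<bar>ln T\<bar>)))"
proof -
  let ?c = "1 / - (fst G + 1)" and ?d = "1 / (snd G + 1)"
  have pos: "0 < ?c" "0 < ?d" using G by auto
  have small: "(\<integral>\<^sup>+t. ennreal (1 / t * broken_log G t) * indicator {0<..T} t \<partial>lborel) \<le> ennreal (?c * (1 - ln T) powr (fst G + 1))"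
    if T: "0 < T" "T \<le> 1" for T
  proof -
    have "(\<integral>\<^sup>+t. ennreal (1 / t * broken_log G t) * indicator {0<..T} t \<partial>lborel) = (\<integral>\<^sup>+t. ennreal (1 / t * (1 - ln t) powr fst G) * indicator {0<..T} t \<partial>lborel)"
      using T by (intro nn_integral_cong) (auto simp: broken_log_def indicator_def abs_of_nonpos)
    also have "\<dots> \<le> ennreal (?c * (1 - ln T) powr (fst G + 1))"
      using nn_integral_log_le_1[OF G(1) T] by simp
    finally show ?thesis .
  qed
  have "(\<integral>\<^sup>+t. ennreal (1 / t * broken_log G t) * indicator {0<..T} t \<partial>lborel) \<le> ennreal ((?c + ?d) * (broken_log G T * (1 + \<bar>ln T\<bar>)))"
    if T: "0 < T" for T
  proof (cases "T \<le> 1")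
    case True
    have l: "\<bar>ln T\<bar> = - ln T" using True T by (simp add: abs_of_nonpos)
    have "(1 - ln T) * (1 - ln T) powr fst G = (1 - ln T) powr (1 + fst G)"
    proof (rule powr_mult_base)
      have "ln T \<le> 0" using True T by simp
      then show "0 \<le> 1 - ln T" by linarith
    qed
    then have "broken_log G T * (1 + \<bar>ln T\<bar>) = (1 - ln T) powr (fst G + 1)"
      using True T by (simp add: broken_log_def l mult.commute add.commute)
    moreover have "?c * (1 - ln T) powr (fst G + 1) \<le> (?c + ?d) * (1 - ln T) powr (fst G + 1)"
      by (rule mult_right_mono) (use pos in linarith, simp)
    ultimately show ?thesis
      using order_trans[OF small[OF T True] ennreal_leI] by simp
  next
    case False
    then have T1: "1 \<le> T" by simp
    have l: "\<bar>ln T\<bar> = ln T" using False T by simp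
    have e: "broken_log G T * (1 + \<bar>ln T\<bar>) = (1 + ln T) powr (snd G + 1)"
      using False T ln_ge_zero[OF T1] by (simp add: broken_log_def powr_add)
    \<comment> \<open>This absorbs the constant contribution of (0, 1] into the term that grows with
      \<open>T\<close>.\<close>
    have one: "1 \<le> (1 + ln T) powr (snd G + 1)" using ln_ge_zero[OF T1] G by (intro ge_one_powr_ge_zero) auto
    have "(\<integral>\<^sup>+t. ennreal (1 / t * broken_log G t) * indicator {0<..T} t \<partial>lborel) \<le>
      (\<integral>\<^sup>+t. ennreal (1 / t * broken_log G t) * indicator {0<..1} t + ennreal (1 / t * (1 + ln t) powr snd G) * indicator {1..T} t \<partial>lborel)"
      by (intro nn_integral_mono) (auto simp: broken_log_def indicator_def)
    also have "\<dots> = (\<integral>\<^sup>+t. ennreal (1 / t * broken_log G t) * indicator {0<..1} t \<partial>lborel) + (\<integral>\<^sup>+t. ennreal (1 / t * (1 + ln t) powr snd G) * indicator {1..T} t \<partial>lborel)"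
      by (rule nn_integral_add) measurable
    also have "\<dots> \<le> ennreal (?c * (1 - ln 1) powr (fst G + 1)) + ennreal ((1 + ln T) powr (snd G + 1) / (snd G + 1))"
      by (intro add_mono small nn_integral_log_ge_1 G T1) auto
    also have "\<dots> = ennreal (?c + (1 + ln T) powr (snd G + 1) / (snd G + 1))"
      using pos G by (subst ennreal_plus) auto
    also have "\<dots> \<le> ennreal ((?c + ?d) * (broken_log G T * (1 + \<bar>ln T\<bar>)))"
      unfolding e using mult_left_mono[OF one, of ?c] pos by (intro ennreal_leI) (simp add: distrib_right)
    finally show ?thesis .
  qed
  then show ?thesis using pos by (intro exI[of _ "?c + ?d"]) (auto simp: add_pos_pos)
qed

section \<open>Powers of extended nonnegative reals and the quasi-norm\<close>

lemma ennreal_powr_mono: "0 < a \<Longrightarrow> x \<le> y \<Longrightarrow> ennreal_powr x a \<le> ennreal_powr y a"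
  unfolding ennreal_powr_def
  by (auto simp: top_unique intro!: ennreal_leI powr_mono2 enn2real_mono simp: less_top)

lemma ennreal_powr_ennreal: "0 \<le> r \<Longrightarrow> ennreal_powr (ennreal r) a = ennreal (r powr a)"
  by (simp add: ennreal_powr_def)

lemma ennreal_powr_mult: "0 \<le> c \<Longrightarrow> 0 < a \<Longrightarrow> ennreal_powr (ennreal c * x) a = ennreal (c powr a) * ennreal_powr x a"
proof (cases x)
  case (real r)
  assume "0 \<le> c" "0 < a"
  then show ?thesis using real
    by (simp add: ennreal_mult[symmetric] ennreal_powr_ennreal powr_mult)
next
  case top
  assume "0 \<le> c" "0 < a"
  then show ?thesis using top by (cases "c = 0") (auto simp: ennreal_powr_def ennreal_mult_top)
qed

lemma ennreal_powr_powr_inverse: "0 < a \<Longrightarrow> ennreal_powr (ennreal_powr x a) (1 / a) = x"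
  by (cases x) (auto simp: ennreal_powr_ennreal powr_powr, auto simp: ennreal_powr_def)

lemma ennreal_powr_measurable [measurable]: "(\<lambda>x. ennreal_powr x a) \<in> borel_measurable borel"
  unfolding ennreal_powr_def[abs_def] by measurable

lemma nn_integral_lebesgue_on_pos:
  fixes g :: "real \<Rightarrow> ennreal"
  assumes [measurable]: "g \<in> borel_measurable borel"
  shows "(\<integral>\<^sup>+t. g t \<partial>lebesgue_on {0<..}) = (\<integral>\<^sup>+t. g t * indicator {0<..} t \<partial>lborel)"
proof -
  have "(\<integral>\<^sup>+t. g t \<partial>lebesgue_on {0<..}) = (\<integral>\<^sup>+t. g t * indicator {0<..} t \<partial>lebesgue)"
    by (rule nn_integral_restrict_space) simp
  also have "\<dots> = (\<integral>\<^sup>+t. g t * indicator {0<..} t \<partial>lborel)"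
    by (rule nn_integral_completion)
  finally show ?thesis .
qed

lemma recip_ennreal: "0 < r \<Longrightarrow> recip (ennreal r) = 1 / r"
  by (simp add: recip_def inverse_ennreal inverse_eq_divide)

lemma recip_top [simp]: "recip \<infinity> = 0" "recip top = 0"
  by (simp_all add: recip_def)

lemma LZ_qnorm_finite:
  assumes "0 < r"
  shows "LZ_qnorm p (ennreal r) A f =
    ennreal_powr (\<integral>\<^sup>+t. ennreal_powr (ennreal (t powr (recip p - 1 / r) * broken_log A t) * rearrangement f t) r * indicator {0<..} t \<partial>lborel) (1 / r)"
  using assms unfolding LZ_qnorm_def Lp_qnorm_def
  by (simp add: recip_ennreal nn_integral_lebesgue_on_pos)

lemma LZ_qnorm_top:
  "LZ_qnorm p \<infinity> A f = esssup (lebesgue_on {0<..}) (\<lambda>t. ennreal (t powr recip p * broken_log A t) * rearrangement f t)"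
  unfolding LZ_qnorm_def Lp_qnorm_def by simp

text \<open>Moving from \<open>t\<close> down to a point of [t/2, t], the power loses at most a
  factor 2^|a|. The logarithm loses at most 2^(expo B), because |ln (t/s)| \<le> 1 there.\<close>

lemma weight_lower:
  assumes "0 < t" "t / 2 \<le> s" "s \<le> t"
  shows "2 powr (- (\<bar>a\<bar> + expo B)) * (t powr a * broken_log B t) \<le> s powr a * broken_log B s"
proof -
  have s: "0 < s" using assms by simp
  have "2 powr (- \<bar>a\<bar>) * t powr a \<le> s powr a"
  proof (cases "0 \<le> a")
    case True
    have "(t / 2) powr a \<le> s powr a" using assms True by (intro powr_mono2) auto
    then show ?thesis using True assms by (simp add: powr_divide powr_minus_divide mult.commute)
  next
    case False
    have "2 powr (- \<bar>a\<bar>) * t powr a \<le> 1 * t powr a" using powr_mono[of "- \<bar>a\<bar>" 0 2] by (intro mult_right_mono) auto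
    also have "\<dots> \<le> s powr a" using False assms s by (simp add: powr_mono2')
    finally show ?thesis .
  qed
  moreover have "2 powr (- expo B) * broken_log B t \<le> broken_log B s"
  proof -
    have "\<bar>ln (t / s)\<bar> \<le> 1"
    proof -
      have "0 \<le> ln (t / s)" using s assms by simp
      moreover have "t / s \<le> 2" using s assms by (simp add: field_simps)
      then have "ln (t / s) \<le> 2 - 1" using s assms ln_le_minus_one[of "t / s"] by simp
      ultimately show ?thesis by simp
    qed
    then have "(1 + \<bar>ln (t / s)\<bar>) powr expo B \<le> 2 powr expo B" by (intro powr_mono2) (auto simp: expo_def)
    then have "(1 + \<bar>ln (t / s)\<bar>) powr expo B * broken_log B s \<le> 2 powr expo B * broken_log B s"
      by (intro mult_right_mono) auto
    then have "broken_log B t \<le> 2 powr expo B * broken_log B s"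
      using broken_log_slow[OF assms(1) s, of B] by linarith
    then show ?thesis by (simp add: powr_minus field_simps)
  qed
  ultimately have "(2 powr (- \<bar>a\<bar>) * t powr a) * (2 powr (- expo B) * broken_log B t) \<le> s powr a * broken_log B s"
    by (intro mult_mono) auto
  moreover have "2 powr (- (\<bar>a\<bar> + expo B)) = 2 powr (- \<bar>a\<bar>) * 2 powr (- expo B)"
    by (simp add: powr_add[symmetric])
  ultimately show ?thesis by (simp add: mult_ac)
qed

section \<open>Norm estimates\<close>

text \<open>The function V of the overview.\<close>

definition decay :: "real \<Rightarrow> real \<times> real \<Rightarrow> real \<Rightarrow> real" where
  "decay q B t = t powr (- (1 / q)) * broken_log (- B) t"

lemma decay_pos: "0 < t \<Longrightarrow> 0 < decay q B t"
  by (simp add: decay_def)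

lemma decay_measurable [measurable]: "decay q B \<in> borel_measurable borel"
  unfolding decay_def[abs_def] by measurable

lemma broken_log_zero: "broken_log (0, 0) t = 1"
proof -
  have "1 + \<bar>ln t\<bar> \<noteq> 0" by linarith
  then show ?thesis
    unfolding broken_log_def by (simp only: fst_conv snd_conv if_cancel powr_zero_eq_one if_False)
qed

text \<open>The rearrangement is at least its value at \<open>t\<close> throughout [t/2, t], and the
  weight is comparable to its value at \<open>t\<close>. The share of the norm carried by this
  interval therefore controls that value.\<close>

lemma LZ_qnorm_lower_bound:
  fixes q :: real
  assumes q: "0 < q" and c: "0 < c"
  shows "\<exists>K>0. \<forall>(f :: real ^ 'n::finite \<Rightarrow> complex) t. 0 < t \<longrightarrow>
    ennreal (K * (t powr (1 / q) * broken_log B t)) * rearrangement f t \<le> LZ_qnorm (ennreal q) c B f"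
proof (cases c)
  case top
  let ?\<kappa> = "2 powr (- (\<bar>1 / q\<bar> + expo B))"
  have "ennreal (?\<kappa> * (t powr (1 / q) * broken_log B t)) * rearrangement f t \<le> LZ_qnorm (ennreal q) c B f"
    if t: "0 < t" for t and f :: "real ^ 'n \<Rightarrow> complex"
  proof -
    let ?w = "\<lambda>s. s powr (1 / q) * broken_log B s"
    have N: "LZ_qnorm (ennreal q) c B f = esssup (lebesgue_on {0<..}) (\<lambda>s. ennreal (?w s) * rearrangement f s)"
      using LZ_qnorm_top[of "ennreal q" B f] q top by (simp add: recip_ennreal)
    have AE: "AE s in lebesgue. s \<in> {0<..} \<longrightarrow> ennreal (?w s) * rearrangement f s \<le> LZ_qnorm (ennreal q) c B f"
      using esssup_AE[of "\<lambda>s. ennreal (?w s) * rearrangement f s" "lebesgue_on {0<..}"] unfolding N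
      by (subst (asm) AE_restrict_space_iff) auto
    \<comment> \<open>The essential supremum bounds almost every point, and an interval of positive
      length must contain one of these.\<close>
    have "\<exists>s\<in>{t/2..t}. ennreal (?w s) * rearrangement f s \<le> LZ_qnorm (ennreal q) c B f"
    proof (rule ccontr)
      assume neg: "\<not> ?thesis"
      have "AE s in lebesgue. s \<notin> {t/2..t}"
        using AE
      proof (rule AE_mp, intro AE_I2 impI)
        fix s assume "s \<in> {0<..} \<longrightarrow> ennreal (?w s) * rearrangement f s \<le> LZ_qnorm (ennreal q) c B f"
        then show "s \<notin> {t/2..t}" using neg t by (cases "0 < s") auto
      qed
      then have "{t/2..t} \<in> null_sets lebesgue" by (subst AE_iff_null_sets) auto
      then have "emeasure lebesgue {t/2..t} = 0" by (simp add: null_sets_def)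
      then show False using t by simp
    qed
    then obtain s where s: "t / 2 \<le> s" "s \<le> t" "ennreal (?w s) * rearrangement f s \<le> LZ_qnorm (ennreal q) c B f" by auto
    have "ennreal (?\<kappa> * ?w t) * rearrangement f t \<le> ennreal (?w s) * rearrangement f s"
      by (rule mult_mono[OF ennreal_leI[OF weight_lower[OF t s(1,2)]] rearrangement_antimono[OF s(2)]]) auto
    with s(3) show ?thesis by simp
  qed
  moreover have "0 < ?\<kappa>" by simp
  ultimately show ?thesis by blast
next
  case (real r)
  have r: "0 < r" using c real by simp
  let ?a = "1 / q - 1 / r"
  let ?\<kappa> = "2 powr (- (\<bar>?a\<bar> + expo B))"
  \<comment> \<open>The factor 2^(-1/r) comes from the length t/2 of the interval, whose power
    t^(1/r) completes the weight t^(1/q - 1/r) to t^(1/q).\<close>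
  let ?K = "2 powr (- (1 / r)) * ?\<kappa>"
  have "ennreal (?K * (t powr (1 / q) * broken_log B t)) * rearrangement f t \<le> LZ_qnorm (ennreal q) c B f"
    if t: "0 < t" for t and f :: "real ^ 'n \<Rightarrow> complex"
  proof -
    let ?w = "\<lambda>s. s powr ?a * broken_log B s"
    let ?X = "ennreal (?\<kappa> * ?w t) * rearrangement f t"
    have "ennreal (t / 2) * ennreal_powr ?X r = (\<integral>\<^sup>+s. ennreal_powr ?X r * indicator {t/2..t} s \<partial>lborel)"
      using t by (subst nn_integral_cmult_indicator) (auto simp: mult.commute)
    also have "\<dots> \<le> (\<integral>\<^sup>+s. ennreal_powr (ennreal (?w s) * rearrangement f s) r * indicator {0<..} s \<partial>lborel)"
    proof (rule nn_integral_mono)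
      fix s
      show "ennreal_powr ?X r * indicator {t/2..t} s \<le> ennreal_powr (ennreal (?w s) * rearrangement f s) r * indicator {0<..} s"
      proof (cases "s \<in> {t/2..t}")
        case True
        then have s: "t / 2 \<le> s" "s \<le> t" by auto
        have "?X \<le> ennreal (?w s) * rearrangement f s"
          by (rule mult_mono[OF ennreal_leI[OF weight_lower[OF t s]] rearrangement_antimono[OF s(2)]]) auto
        then show ?thesis using True t ennreal_powr_mono[OF r] by simp
      qed simp
    qed
    finally have "ennreal_powr (ennreal (t / 2) * ennreal_powr ?X r) (1 / r) \<le> LZ_qnorm (ennreal q) c B f"
      using r q real by (simp add: LZ_qnorm_finite recip_ennreal ennreal_powr_mono)
    moreover have "ennreal_powr (ennreal (t / 2) * ennreal_powr X r) (1 / r) = ennreal ((t / 2) powr (1 / r)) * X" for X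
      using t r by (simp add: ennreal_powr_mult ennreal_powr_powr_inverse)
    moreover have "ennreal ((t / 2) powr (1 / r)) * ?X = ennreal (?K * (t powr (1 / q) * broken_log B t)) * rearrangement f t"
    proof -
      have "(t / 2) powr (1 / r) * (?\<kappa> * ?w t) = ?K * ((t powr (1 / r) * t powr ?a) * broken_log B t)"
        using t by (simp add: powr_divide powr_minus_divide)
      also have "t powr (1 / r) * t powr ?a = t powr (1 / q)" using t by (simp add: powr_add[symmetric])
      finally have eq: "(t / 2) powr (1 / r) * (?\<kappa> * ?w t) = ?K * (t powr (1 / q) * broken_log B t)" .
      have "ennreal x * (ennreal y * F) = ennreal (x * y) * F" if "0 \<le> x" "0 \<le> y" for x y :: real and F :: ennreal
        using that by (simp add: ennreal_mult mult.assoc)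
      from this[of "(t / 2) powr (1 / r)" "?\<kappa> * ?w t" "rearrangement f t"] show ?thesis
        unfolding eq by simp
    qed
    ultimately show ?thesis by simp
  qed
  moreover have "0 < ?K" by simp
  ultimately show ?thesis by blast
qed

lemma rearrangement_le_decay:
  fixes q :: real
  assumes q: "0 < q" and c: "0 < c"
  shows "\<exists>C>0. \<forall>(f :: real ^ 'n::finite \<Rightarrow> complex) t. 0 < t \<longrightarrow>
    rearrangement f t \<le> ennreal (C * decay q B t) * LZ_qnorm (ennreal q) c B f"
proof -
  obtain K where K: "0 < K" "\<And>(f :: real ^ 'n \<Rightarrow> complex) t. 0 < t \<Longrightarrow>
    ennreal (K * (t powr (1 / q) * broken_log B t)) * rearrangement f t \<le> LZ_qnorm (ennreal q) c B f"
    using LZ_qnorm_lower_bound[OF assms, where 'n='n and B=B] by blast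
  have "rearrangement f t \<le> ennreal (1 / K * decay q B t) * LZ_qnorm (ennreal q) c B f"
    if t: "0 < t" for t and f :: "real ^ 'n \<Rightarrow> complex"
  proof -
    let ?Y = "K * (t powr (1 / q) * broken_log B t)"
    have Y: "(1 / K * decay q B t) * ?Y = 1"
      using K(1) t by (simp add: decay_def broken_log_uminus powr_minus field_simps less_imp_neq[OF broken_log_pos, symmetric])
    have "rearrangement f t = ennreal ((1 / K * decay q B t) * ?Y) * rearrangement f t" unfolding Y by simp
    also have "\<dots> = ennreal (1 / K * decay q B t) * (ennreal ?Y * rearrangement f t)"
      using K(1) decay_pos[OF t, of q B] by (subst ennreal_mult) (auto simp: mult.assoc)
    also have "\<dots> \<le> ennreal (1 / K * decay q B t) * LZ_qnorm (ennreal q) c B f"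
      using K(2)[OF t] by (intro mult_left_mono) auto
    finally show ?thesis .
  qed
  then show ?thesis using K(1) by (intro exI[of _ "1 / K"]) auto
qed

text \<open>For \<open>1 < q\<close> the pointwise bound is integrable at 0, as 1/q < 1. For
  \<open>q = 1\<close> and trivial \<open>B\<close> it is 1/t and is not; but with
  \<open>c = 1\<close> the norm is itself the integral of the rearrangement, and T V(T) = 1.\<close>

lemma rearrangement_integral_le_decay:
  fixes q :: real
  assumes "1 \<le> q" "0 < c" "(q = 1 \<and> c = 1 \<and> B = (0, 0)) \<or> 1 < q"
  shows "\<exists>C>0. \<forall>(f :: real ^ 'n::finite \<Rightarrow> complex) T. 0 < T \<longrightarrow>
    (\<integral>\<^sup>+t. rearrangement f t * indicator {0<..<T} t \<partial>lborel) \<le> ennreal (C * (T * decay q B T)) * LZ_qnorm (ennreal q) c B f"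
  using assms(3)
proof
  assume "q = 1 \<and> c = 1 \<and> B = (0, 0)"
  then have e: "q = 1" "c = ennreal 1" "B = (0, 0)" by simp_all
  have "(\<integral>\<^sup>+t. rearrangement f t * indicator {0<..<T} t \<partial>lborel) \<le> ennreal (1 * (T * decay q B T)) * LZ_qnorm (ennreal q) c B f"
    if T: "0 < T" for T and f :: "real ^ 'n \<Rightarrow> complex"
  proof -
    have p1: "ennreal_powr x 1 = x" for x by (cases x) (auto simp: ennreal_powr_def)
    have "LZ_qnorm (ennreal q) c B f = (\<integral>\<^sup>+t. (ennreal (t powr (recip (ennreal 1) - 1) * broken_log (0, 0) t) * rearrangement f t) * indicator {0<..} t \<partial>lborel)"
      unfolding e by (subst LZ_qnorm_finite) (simp_all only: p1 div_by_1 zero_less_one)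
    also have "\<dots> = (\<integral>\<^sup>+t. rearrangement f t * indicator {0<..} t \<partial>lborel)"
      using recip_ennreal[of 1] by (intro nn_integral_cong) (auto simp: broken_log_zero indicator_def)
    finally have N: "LZ_qnorm (ennreal q) c B f = (\<integral>\<^sup>+t. rearrangement f t * indicator {0<..} t \<partial>lborel)" .
    have "T * decay q B T = 1" using T by (simp add: e decay_def broken_log_zero powr_minus)
    moreover have "(\<integral>\<^sup>+t. rearrangement f t * indicator {0<..<T} t \<partial>lborel) \<le> (\<integral>\<^sup>+t. rearrangement f t * indicator {0<..} t \<partial>lborel)"
      by (intro nn_integral_mono) (auto simp: indicator_def)
    ultimately show ?thesis unfolding N by simp
  qed
  then show ?thesis by (intro exI[of _ 1]) simp
next
  assume q: "1 < q"
  \<comment> \<open>Half of the gap between 1/q and 1: one half pays for the logarithm, and because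
    of the other half t^(d - 1) is still integrable at 0.\<close>
  define d where "d = (1 - 1 / q) / 2"
  have d: "0 < d" using q by (simp add: d_def)
  obtain C where C: "0 < C" "\<And>(f :: real ^ 'n \<Rightarrow> complex) t. 0 < t \<Longrightarrow> rearrangement f t \<le> ennreal (C * decay q B t) * LZ_qnorm (ennreal q) c B f"
    using rearrangement_le_decay[of q c, where 'n='n and B=B] q assms(2) by auto
  obtain E where E: "0 < E" "\<And>u. 1 \<le> u \<Longrightarrow> (1 + ln u) powr expo (- B) \<le> E * u powr d"
    using log_le_power[of "expo (- B)" d] d by (auto simp: expo_def)
  have pw: "decay q B t \<le> E * T powr d * broken_log (- B) T * t powr (d - 1)" if t: "0 < t" "t \<le> T" for t T
  proof -
    have "\<bar>ln (t / T)\<bar> = ln (T / t)" using t by (simp add: ln_div)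
    then have "broken_log (- B) t \<le> (1 + ln (T / t)) powr expo (- B) * broken_log (- B) T"
      using broken_log_slow[of t T "- B"] t by simp
    also have "\<dots> \<le> (E * (T / t) powr d) * broken_log (- B) T"
      using t by (intro mult_right_mono E(2)) auto
    finally have "decay q B t \<le> t powr (- (1 / q)) * ((E * (T / t) powr d) * broken_log (- B) T)"
      unfolding decay_def by (intro mult_left_mono) auto
    also have "\<dots> = E * T powr d * broken_log (- B) T * (t powr (- (1 / q)) * t powr (- d))"
      using t by (simp add: powr_divide powr_minus_divide)
    also have "t powr (- (1 / q)) * t powr (- d) = t powr (d - 1)"
    proof -
      have "- u + - ((1 - u) / 2) = (1 - u) / 2 - 1" for u :: real by (simp add: field_simps)
      then have "- (1 / q) + - d = d - 1" unfolding d_def .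
      then show ?thesis by (metis powr_add)
    qed
    finally show ?thesis .
  qed
  have "(\<integral>\<^sup>+t. rearrangement f t * indicator {0<..<T} t \<partial>lborel) \<le> ennreal (C * E / d * (T * decay q B T)) * LZ_qnorm (ennreal q) c B f"
    if T: "0 < T" for T and f :: "real ^ 'n \<Rightarrow> complex"
  proof -
    let ?N = "LZ_qnorm (ennreal q) c B f"
    let ?c = "C * (E * T powr d * broken_log (- B) T)"
    have c0: "0 \<le> ?c" using C(1) E(1) by simp
    have "(\<integral>\<^sup>+t. rearrangement f t * indicator {0<..<T} t \<partial>lborel) \<le>
      (\<integral>\<^sup>+t. (ennreal ?c * ?N) * (ennreal (t powr (d - 1)) * indicator {0<..T} t) \<partial>lborel)"
    proof (rule nn_integral_mono)
      fix t
      show "rearrangement f t * indicator {0<..<T} t \<le> (ennreal ?c * ?N) * (ennreal (t powr (d - 1)) * indicator {0<..T} t)"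
      proof (cases "0 < t \<and> t < T")
        case True
        have "rearrangement f t \<le> ennreal (C * decay q B t) * ?N" using C(2) True by simp
        also have "\<dots> \<le> ennreal (?c * t powr (d - 1)) * ?N"
          using True C(1) mult_left_mono[OF pw[of t T], of C]
          by (intro mult_right_mono ennreal_leI) (auto simp: mult.assoc)
        also have "\<dots> = (ennreal ?c * ?N) * ennreal (t powr (d - 1))"
          by (subst ennreal_mult[OF c0]) (simp_all only: powr_ge_zero mult_ac)
        finally show ?thesis using True by simp
      qed (auto simp: indicator_def)
    qed
    also have "\<dots> = (ennreal ?c * ?N) * (\<integral>\<^sup>+t. ennreal (t powr (d - 1)) * indicator {0<..T} t \<partial>lborel)"
      by (rule nn_integral_cmult) measurable
    also have "\<dots> \<le> (ennreal ?c * ?N) * ennreal (T powr d / d)"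
      by (intro mult_left_mono nn_integral_power_Ioc_le d T) auto
    also have "\<dots> = ennreal (?c * (T powr d / d)) * ?N"
      using c0 d by (subst ennreal_mult) (auto simp: mult_ac)
    also have "?c * (T powr d / d) = C * E / d * ((T powr d * T powr d) * broken_log (- B) T)"
      by simp
    also have "T powr d * T powr d = T powr (1 + - (1 / q))"
      using d by (simp add: powr_add[symmetric] d_def)
    also have "\<dots> = T * T powr (- (1 / q))" using T by (simp add: powr_mult_base)
    finally show ?thesis by (simp add: decay_def mult.assoc)
  qed
  then show ?thesis using C(1) E(1) d by (intro exI[of _ "C * E / d"]) auto
qed

section \<open>The Nikolskii inequality\<close>

lemma lebesgue_ex_borel:
  fixes f :: "'a::euclidean_space \<Rightarrow> complex"
  assumes "f \<in> borel_measurable lebesgue"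
  obtains g where "g \<in> borel_measurable borel" "AE x in lborel. f x = g x"
proof -
  have "(\<lambda>x. Re (f x)) \<in> borel_measurable lebesgue" "(\<lambda>x. Im (f x)) \<in> borel_measurable lebesgue"
    using assms by measurable
  then obtain g h where g: "g \<in> borel_measurable lborel" "AE x in lborel. Re (f x) = g x"
    and h: "h \<in> borel_measurable lborel" "AE x in lborel. Im (f x) = h x"
    using completion_ex_borel_measurable_real by metis
  have "(\<lambda>x. Complex (g x) (h x)) \<in> borel_measurable borel"
    using g(1) h(1) by (simp add: Complex_eq)
  moreover have "AE x in lborel. f x = Complex (g x) (h x)"
    using g(2) h(2) by eventually_elim (simp add: complex_eq_iff)
  ultimately show thesis using that by blast
qed

lemma F1_scale:
  assumes "0 < a" shows "F1 (\<lambda>x. f (1 / a * x)) w = of_real a * F1 f (a * w)"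
proof -
  have "F1 (\<lambda>x. f (1 / a * x)) w = \<bar>a\<bar> *\<^sub>R (\<integral>x. echar ((0 + a * x) * w) * f (1 / a * (0 + a * x)) \<partial>lborel)"
    unfolding F1_def by (rule lborel_integral_real_affine) (use assms in simp)
  then show ?thesis using assms by (simp add: F1_def scaleR_conv_of_real mult_ac)
qed

text \<open>All cutoffs are dilates of a single one. Per coordinate the transform then has L^1 norm
  \<open>a1\<close>, independent of \<open>R\<close>, and supremum at most \<open>2 * R * a\<close>.
  The resulting R^n cancels against the factor \<open>T\<close> in the integral of the
  rearrangement, and this is why the level is taken at T = R^(-n).\<close>

lemma bandlimited_sup_bound:
  fixes q :: real
  assumes hyp: "1 \<le> q" "0 < c" "(q = 1 \<and> c = 1 \<and> B = (0, 0)) \<or> 1 < q"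
  shows "\<exists>C>0. \<forall>R>0. \<forall>f :: real ^ 'n::finite \<Rightarrow> complex. f \<in> LZ_bandlimited R (ennreal q) c B \<longrightarrow>
    (\<forall>t. rearrangement f t \<le> ennreal (C * decay q B (R powr (- real CARD('n)))) * LZ_qnorm (ennreal q) c B f)"
proof -
  obtain CW where CW: "0 < CW" "\<And>(f :: real ^ 'n \<Rightarrow> complex) t. 0 < t \<Longrightarrow> rearrangement f t \<le> ennreal (CW * decay q B t) * LZ_qnorm (ennreal q) c B f"
    using rearrangement_le_decay[of q c, where 'n='n and B=B] hyp by auto
  obtain CI where CI: "0 < CI" "\<And>(f :: real ^ 'n \<Rightarrow> complex) T. 0 < T \<Longrightarrow>
      (\<integral>\<^sup>+t. rearrangement f t * indicator {0<..<T} t \<partial>lborel) \<le> ennreal (CI * (T * decay q B T)) * LZ_qnorm (ennreal q) c B f"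
    using rearrangement_integral_le_decay[OF hyp, where 'n='n] by blast
  let ?k = "F1 cutoff"
  have k: "schwartz1 ?k" by (rule F1_schwartz1[OF test1_cutoff])
  obtain a where a: "0 \<le> a" "\<And>x. norm (?k x) \<le> a" using schwartz1_weighted[OF k, where k=0 and m=0] by auto
  define a1 where "a1 = (\<integral>x. norm (?k x) \<partial>lborel)"
  have a1: "0 \<le> a1" unfolding a1_def by (intro Bochner_Integration.integral_nonneg) auto
  define n where "n = CARD('n)"
  \<comment> \<open>The first two terms come from the parts of \<open>f\<close> below and above the
    level \<open>r\<close>; the summand 1 secures positivity.\<close>
  define C where "C = CW * a1 ^ n + (2 * a) ^ n * CI + 1"
  have C: "0 < C" unfolding C_def using CW(1) CI(1) a a1 by (intro add_nonneg_pos add_nonneg_nonneg mult_nonneg_nonneg) auto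
  have "rearrangement f t \<le> ennreal (C * decay q B (R powr (- real n))) * LZ_qnorm (ennreal q) c B f"
    if R: "0 < R" and f: "f \<in> LZ_bandlimited R (ennreal q) c B" for R and f :: "real ^ 'n \<Rightarrow> complex" and t
  proof -
    define T where "T = R powr (- real n)"
    have T: "0 < T" "R ^ n * T = 1" using R by (auto simp: T_def powr_minus powr_realpow)
    let ?N = "LZ_qnorm (ennreal q) c B f"
    have fm: "f \<in> borel_measurable lebesgue" and "?N < \<infinity>" using f by (auto simp: LZ_bandlimited_def LZ_space_def)
    then obtain N where N: "?N = ennreal N" "0 \<le> N" by (cases ?N) auto
    obtain S where S: "tempered S" "represents f S" "dist_supp (fourier_dist S) \<subseteq> cball 0 R"
      using f by (auto simp: LZ_bandlimited_def)
    \<comment> \<open>The convolution argument lives on \<open>lborel\<close>, so \<open>f\<close>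
      is replaced by a Borel representative. This changes neither the rearrangement nor the
      integrals that represent \<open>S\<close>.\<close>
    obtain g where g [measurable]: "g \<in> borel_measurable borel" and fg: "AE x in lborel. f x = g x"
      using lebesgue_ex_borel[OF fm] .
    have gm: "g \<in> borel_measurable lebesgue" using g by (simp add: measurable_completion)
    have fg': "AE x in lebesgue. f x = g x" using fg by (rule AE_completion)
    have rfg: "rearrangement f = rearrangement g" by (rule rearrangement_cong_AE[OF fm gm fg'])
    let ?V = "decay q B T"
    have V: "0 < ?V" by (rule decay_pos[OF T(1)])
    have rT: "rearrangement g T \<le> ennreal (CW * ?V * N)"
      using CW(2)[OF T(1), of f] CW(1) V N by (simp add: rfg ennreal_mult)
    then obtain r where r: "rearrangement g T = ennreal r" "0 \<le> r" by (cases "rearrangement g T") (auto simp: top_unique)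
    have r_le: "r \<le> CW * ?V * N" using rT r CW(1) V N by (simp add: ennreal_le_iff)
    let ?J = "\<integral>\<^sup>+x. ennreal (norm (g x)) * indicator {x. r < norm (g x)} x \<partial>lborel"
    have "?J \<le> (\<integral>\<^sup>+t. rearrangement g t * indicator {0<..<T} t \<partial>lborel)"
      by (rule nn_integral_large_values_le[OF g r(2) distr_fun_rearrangement[OF g r]])
    also have "\<dots> \<le> ennreal (CI * (T * ?V) * N)"
      using CI(2)[OF T(1), of f] CI(1) T V N by (simp add: rfg ennreal_mult)
    finally have J: "?J \<le> ennreal (CI * (T * ?V) * N)" .
    have gL: "L1_plus_Linf g"
      unfolding L1_plus_Linf_def using r(2) le_less_trans[OF J ennreal_less_top] g by auto
    \<comment> \<open>The dilation makes \<eta> equal to 1 up to \<open>2 * R\<close>, which leaves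
      the strict margin beyond \<open>R\<close> demanded by
      \<open>bandlimited_AE_bound\<close>.\<close>
    define \<eta> where "\<eta> = (\<lambda>x. cutoff (1 / (2 * R) * x))"
    have \<eta>: "test1 \<eta>" unfolding \<eta>_def using R by (intro test1_scale test1_cutoff) auto
    have \<eta>1: "\<eta> x = 1" if "\<bar>x\<bar> \<le> 2 * R" for x
      unfolding \<eta>_def by (rule cutoff_eq_1) (use that R in \<open>simp add: abs_mult\<close>)
    have F\<eta>: "F1 \<eta> w = of_real (2 * R) * ?k (2 * R * w)" for w
      unfolding \<eta>_def by (rule F1_scale) (use R in simp)
    define M where "M = r * a1 ^ n + (2 * R * a) ^ n * (CI * (T * ?V) * N)"
    have M0: "0 \<le> M" unfolding M_def using r a a1 R CI(1) T V N by simp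
    have M: "(\<integral>\<^sup>+x. ennreal (norm (g x * tensor (\<lambda>i. F1 \<eta>) (x - z))) \<partial>lborel) \<le> ennreal M" for z
    proof -
      let ?K = "\<lambda>x. tensor (\<lambda>i. F1 \<eta>) (x - z)"
      have Kint: "integrable lborel ?K" by (rule tensor_translate_integrable[OF F1_schwartz1[OF \<eta>]])
      have [measurable]: "?K \<in> borel_measurable borel" using borel_measurable_integrable[OF Kint] by simp
      have Kb: "norm (?K x) \<le> (2 * R * a) ^ n" for x
      proof -
        have "norm (?K x) \<le> (\<Prod>i\<in>(UNIV :: 'n set). 2 * R * a)"
          unfolding tensor_def prod_norm[symmetric] F\<eta>
          using R a by (intro prod_mono) (auto simp: norm_mult intro!: mult_left_mono)
        then show ?thesis by (simp add: n_def)
      qed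
      have Ki: "(\<integral>\<^sup>+x. ennreal (norm (?K x)) \<partial>lborel) = ennreal (a1 ^ n)"
      proof -
        have one: "(\<integral>t. norm (F1 \<eta> (t - s)) \<partial>lborel) = a1" for s
        proof -
          have "a1 = \<bar>2 * R\<bar> *\<^sub>R (\<integral>t. norm (?k (- (2 * R) * s + 2 * R * t)) \<partial>lborel)"
            unfolding a1_def by (rule lborel_integral_real_affine) (use R in simp)
          also have "\<dots> = (\<integral>t. norm (F1 \<eta> (t - s)) \<partial>lborel)"
            unfolding F\<eta> using R by (simp add: norm_mult algebra_simps)
          finally show ?thesis by simp
        qed
        have i: "integrable lborel (\<lambda>t. norm (F1 \<eta> (t - s)))" for s
          using lborel_integrable_real_affine[OF schwartz1_integrable[OF F1_schwartz1[OF \<eta>]], of 1 "- s"] by simp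
        have "(\<integral>x. norm (?K x) \<partial>lborel) = (\<integral>x. (\<Prod>i\<in>UNIV. norm (F1 \<eta> (x $ i - z $ i))) \<partial>(lborel :: (real ^ 'n) measure))"
          by (simp add: tensor_def prod_norm)
        also have "\<dots> = (\<Prod>i\<in>(UNIV :: 'n set). a1)"
          by (subst integral_prod_vec[OF i]) (simp add: one)
        finally show ?thesis
          using nn_integral_eq_integral[OF integrable_norm[OF Kint]] by (simp add: n_def)
      qed
      have "(\<integral>\<^sup>+x. ennreal (norm (g x * ?K x)) \<partial>lborel) \<le> ennreal r * (\<integral>\<^sup>+x. ennreal (norm (?K x)) \<partial>lborel) + ennreal ((2 * R * a) ^ n) * ?J"
        by (rule nn_integral_mult_split_le[OF _ _ Kb r(2)]) measurable
      also have "\<dots> \<le> ennreal r * ennreal (a1 ^ n) + ennreal ((2 * R * a) ^ n) * ennreal (CI * (T * ?V) * N)"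
        unfolding Ki by (intro add_mono mult_left_mono J) auto
      also have "\<dots> = ennreal M"
        unfolding M_def using r a a1 R CI(1) T V N by (simp add: ennreal_mult ennreal_plus)
      finally show ?thesis .
    qed
    have rep: "S \<phi> = (\<integral>x. g x * \<phi> x \<partial>lborel)" if "\<phi> \<in> test_functions" and [measurable]: "\<phi> \<in> borel_measurable borel" for \<phi>
    proof -
      have \<phi>m: "\<phi> \<in> borel_measurable lebesgue" using that(2) by (simp add: measurable_completion)
      have "S \<phi> = (\<integral>x. f x * \<phi> x \<partial>lebesgue)" using S(2) that(1) by (simp add: represents_def)
      also have "\<dots> = (\<integral>x. g x * \<phi> x \<partial>lebesgue)"
        using fm gm \<phi>m fg' by (intro integral_cong_AE) auto
      also have "\<dots> = (\<integral>x. g x * \<phi> x \<partial>lborel)" by (rule integral_completion) measurable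
      finally show ?thesis .
    qed
    have "AE x in lborel. norm (g x) \<le> M"
      by (rule bandlimited_AE_bound[OF S(1) gL rep S(3) \<eta> \<eta>1 _ M M0]) (use R in auto)
    then have "rearrangement g t \<le> ennreal M"
      by (intro rearrangement_le M0 gm AE_completion)
    also have "M \<le> C * ?V * N"
    proof -
      have "M = r * a1 ^ n + (2 * a) ^ n * CI * (R ^ n * T) * (?V * N)"
        by (simp add: M_def power_mult_distrib mult_ac)
      also have "\<dots> = r * a1 ^ n + (2 * a) ^ n * CI * (?V * N)" by (simp add: T(2))
      also have "\<dots> \<le> (CW * ?V * N) * a1 ^ n + (2 * a) ^ n * CI * (?V * N)"
        using a1 by (intro add_right_mono mult_right_mono r_le) auto
      also have "\<dots> \<le> C * ?V * N"
        using V N(2) mult_nonneg_nonneg[of ?V N] by (simp add: C_def algebra_simps)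
      finally show ?thesis .
    qed
    finally show ?thesis using C V N unfolding rfg[symmetric] T_def[symmetric]
      by (simp add: ennreal_mult rfg ennreal_leI)
  qed
  then show ?thesis using C unfolding n_def by blast
qed

section \<open>The norm with first index infinity, and the passage from T to R\<close>

lemma broken_log_increasing:
  assumes "fst A \<le> 0" "0 \<le> snd A" "0 < t" "t \<le> T"
  shows "broken_log A t \<le> broken_log A T"
proof (cases "T \<le> 1")
  case True
  have "ln t \<le> ln T" "ln T \<le> 0" using assms True by auto
  then have "1 + \<bar>ln T\<bar> \<le> 1 + \<bar>ln t\<bar>" by linarith
  then have "(1 + \<bar>ln t\<bar>) powr fst A \<le> (1 + \<bar>ln T\<bar>) powr fst A"
    using assms(1) by (intro powr_mono2') auto
  then show ?thesis using assms True by (simp add: broken_log_def)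
next
  case False
  show ?thesis
  proof (cases "t \<le> 1")
    case True
    have "(1 + \<bar>ln t\<bar>) powr fst A \<le> (1 + \<bar>ln t\<bar>) powr 0" using assms(1) by (intro powr_mono) auto
    also have "\<dots> \<le> 1" by (simp only: powr_zero_eq_one split: if_split) simp
    finally have "broken_log A t \<le> 1" using True by (simp only: broken_log_def if_True)
    also have "1 \<le> broken_log A T" using False assms by (simp add: broken_log_def ge_one_powr_ge_zero)
    finally show ?thesis .
  next
    case False': False
    have "ln t \<le> ln T" "0 \<le> ln t" using assms False False' by auto
    then have "1 + \<bar>ln t\<bar> \<le> 1 + \<bar>ln T\<bar>" by linarith
    then have "(1 + \<bar>ln t\<bar>) powr snd A \<le> (1 + \<bar>ln T\<bar>) powr snd A"
      using assms(2) by (intro powr_mono2) auto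
    then show ?thesis using False False' by (simp add: broken_log_def)
  qed
qed

text \<open>Only the two bounds on the rearrangement enter, with \<open>N\<close> in the place of
  the norm of \<open>f\<close>. For finite \<open>b\<close>, the constant bound on (0, T] leaves the
  integral of a broken logarithm against 1/t; its extra factor 1 + |ln T| becomes the power
  \<open>recip b\<close> after the root is taken. The tail decays like a power of \<open>t\<close>
  and contributes no further logarithm.\<close>

lemma LZ_qnorm_inf_le:
  fixes q CM CW :: real
  assumes q: "0 < q" and b: "0 < b" and A: "fst A < - recip b" "- recip b < snd A" and C: "0 < CM" "0 < CW"
  shows "\<exists>C>0. \<forall>(f :: real ^ 'n::finite \<Rightarrow> complex) T N. 0 < T \<longrightarrow>
    (\<forall>t. rearrangement f t \<le> ennreal (CM * decay q B T) * N) \<longrightarrow>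
    (\<forall>t>0. rearrangement f t \<le> ennreal (CW * decay q B t) * N) \<longrightarrow>
    LZ_qnorm \<infinity> b A f \<le> ennreal (C * (T powr (- (1 / q)) * broken_log (A - B) T * (1 + \<bar>ln T\<bar>) powr recip b)) * N"
proof -
  \<comment> \<open>Half of the decay exponent 1/q: \<open>t powr d\<close> pays for the variation
    of the logarithms beyond \<open>T\<close>, and \<open>t powr (- d)\<close> remains as
    decay.\<close>
  define d where "d = 1 / (2 * q)"
  have d: "0 < d" "- d - d = - (1 / q)" using q by (auto simp: d_def field_simps)
  obtain E where E: "0 < E" "\<And>u. 1 \<le> u \<Longrightarrow> (1 + ln u) powr expo (A - B) \<le> E * u powr d"
    using log_le_power[of "expo (A - B)" d] d by (auto simp: expo_def)
  define H where "H T = T powr (- (1 / q)) * broken_log (A - B) T" for T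
  have AB: "broken_log A t * broken_log (- B) t = broken_log (A - B) t" for t
    using broken_log_add[of A "- B" t] by simp
  have H0: "0 < H T" if "0 < T" for T using that by (simp add: H_def)
  have HT: "broken_log A T * decay q B T = H T" for T
    unfolding H_def decay_def AB[symmetric] by simp
  have TH: "T powr (- d) * (T powr (- d) * broken_log (A - B) T) = H T" for T
    unfolding H_def d(2)[symmetric] by (simp add: powr_add[symmetric] mult.assoc[symmetric])
  have tail: "broken_log A t * decay q B t \<le> E * (T powr (- d) * broken_log (A - B) T) * t powr (- d)" if t: "0 < T" "T \<le> t" for t T
  proof -
    have "\<bar>ln (t / T)\<bar> = ln (t / T)" using t by simp
    then have "broken_log (A - B) t \<le> (1 + ln (t / T)) powr expo (A - B) * broken_log (A - B) T"
      using broken_log_slow[of t T "A - B"] t by simp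
    also have "\<dots> \<le> (E * (t / T) powr d) * broken_log (A - B) T"
      using t by (intro mult_right_mono E(2)) auto
    finally have "t powr (- (1 / q)) * broken_log (A - B) t \<le> t powr (- (1 / q)) * ((E * (t / T) powr d) * broken_log (A - B) T)"
      by (intro mult_left_mono) auto
    also have "\<dots> = E * (T powr (- d) * broken_log (A - B) T) * (t powr (- (1 / q)) * t powr d)"
      using t by (simp add: powr_divide powr_minus_divide mult_ac)
    also have "t powr (- (1 / q)) * t powr d = t powr (- d)"
    proof -
      have "- (1 / q) + d = - d" using d(2) by linarith
      then show ?thesis by (metis powr_add)
    qed
    finally show ?thesis using HT[of t] by (simp add: H_def)
  qed
  show ?thesis
  proof (cases b)
    case top
    have "LZ_qnorm \<infinity> b A f \<le> ennreal ((CM + CW * E) * (T powr (- (1 / q)) * broken_log (A - B) T * (1 + \<bar>ln T\<bar>) powr recip b)) * N"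
      if T: "0 < T" and M: "\<And>t. rearrangement f t \<le> ennreal (CM * decay q B T) * N"
        and W: "\<And>t. 0 < t \<Longrightarrow> rearrangement f t \<le> ennreal (CW * decay q B t) * N" for f :: "real ^ 'n \<Rightarrow> complex" and T N
    proof -
      let ?g = "\<lambda>t. ennreal (t powr 0 * broken_log A t) * rearrangement f t"
      have gm: "?g \<in> borel_measurable (lebesgue_on {0<..})"
        by (intro measurable_restrict_space1 measurable_completion) measurable
      have "?g t \<le> ennreal ((CM + CW * E) * H T) * N" if t: "0 < t" for t
      proof (cases "t \<le> T")
        case True
        \<comment> \<open>Here \<open>recip b = 0\<close>, so the hypotheses read
          \<open>fst A < 0 < snd A\<close> and the weight is increasing.\<close>
        have "?g t \<le> ennreal (broken_log A T) * (ennreal (CM * decay q B T) * N)"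
          using A top t True by (intro mult_mono M ennreal_leI) (auto intro: broken_log_increasing)
        also have "\<dots> = ennreal (CM * H T) * N"
          unfolding HT[symmetric] using C(1) decay_pos[OF T, of q B]
          by (subst mult.assoc[symmetric], subst ennreal_mult[symmetric]) (auto simp: mult_ac)
        also have "\<dots> \<le> ennreal ((CM + CW * E) * H T) * N"
          using C E(1) H0[OF T] by (intro mult_right_mono ennreal_leI) auto
        finally show ?thesis .
      next
        case False
        have "?g t \<le> ennreal (broken_log A t) * (ennreal (CW * decay q B t) * N)"
          using t by (intro mult_mono W ennreal_leI) auto
        also have "\<dots> = ennreal (CW * (broken_log A t * decay q B t)) * N"
          using C(2) decay_pos[OF t, of q B]
          by (subst mult.assoc[symmetric], subst ennreal_mult[symmetric]) (auto simp: mult_ac)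
        also have "\<dots> \<le> ennreal ((CM + CW * E) * H T) * N"
        proof (intro mult_right_mono ennreal_leI)
          have "broken_log A t * decay q B t \<le> E * (T powr (- d) * broken_log (A - B) T) * t powr (- d)"
            using tail[of T t] T False by simp
          also have "\<dots> \<le> E * (T powr (- d) * broken_log (A - B) T) * T powr (- d)"
            using E(1) T False d(1) by (intro mult_left_mono powr_mono2') auto
          also have "\<dots> = E * H T" using TH[of T] by (simp add: mult_ac)
          finally have "CW * (broken_log A t * decay q B t) \<le> CW * (E * H T)" using C(2) by (intro mult_left_mono) auto
          also have "\<dots> \<le> (CM + CW * E) * H T" using C H0[OF T] by (simp add: algebra_simps)
          finally show "CW * (broken_log A t * decay q B t) \<le> (CM + CW * E) * H T" .
        qed auto
        finally show ?thesis .
      qed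
      then have "AE t in lebesgue_on {0<..}. ?g t \<le> ennreal ((CM + CW * E) * H T) * N"
        by (intro AE_I2) auto
      then have "esssup (lebesgue_on {0<..}) ?g \<le> ennreal ((CM + CW * E) * H T) * N"
        by (intro esssup_I gm)
      then show ?thesis using LZ_qnorm_top[of \<infinity> A f] top abs_ge_zero[of "ln T"] by (simp add: H_def del: abs_ge_zero)
    qed
    moreover have "0 < CM + CW * E" using C E by (simp add: add_pos_pos)
    ultimately show ?thesis by blast
  next
    case (real r)
    have r: "0 < r" using b real by simp
    have rb: "recip b = 1 / r" using real r by (simp add: recip_ennreal)
    \<comment> \<open>Multiplied by \<open>r\<close>, the hypotheses on \<open>A\<close> become
      those of \<open>nn_integral_broken_log_le\<close> for the r-th power of the weight.\<close>
    have "fst (r *\<^sub>R A) < - 1" "- 1 < snd (r *\<^sub>R A)"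
      using A r unfolding rb by (auto simp: field_simps)
    then obtain C3 where C3: "0 < C3" "\<And>T. 0 < T \<Longrightarrow> (\<integral>\<^sup>+t. ennreal (1 / t * broken_log (r *\<^sub>R A) t) * indicator {0<..T} t \<partial>lborel) \<le>
        ennreal (C3 * (broken_log (r *\<^sub>R A) T * (1 + \<bar>ln T\<bar>)))"
      using nn_integral_broken_log_le by blast
    \<comment> \<open>The two terms belong to (0, T] and to the tail, where integrating
      \<open>t powr (- (d * r) - 1)\<close> produces the denominator \<open>d * r\<close>.\<close>
    define C4 where "C4 = CM powr r * C3 + (CW * E) powr r / (d * r)"
    have C4: "0 < C4" unfolding C4_def using C C3 E d r by (intro add_pos_pos mult_pos_pos divide_pos_pos) auto
    have "LZ_qnorm \<infinity> b A f \<le> ennreal (C4 powr (1 / r) * (T powr (- (1 / q)) * broken_log (A - B) T * (1 + \<bar>ln T\<bar>) powr recip b)) * N"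
      if T: "0 < T" and M: "\<And>t. rearrangement f t \<le> ennreal (CM * decay q B T) * N"
        and W: "\<And>t. 0 < t \<Longrightarrow> rearrangement f t \<le> ennreal (CW * decay q B t) * N" for f :: "real ^ 'n \<Rightarrow> complex" and T N
    proof -
      let ?P = "ennreal_powr N r" and ?V = "decay q B T"
      let ?D = "CW * E * (T powr (- d) * broken_log (A - B) T)"
      have V: "0 < ?V" by (rule decay_pos[OF T])
      have D: "0 < ?D" using C E T by simp
      have trp: "(t powr (- (1 / r))) powr r = 1 / t" if "0 < t" for t
        using that r powr_minus_divide[of t 1] by (simp add: powr_powr)
      let ?g = "\<lambda>t. ennreal_powr (ennreal (t powr (recip \<infinity> - 1 / r) * broken_log A t) * rearrangement f t) r * indicator {0<..} t"
      have "(\<integral>\<^sup>+t. ?g t \<partial>lborel) \<le> (\<integral>\<^sup>+t. (ennreal ((CM * ?V) powr r) * ?P) * (ennreal (1 / t * broken_log (r *\<^sub>R A) t) * indicator {0<..T} t) +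
          (ennreal (?D powr r) * ?P) * (ennreal (t powr (- (d * r) - 1)) * indicator {T..} t) \<partial>lborel)"
      proof (rule nn_integral_mono)
        fix t :: real
        consider "t \<le> 0" | "0 < t" "t \<le> T" | "0 < t" "T < t" by linarith
        then show "?g t \<le> (ennreal ((CM * ?V) powr r) * ?P) * (ennreal (1 / t * broken_log (r *\<^sub>R A) t) * indicator {0<..T} t) +
          (ennreal (?D powr r) * ?P) * (ennreal (t powr (- (d * r) - 1)) * indicator {T..} t)"
        proof cases
          case 2
          have "?g t \<le> ennreal_powr (ennreal (t powr (- (1 / r)) * broken_log A t) * (ennreal (CM * ?V) * N)) r"
            using 2 r by (auto intro!: ennreal_powr_mono mult_left_mono M)
          also have "\<dots> = ennreal ((t powr (- (1 / r)) * broken_log A t) powr r) * (ennreal ((CM * ?V) powr r) * ?P)"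
            using r C(1) V by (subst ennreal_powr_mult, simp, simp, subst ennreal_powr_mult) auto
          also have "(t powr (- (1 / r)) * broken_log A t) powr r = 1 / t * broken_log (r *\<^sub>R A) t"
            using 2 by (simp add: powr_mult trp broken_log_powr)
          finally show ?thesis using 2 by (auto simp: mult_ac intro: add_increasing2)
        next
          case 3
          have "?g t \<le> ennreal_powr (ennreal (t powr (- (1 / r)) * broken_log A t) * (ennreal (CW * decay q B t) * N)) r"
            using 3 r by (auto intro!: ennreal_powr_mono mult_left_mono W)
          also have "\<dots> = ennreal_powr (ennreal (t powr (- (1 / r)) * (CW * (broken_log A t * decay q B t))) * N) r"
            using C(2) decay_pos[OF 3(1), of q B]
            by (subst mult.assoc[symmetric], subst ennreal_mult[symmetric]) (auto simp: mult_ac)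
          also have "\<dots> \<le> ennreal_powr (ennreal (t powr (- (1 / r)) * (?D * t powr (- d))) * N) r"
            using tail[of T t] T 3 C(2) mult_left_mono[OF tail[of T t], of CW]
            by (intro ennreal_powr_mono r mult_right_mono ennreal_leI mult_left_mono) (auto simp: mult.assoc)
          also have "\<dots> = ennreal ((t powr (- (1 / r)) * (?D * t powr (- d))) powr r) * ?P"
            using r D by (intro ennreal_powr_mult) auto
          also have "(t powr (- (1 / r)) * (?D * t powr (- d))) powr r = ?D powr r * (1 / t * t powr (- (d * r)))"
            using 3 D r by (simp add: powr_mult trp powr_powr)
          also have "1 / t * t powr (- (d * r)) = t powr (- (d * r) - 1)"
            using 3 by (simp add: powr_diff)
          finally show ?thesis using 3 D by (auto simp: ennreal_mult mult_ac intro: add_increasing)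
        qed simp
      qed
      also have "\<dots> = (ennreal ((CM * ?V) powr r) * ?P) * (\<integral>\<^sup>+t. ennreal (1 / t * broken_log (r *\<^sub>R A) t) * indicator {0<..T} t \<partial>lborel) +
          (ennreal (?D powr r) * ?P) * (\<integral>\<^sup>+t. ennreal (t powr (- (d * r) - 1)) * indicator {T..} t \<partial>lborel)"
        by (subst nn_integral_add) (auto simp: nn_integral_cmult)
      also have "\<dots> \<le> (ennreal ((CM * ?V) powr r) * ?P) * ennreal (C3 * (broken_log (r *\<^sub>R A) T * (1 + \<bar>ln T\<bar>))) +
          (ennreal (?D powr r) * ?P) * ennreal (T powr (- (d * r)) / (d * r))"
        using d r T by (intro add_mono mult_left_mono C3 nn_integral_power_Ici_le) auto
      also have "\<dots> = ennreal ((CM * ?V) powr r * (C3 * (broken_log (r *\<^sub>R A) T * (1 + \<bar>ln T\<bar>))) + ?D powr r * (T powr (- (d * r)) / (d * r))) * ?P"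
      proof -
        have n1: "0 \<le> C3 * (broken_log (r *\<^sub>R A) T * (1 + \<bar>ln T\<bar>))" and n2: "0 \<le> T powr (- (d * r)) / (d * r)"
          using C3 d r by auto
        have "(ennreal x * P) * ennreal y + (ennreal u * P) * ennreal v = ennreal (x * y + u * v) * P"
          if "0 \<le> x" "0 \<le> y" "0 \<le> u" "0 \<le> v" for x y u v :: real and P :: ennreal
          using that by (simp add: ennreal_mult ennreal_plus distrib_left distrib_right mult_ac)
        then show ?thesis using n1 n2 by (simp only: powr_ge_zero)
      qed
      also have "\<dots> \<le> ennreal (C4 * (H T powr r * (1 + \<bar>ln T\<bar>))) * ?P"
      proof (intro mult_right_mono ennreal_leI)
        have "(CM * ?V) powr r * (C3 * (broken_log (r *\<^sub>R A) T * (1 + \<bar>ln T\<bar>))) = CM powr r * C3 * (H T powr r * (1 + \<bar>ln T\<bar>))"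
          using C(1) V by (simp add: HT[symmetric] powr_mult broken_log_powr[symmetric])
        moreover have "?D powr r * (T powr (- (d * r)) / (d * r)) = (CW * E) powr r / (d * r) * H T powr r"
        proof -
          have "?D powr r * T powr (- (d * r)) = (CW * E) powr r * H T powr r"
            unfolding TH[symmetric] using C E by (simp add: powr_mult powr_powr mult_ac)
          then show ?thesis by simp
        qed
        moreover have "(CW * E) powr r / (d * r) * H T powr r \<le> (CW * E) powr r / (d * r) * (H T powr r * (1 + \<bar>ln T\<bar>))"
          using d r by (intro mult_left_mono) (auto simp: algebra_simps)
        moreover have "C4 * X = CM powr r * C3 * X + (CW * E) powr r / (d * r) * X" for X
          unfolding C4_def by (rule distrib_right)
        ultimately show "(CM * ?V) powr r * (C3 * (broken_log (r *\<^sub>R A) T * (1 + \<bar>ln T\<bar>))) + ?D powr r * (T powr (- (d * r)) / (d * r)) \<le> C4 * (H T powr r * (1 + \<bar>ln T\<bar>))"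
          by (simp only: add_left_mono)
      qed auto
      finally have "ennreal_powr (\<integral>\<^sup>+t. ?g t \<partial>lborel) (1 / r) \<le> ennreal_powr (ennreal (C4 * (H T powr r * (1 + \<bar>ln T\<bar>))) * ?P) (1 / r)"
        using r by (intro ennreal_powr_mono) auto
      also have "\<dots> = ennreal ((C4 * (H T powr r * (1 + \<bar>ln T\<bar>))) powr (1 / r)) * N"
        using r C4 by (subst ennreal_powr_mult) (auto simp: ennreal_powr_powr_inverse)
      also have "(C4 * (H T powr r * (1 + \<bar>ln T\<bar>))) powr (1 / r) = C4 powr (1 / r) * (H T * (1 + \<bar>ln T\<bar>) powr recip b)"
        using C4 r H0[OF T] by (simp add: powr_mult powr_powr rb)
      finally show ?thesis using LZ_qnorm_finite[OF r, of \<infinity> A f] real by (simp add: H_def)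
    qed
    moreover have "0 < C4 powr (1 / r)" using C4 by simp
    ultimately show ?thesis by blast
  qed
qed

text \<open>Since the logarithm of R^(-n) is - n ln R, the two branches trade places, which produces
  the swapped pairs. The factor n inside the logarithm costs only a constant, and the power \<beta>
  of the logarithm is merged into both exponents.\<close>

lemma broken_log_dilation:
  fixes n :: nat and q \<beta> :: real
  assumes n: "1 \<le> n"
  shows "\<exists>C>0. \<forall>R>0. (R powr (- real n)) powr (- (1 / q)) * broken_log (A - B) (R powr (- real n)) * (1 + \<bar>ln (R powr (- real n))\<bar>) powr \<beta>
    \<le> C * (R powr (real n / q) * broken_log (prod.swap A - prod.swap B + (\<beta>, \<beta>)) R)"
proof -
  define C where "C = real n powr (\<bar>fst (A - B) + \<beta>\<bar> + \<bar>snd (A - B) + \<beta>\<bar>)"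
  have n1: "1 \<le> real n" using n by simp
  have aux: "(1 + real n * L) powr \<gamma> \<le> C * (1 + L) powr \<gamma>"
    if L: "0 \<le> L" and \<gamma>: "\<bar>\<gamma>\<bar> \<le> \<bar>fst (A - B) + \<beta>\<bar> + \<bar>snd (A - B) + \<beta>\<bar>" for L \<gamma>
  proof (cases "0 \<le> \<gamma>")
    case True
    have "1 + real n * L \<le> real n * (1 + L)" using n1 by (simp add: distrib_left)
    then have "(1 + real n * L) powr \<gamma> \<le> (real n * (1 + L)) powr \<gamma>" using True L by (intro powr_mono2) auto
    also have "\<dots> = real n powr \<gamma> * (1 + L) powr \<gamma>" using L by (simp add: powr_mult)
    also have "\<dots> \<le> C * (1 + L) powr \<gamma>"
      unfolding C_def using True \<gamma> n1 by (intro mult_right_mono powr_mono) auto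
    finally show ?thesis .
  next
    case False
    have "1 * L \<le> real n * L" using n1 L by (intro mult_right_mono) auto
    then have "(1 + real n * L) powr \<gamma> \<le> 1 * (1 + L) powr \<gamma>" using False L by (simp add: powr_mono2')
    also have "\<dots> \<le> C * (1 + L) powr \<gamma>"
      unfolding C_def using n1 by (intro mult_right_mono ge_one_powr_ge_zero) auto
    finally show ?thesis .
  qed
  have "(R powr (- real n)) powr (- (1 / q)) * broken_log (A - B) (R powr (- real n)) * (1 + \<bar>ln (R powr (- real n))\<bar>) powr \<beta>
    \<le> C * (R powr (real n / q) * broken_log (prod.swap A - prod.swap B + (\<beta>, \<beta>)) R)" if R: "0 < R" for R
  proof -
    let ?T = "R powr (- real n)" and ?S = "prod.swap A - prod.swap B + (\<beta>, \<beta>)"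
    have lT: "\<bar>ln ?T\<bar> = real n * \<bar>ln R\<bar>" using R by (simp add: ln_powr abs_mult)
    have "broken_log (A - B) ?T * (1 + \<bar>ln ?T\<bar>) powr \<beta> \<le> C * broken_log ?S R"
    \<comment> \<open>At \<open>R = 1\<close> both \<open>R\<close> and \<open>?T\<close> fall into
      the branch \<open>\<le> 1\<close>, so the exchange of branches fails; but all logarithms
      vanish there and both broken logarithms are 1.\<close>
    proof (cases "R = 1")
      case True
      then show ?thesis using n1 by (simp add: broken_log_def C_def ge_one_powr_ge_zero)
    next
      case False
      define \<gamma> where "\<gamma> = (if R \<le> 1 then snd (A - B) + \<beta> else fst (A - B) + \<beta>)"
      have iff: "?T \<le> 1 \<longleftrightarrow> \<not> R \<le> 1"
      proof -
        have "ln ?T = - (real n * ln R)" using R by (simp add: ln_powr)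
        moreover have "?T \<le> 1 \<longleftrightarrow> ln ?T \<le> 0" by (rule ln_le_zero_iff[symmetric]) (use R in simp)
        moreover have "0 \<le> real n * ln R \<longleftrightarrow> 0 \<le> ln R" using n1 by (simp add: zero_le_mult_iff)
        moreover have "0 \<le> ln R \<longleftrightarrow> 1 \<le> R" using R by simp
        ultimately show ?thesis using False by linarith
      qed
      have "broken_log (A - B) ?T * (1 + \<bar>ln ?T\<bar>) powr \<beta> = (1 + real n * \<bar>ln R\<bar>) powr \<gamma>"
        unfolding broken_log_def lT iff \<gamma>_def by (auto simp: powr_add)
      also have "\<dots> \<le> C * (1 + \<bar>ln R\<bar>) powr \<gamma>" by (rule aux) (auto simp: \<gamma>_def)
      also have "(1 + \<bar>ln R\<bar>) powr \<gamma> = broken_log ?S R"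
        by (simp add: broken_log_def \<gamma>_def)
      finally show ?thesis .
    qed
    then have "R powr (real n / q) * (broken_log (A - B) ?T * (1 + \<bar>ln ?T\<bar>) powr \<beta>) \<le> R powr (real n / q) * (C * broken_log ?S R)"
      by (intro mult_left_mono) auto
    moreover have "?T powr (- (1 / q)) = R powr (real n / q)" by (simp add: powr_powr)
    ultimately show ?thesis by (simp add: mult_ac)
  qed
  moreover have "0 < C" using n1 by (simp add: C_def)
  ultimately show ?thesis by blast
qed

theorem theorem13:
  fixes q :: real and b c :: ennreal and A B :: "real \<times> real"
  assumes "1 \<le> q" and "0 < c"
    and "(q = 1 \<and> c = 1 \<and> B = (0, 0)) \<or> 1 < q"
    and "0 < b"
    and "fst A < - recip b" and "- recip b < snd A"
  shows "\<exists>C>0. \<forall>R>0. \<forall>f :: real ^ 'n \<Rightarrow> complex. f \<in> LZ_bandlimited R (ennreal q) c B \<longrightarrow>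
    LZ_qnorm \<infinity> b A f \<le>
      ennreal (C * R powr (real CARD('n) / q)
        * broken_log (prod.swap A - prod.swap B + (recip b, recip b)) R)
      * LZ_qnorm (ennreal q) c B f"
proof -
  have q: "0 < q" using assms(1) by simp
  obtain CM where CM: "0 < CM" "\<And>R (f :: real ^ 'n \<Rightarrow> complex) t. 0 < R \<Longrightarrow> f \<in> LZ_bandlimited R (ennreal q) c B \<Longrightarrow>
      rearrangement f t \<le> ennreal (CM * decay q B (R powr (- real CARD('n)))) * LZ_qnorm (ennreal q) c B f"
    using bandlimited_sup_bound[OF assms(1-3), where 'n='n] by blast
  obtain CW where CW: "0 < CW" "\<And>(f :: real ^ 'n \<Rightarrow> complex) t. 0 < t \<Longrightarrow>
      rearrangement f t \<le> ennreal (CW * decay q B t) * LZ_qnorm (ennreal q) c B f"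
    using rearrangement_le_decay[OF q assms(2), where 'n='n and B=B] by blast
  obtain C1 where C1: "0 < C1" "\<And>(f :: real ^ 'n \<Rightarrow> complex) T N. 0 < T \<Longrightarrow>
      (\<And>t. rearrangement f t \<le> ennreal (CM * decay q B T) * N) \<Longrightarrow>
      (\<And>t. 0 < t \<Longrightarrow> rearrangement f t \<le> ennreal (CW * decay q B t) * N) \<Longrightarrow>
      LZ_qnorm \<infinity> b A f \<le> ennreal (C1 * (T powr (- (1 / q)) * broken_log (A - B) T * (1 + \<bar>ln T\<bar>) powr recip b)) * N"
    using LZ_qnorm_inf_le[OF q assms(4-6) CM(1) CW(1), where 'n='n and B=B] by blast
  obtain C2 where C2: "0 < C2" "\<And>R. 0 < R \<Longrightarrow> (R powr (- real CARD('n))) powr (- (1 / q)) * broken_log (A - B) (R powr (- real CARD('n)))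
      * (1 + \<bar>ln (R powr (- real CARD('n)))\<bar>) powr recip b
    \<le> C2 * (R powr (real CARD('n) / q) * broken_log (prod.swap A - prod.swap B + (recip b, recip b)) R)"
    using broken_log_dilation[of "CARD('n)" q A B "recip b"] by (auto simp: Suc_le_eq)
  have "LZ_qnorm \<infinity> b A f \<le> ennreal (C1 * C2 * R powr (real CARD('n) / q)
        * broken_log (prod.swap A - prod.swap B + (recip b, recip b)) R) * LZ_qnorm (ennreal q) c B f"
    if R: "0 < R" and f: "f \<in> LZ_bandlimited R (ennreal q) c B" for R and f :: "real ^ 'n \<Rightarrow> complex"
  \<comment> \<open>The splitting point is \<open>T = R powr (- real CARD('n))\<close>, the same at
    which the supremum bound was taken, so that the two estimates fit together.\<close>
  proof (rule order_trans[OF C1(2)[of "R powr (- real CARD('n))" f "LZ_qnorm (ennreal q) c B f"]])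
    show "ennreal (C1 * ((R powr (- real CARD('n))) powr (- (1 / q)) * broken_log (A - B) (R powr (- real CARD('n)))
        * (1 + \<bar>ln (R powr (- real CARD('n)))\<bar>) powr recip b)) * LZ_qnorm (ennreal q) c B f
      \<le> ennreal (C1 * C2 * R powr (real CARD('n) / q)
        * broken_log (prod.swap A - prod.swap B + (recip b, recip b)) R) * LZ_qnorm (ennreal q) c B f"
      using mult_left_mono[OF C2(2)[OF R], of C1] C1(1)
      by (intro mult_right_mono ennreal_leI) (auto simp: mult.assoc)
  qed (use R CM(2)[OF R f] CW(2) in auto)
  then show ?thesis using C1(1) C2(1) by (intro exI[of _ "C1 * C2"]) auto
qed

end
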